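(* Let $p$ be a prime and let $(\mathcal M,\mathbf N,\mathbf J)$ be an arithmetic $\mathcal G$-family of $\mathbb Z_p[\mathcal G]$-modules. For every irreducible rational character $\chi$ of $\mathcal G$, put $\mathcal M^{\rm ar}_\chi:=\{x\in\mathcal M_{K_\chi},\ \mathbf N_{K_\chi/k}(x)=1\ \text{for all subfields }k\subsetneq K_\chi\}$ and, for each irreducible $p$-adic character $\varphi\mid\chi$, $\mathcal M^{\rm ar}_\varphi:=\{x\in\mathcal M_{K_\chi},\ x^{P_\varphi(\sigma_\chi)}=1\ \text{and}\ \mathbf N_{K_\chi/k}(x)=1\ \text{for all subfields } k\subsetneq K_\chi\}$. Then $$\mathcal M^{\rm ar}_\chi=\bigoplus_{\varphi\mid\chi}\mathcal M^{\rm ar}_\varphi .$$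
   Context: $\mathbb Q^{\rm ab}$ is the maximal abelian extension of $\mathbb Q$, $\mathcal G:=\mathrm{Gal}(\mathbb Q^{\rm ab}/\mathbb Q)$, and $\mathcal K$ is the set of finite extensions of $\mathbb Q$ contained in $\mathbb Q^{\rm ab}$. An arithmetic $\mathcal G$-family of $\mathbb Z_p[\mathcal G]$-modules consists of (multiplicatively written) $\mathbb Z_p[\mathcal G]$-modules $\mathcal M_K$, $K\in\mathcal K$, and, for $k\subseteq K$ in $\mathcal K$, of $\mathbb Z_p[\mathcal G]$-module homomorphisms $\mathbf N_{K/k}:\mathcal M_K\to\mathcal M_k$ and $\mathbf J_{K/k}:\mathcal M_k\to\mathcal M_K$ such that: (a) $\mathrm{Gal}(\mathbb Q^{\rm ab}/K)$ acts trivially on $\mathcal M_K$; (b) $\mathbf N_{K/k}\circ\mathbf N_{L/K}=\mathbf N_{L/k}$ and $\mathbf J_{L/K}\circ\mathbf J_{K/k}=\mathbf J_{L/k}$ for $k\subseteq K\subseteq L$; (c) $\mathbf J_{K/k}\circ\mathbf N_{K/k}=\nu_{K/k}:=\sum_{\sigma\in\mathrm{Gal}(K/k)}\sigma$ on $\mathcal M_K$. Let $\psi$ denote degree one characters of finite order of $\mathcal G$ with values in $\overline{\mathbb Q}_p$. An irreducible rational (resp. $p$-adic) character $\chi$ (resp. $\varphi$) is the sum of the conjugates over $\mathbb Q$ (resp. $\mathbb Q_p$) of some $\psi$; $\psi\mid\varphi\mid\chi$ means being a term of. $g_\chi$ is the order of any $\psi\mid\chi$, $K_\chi$ is the field fixed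 by $\mathrm{Ker}(\psi)$, $G_\chi=\mathrm{Gal}(K_\chi/\mathbb Q)=\langle\sigma_\chi\rangle$ is cyclic of order $g_\chi$, and $P_\varphi(X):=\prod_{\psi\mid\varphi}(X-\psi(\sigma_\chi))\in\mathbb Z_p[X]$. *)

theory Defs
  imports
    "HOL-Algebra.Bij"
    "HOL-Algebra.Module"
    "HOL-Algebra.Generated_Groups"
    "HOL-Algebra.Generated_Fields"
    "HOL-Algebra.Embedded_Algebras"
    "HOL-Algebra.QuotRing"
    "HOL-Algebra.Algebraic_Closure_Type"
    "HOL-Computational_Algebra.Computational_Algebra"
    "Berlekamp_Zassenhaus.Finite_Field"
    Complex_Main
begin

section \<open>The p-adic integers\<close>

text \<open>
  The prime p is the cardinality of the type \<open>'p\<close>, which ranges over the class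
  \<open>prime_card\<close>. The p-adic integers are the inverse limit of the rings Z/p^n, each of
  which is represented by its residues 0, ..., p^n - 1.
\<close>

definition padic_seqs :: "nat \<Rightarrow> (nat \<Rightarrow> int) set" where
  "padic_seqs p = {x. \<forall>n. x n \<in> {0..<int p ^ n} \<and> x (Suc n) mod int p ^ n = x n}"

typedef 'p padic_int = "padic_seqs CARD('p::prime_card)"
  by (rule exI[of _ "\<lambda>_. 0"]) (simp add: padic_seqs_def zero_less_card_finite)

setup_lifting type_definition_padic_int

lemma prime_card_int_pos: "(0::int) < int CARD('p::prime_card) ^ n"
  by simp

lemma padic_seqsI:
  fixes f :: "nat \<Rightarrow> int"
  assumes "\<And>n. f (Suc n) mod int CARD('p::prime_card) ^ n = f n mod int CARD('p) ^ n"
  shows "(\<lambda>n. f n mod int CARD('p) ^ n) \<in> padic_seqs CARD('p)"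
  unfolding padic_seqs_def
proof (clarify, intro conjI)
  fix n
  show "f n mod int CARD('p) ^ n \<in> {0..<int CARD('p) ^ n}"
    using prime_card_int_pos[where 'p = 'p, of n]
    by (simp add: pos_mod_sign pos_mod_bound del: zero_less_power)
  have "f (Suc n) mod int CARD('p) ^ Suc n mod int CARD('p) ^ n = f (Suc n) mod int CARD('p) ^ n"
    by (rule mod_mod_cancel) simp
  then show "f (Suc n) mod int CARD('p) ^ Suc n mod int CARD('p) ^ n = f n mod int CARD('p) ^ n"
    using assms by simp
qed

lemma padic_seqsD:
  assumes "x \<in> padic_seqs CARD('p::prime_card)"
  shows "x (Suc n) mod int CARD('p) ^ n = x n" "x n mod int CARD('p) ^ n = x n"
  using assms by (auto simp: padic_seqs_def)

lemma padic_seqs_mod: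
  assumes "x \<in> padic_seqs CARD('p::prime_card)" "n \<le> m"
  shows "x m mod int CARD('p) ^ n = x n"
  using assms(2)
proof (induction m rule: dec_induct)
  case base
  show ?case using padic_seqsD(2)[OF assms(1)] .
next
  case (step m)
  have "x (Suc m) mod int CARD('p) ^ n = x (Suc m) mod int CARD('p) ^ m mod int CARD('p) ^ n"
    using step.hyps by (simp add: mod_mod_cancel le_imp_power_dvd)
  then show ?case using step.IH padic_seqsD(1)[OF assms(1)] by simp
qed

instantiation padic_int :: (prime_card) comm_ring_1
begin

lift_definition zero_padic_int :: "'a padic_int" is "\<lambda>n. 0 mod int CARD('a) ^ n"
  by (rule padic_seqsI) simp

lift_definition one_padic_int :: "'a padic_int" is "\<lambda>n. 1 mod int CARD('a) ^ n"
  by (rule padic_seqsI) simp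

lift_definition plus_padic_int :: "'a padic_int \<Rightarrow> 'a padic_int \<Rightarrow> 'a padic_int"
  is "\<lambda>x y n. (x n + y n) mod int CARD('a) ^ n"
  by (rule padic_seqsI, rule mod_add_cong) (auto simp: padic_seqsD)

lift_definition uminus_padic_int :: "'a padic_int \<Rightarrow> 'a padic_int"
  is "\<lambda>x n. (- x n) mod int CARD('a) ^ n"
  by (rule padic_seqsI, rule mod_minus_cong) (auto simp: padic_seqsD)

lift_definition minus_padic_int :: "'a padic_int \<Rightarrow> 'a padic_int \<Rightarrow> 'a padic_int"
  is "\<lambda>x y n. (x n - y n) mod int CARD('a) ^ n"
  by (rule padic_seqsI, rule mod_diff_cong) (auto simp: padic_seqsD)

lift_definition times_padic_int :: "'a padic_int \<Rightarrow> 'a padic_int \<Rightarrow> 'a padic_int"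
  is "\<lambda>x y n. (x n * y n) mod int CARD('a) ^ n"
  by (rule padic_seqsI, rule mod_mult_cong) (auto simp: padic_seqsD)

instance
proof
  fix a b c :: "'a padic_int"
  show "a * b * c = a * (b * c)"
    by transfer (auto simp: fun_eq_iff mod_simps algebra_simps)
  show "a * b = b * a"
    by transfer (auto simp: fun_eq_iff mult.commute)
  show "1 * a = a"
    by transfer (auto simp: fun_eq_iff mod_simps padic_seqsD)
  show "a + b + c = a + (b + c)"
    by transfer (auto simp: fun_eq_iff mod_simps algebra_simps)
  show "a + b = b + a"
    by transfer (auto simp: fun_eq_iff add.commute)
  show "0 + a = a"
    by transfer (auto simp: fun_eq_iff padic_seqsD)
  show "- a + a = 0"
    by transfer (auto simp: fun_eq_iff mod_simps)
  show "a - b = a + - b"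
    by transfer (auto simp: fun_eq_iff mod_simps)
  show "(a + b) * c = a * c + b * c"
    by transfer (auto simp: fun_eq_iff mod_simps algebra_simps)
  show "(0 :: 'a padic_int) \<noteq> 1"
  proof transfer
    have "(1::int) < int CARD('a)"
      using prime_gt_1_nat[OF prime_card[where 'a = 'a]] by linarith
    then have "(1::int) mod int CARD('a) = 1"
      by (intro mod_pos_pos_trivial) auto
    then show "(\<lambda>n. 0 mod int CARD('a) ^ n) \<noteq> (\<lambda>n. 1 mod int CARD('a) ^ n)"
      by (metis mod_0 power_one_right zero_neq_one)
  qed
qed

end

instance padic_int :: (prime_card) idom
proof
  fix a b :: "'a padic_int"
  assume "a \<noteq> 0" "b \<noteq> 0"
  then show "a * b \<noteq> 0"
  proof transfer
    fix x y :: "nat \<Rightarrow> int"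
    assume x: "x \<in> padic_seqs CARD('a)" and y: "y \<in> padic_seqs CARD('a)"
      and "x \<noteq> (\<lambda>n. 0 mod int CARD('a) ^ n)" "y \<noteq> (\<lambda>n. 0 mod int CARD('a) ^ n)"
    then obtain m n where mn: "x m \<noteq> 0" "y n \<noteq> 0" by (auto simp: fun_eq_iff)
    define p where "p = int CARD('a)"
    have p: "Factorial_Ring.prime p" unfolding p_def by (rule prime_card_int)
    have "\<not> p ^ m dvd x (m + n)" "\<not> p ^ n dvd y (m + n)"
      using padic_seqs_mod[OF x, of m "m + n"] padic_seqs_mod[OF y, of n "m + n"] mn
      by (auto simp: p_def dvd_eq_mod_eq_0)
    moreover from this have "x (m + n) \<noteq> 0" "y (m + n) \<noteq> 0" by auto
    ultimately have "\<not> p ^ (m + n) dvd x (m + n) * y (m + n)"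
      using p by (auto simp: power_dvd_iff_le_multiplicity prime_elem_multiplicity_mult_distrib
          not_le not_prime_unit prime_imp_prime_elem)
    then show "(\<lambda>n. x n * y n mod int CARD('a) ^ n) \<noteq> (\<lambda>n. 0 mod int CARD('a) ^ n)"
      by (auto simp: fun_eq_iff p_def dvd_eq_mod_eq_0)
  qed
qed

lemma of_nat_padic_int:
  "Rep_padic_int (of_nat k :: 'p::prime_card padic_int) = (\<lambda>n. int k mod int CARD('p) ^ n)"
  by (induction k)
     (auto simp: zero_padic_int.rep_eq one_padic_int.rep_eq plus_padic_int.rep_eq mod_simps)

instance padic_int :: (prime_card) ring_char_0
proof
  show "inj (of_nat :: nat \<Rightarrow> 'a padic_int)"
  proof (rule injI)
    fix j k :: nat
    assume eq: "(of_nat j :: 'a padic_int) = of_nat k"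
    define n where "n = max j k"
    have "max j k < CARD('a) ^ n"
      unfolding n_def by (rule power_gt_expt) (use prime_gt_1_nat[OF prime_card[where 'a = 'a]] in simp)
    then have "j < CARD('a) ^ n" "k < CARD('a) ^ n" by auto
    moreover have "int j mod int CARD('a) ^ n = int k mod int CARD('a) ^ n"
      using arg_cong[OF eq, of "\<lambda>x. Rep_padic_int x n"] by (simp add: of_nat_padic_int)
    then have "j mod CARD('a) ^ n = k mod CARD('a) ^ n"
      by (metis of_nat_eq_iff of_nat_mod of_nat_power)
    ultimately show "j = k" by simp
  qed
qed

instance fract :: ("{idom, ring_char_0}") field_char_0
proof
  have "(of_nat n :: 'a fract) = Fract (of_nat n) 1" for n
    by (induction n) (auto simp: Zero_fract_def One_fract_def)
  then show "inj (of_nat :: nat \<Rightarrow> 'a fract)"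
    by (auto intro!: injI simp: eq_fract)
qed

type_synonym 'p padic_closure = "'p padic_int fract alg_closure"

definition padic_int_emb :: "'p::prime_card padic_int \<Rightarrow> 'p padic_closure" where
  "padic_int_emb a = to_ac (Fract a 1)"

definition Qp :: "'p::prime_card padic_closure set" where
  "Qp = range to_ac"


section \<open>Galois groups and the maximal abelian extension of Q\<close>

abbreviation type_ring :: "'a::field ring" where
  "type_ring \<equiv> ring_of_type_algebra"

definition gal_group :: "'a::field set \<Rightarrow> 'a set \<Rightarrow> ('a \<Rightarrow> 'a) monoid" where
  "gal_group L F = BijGroup L \<lparr>carrier :=
     {\<sigma> \<in> Bij L. \<sigma> \<in> ring_iso (type_ring\<lparr>carrier := L\<rparr>) (type_ring\<lparr>carrier := L\<rparr>) \<and>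
        (\<forall>x\<in>F. \<sigma> x = x)}\<rparr>"

definition finite_extension_Q :: "complex set \<Rightarrow> bool" where
  "finite_extension_Q K \<longleftrightarrow>
     subfield K type_ring \<and> ring.finite_dimension type_ring \<rat> K"

definition finite_abelian_extension_Q :: "complex set \<Rightarrow> bool" where
  "finite_abelian_extension_Q K \<longleftrightarrow>
     finite_extension_Q K \<and>
     {x \<in> K. \<forall>\<sigma>\<in>carrier (gal_group K \<rat>). \<sigma> x = x} = \<rat> \<and>
     comm_group (gal_group K \<rat>)"

text \<open>The maximal abelian extension is the compositum, inside the complex numbers, of all
  finite abelian extensions.\<close>

definition Qab :: "complex set" where
  "Qab = generate_field type_ring (\<Union>{K. finite_abelian_extension_Q K})"

type_synonym qab_aut = "complex \<Rightarrow> complex"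

definition GalQab :: "qab_aut monoid" (\<open>\<G>\<close>) where
  "\<G> = gal_group Qab \<rat>"

definition finite_subextensions :: "complex set set" (\<open>\<K>\<close>) where
  "\<K> = {K. finite_extension_Q K \<and> K \<subseteq> Qab}"

text \<open>An element of Gal(K/Q) acts on a module on which Gal(Qab/K) acts trivially, and can be
  inserted into a character that is trivial on Gal(Qab/K), through any of its extensions to
  Qab; the result does not depend on the extension.\<close>

definition lift_aut :: "complex set \<Rightarrow> (complex \<Rightarrow> complex) \<Rightarrow> qab_aut" where
  "lift_aut K \<tau> = (SOME \<sigma>. \<sigma> \<in> carrier \<G> \<and> restrict \<sigma> K = \<tau>)"


section \<open>Group rings, module homomorphisms and direct sums\<close>

definition group_ring :: "('g, 'm) monoid_scheme \<Rightarrow> ('g \<Rightarrow> 'r::comm_ring_1) ring" where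
  "group_ring G =
     \<lparr>carrier = {f. finite {\<sigma>. f \<sigma> \<noteq> 0} \<and> {\<sigma>. f \<sigma> \<noteq> 0} \<subseteq> carrier G},
      monoid.mult = (\<lambda>f g \<tau>. \<Sum>(\<alpha>, \<beta>) \<in> {(\<alpha>, \<beta>). f \<alpha> \<noteq> 0 \<and> g \<beta> \<noteq> 0 \<and> \<alpha> \<otimes>\<^bsub>G\<^esub> \<beta> = \<tau>}. f \<alpha> * g \<beta>),
      one = (\<lambda>\<tau>. if \<tau> = \<one>\<^bsub>G\<^esub> then 1 else 0),
      ring.zero = (\<lambda>\<tau>. 0),
      add = (\<lambda>f g \<tau>. f \<tau> + g \<tau>)\<rparr>"

definition gr_single :: "'r::comm_ring_1 \<Rightarrow> 'g \<Rightarrow> 'g \<Rightarrow> 'r" where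
  "gr_single c \<sigma> = (\<lambda>\<tau>. if \<tau> = \<sigma> then c else 0)"

definition gr_poly :: "('g, 'm) monoid_scheme \<Rightarrow> 'r::comm_ring_1 poly \<Rightarrow> 'g \<Rightarrow> 'g \<Rightarrow> 'r" where
  "gr_poly G P \<sigma> =
     finsum (group_ring G) (\<lambda>i. gr_single (coeff P i) (\<sigma> [^]\<^bsub>G\<^esub> i)) {..degree P}"

definition module_hom ::
  "('r, 'x) ring_scheme \<Rightarrow> ('r, 'a, 'y) module_scheme \<Rightarrow> ('r, 'b, 'z) module_scheme \<Rightarrow> ('a \<Rightarrow> 'b) set"
where
  "module_hom R A B = {f. f \<in> carrier A \<rightarrow> carrier B \<and>
     (\<forall>x\<in>carrier A. \<forall>y\<in>carrier A. f (x \<oplus>\<^bsub>A\<^esub> y) = f x \<oplus>\<^bsub>B\<^esub> f y) \<and>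
     (\<forall>r\<in>carrier R. \<forall>x\<in>carrier A. f (r \<odot>\<^bsub>A\<^esub> x) = r \<odot>\<^bsub>B\<^esub> f x)}"

text \<open>The submodule \<open>A\<close> of \<open>M\<close> is the internal direct sum of the submodules \<open>B i\<close>: every
  element of \<open>A\<close> is the sum of a unique family of elements of the \<open>B i\<close>, and all such sums
  lie in \<open>A\<close>. Finiteness of the index set is part of the notion, as \<open>finsum\<close> is only
  meaningful then.\<close>

definition internal_direct_sum ::
  "('r, 'x) ring_scheme \<Rightarrow> ('r, 'a, 'y) module_scheme \<Rightarrow> 'a set \<Rightarrow> 'i set \<Rightarrow> ('i \<Rightarrow> 'a set) \<Rightarrow> bool"
where
  "internal_direct_sum R M A I B \<longleftrightarrow>
     finite I \<and> submodule A R M \<and> (\<forall>i\<in>I. submodule (B i) R M) \<and>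
     bij_betw (\<lambda>f. finsum M f I) (\<Pi>\<^sub>E i\<in>I. B i) A"


section \<open>Characters\<close>

text \<open>As usual for profinite groups, characters are continuous: their kernel contains
  Gal(Qab/K) for some finite extension K of Q. Otherwise the field fixed by the kernel would
  not determine the kernel. The values on non-elements of \<open>\<G>\<close> are normalised by
  extensionality.\<close>

definition characters :: "(qab_aut \<Rightarrow> 'p::prime_card padic_closure) set" where
  "characters = {\<psi>. \<psi> \<in> extensional (carrier \<G>) \<and> \<psi> \<in> hom \<G> (units_of type_ring) \<and>
     (\<exists>n>0. \<forall>\<sigma>\<in>carrier \<G>. \<psi> \<sigma> ^ n = 1) \<and>
     (\<exists>K\<in>\<K>. \<forall>\<sigma>\<in>carrier (gal_group Qab K). \<psi> \<sigma> = 1)}"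

text \<open>The conjugates of \<open>\<psi>\<close> over \<open>F\<close> are its images under Gal(F(psi)/F), where F(psi) is
  generated over F by the values of \<open>\<psi>\<close>.\<close>

definition conjugates :: "'p::prime_card padic_closure set \<Rightarrow> (qab_aut \<Rightarrow> 'p padic_closure) \<Rightarrow>
    (qab_aut \<Rightarrow> 'p padic_closure) set" where
  "conjugates F \<psi> =
     (\<lambda>\<tau>. restrict (\<tau> \<circ> \<psi>) (carrier \<G>)) `
       carrier (gal_group (generate_field type_ring (F \<union> \<psi> ` carrier \<G>)) F)"

definition conjugate_sum :: "'p::prime_card padic_closure set \<Rightarrow> (qab_aut \<Rightarrow> 'p padic_closure) \<Rightarrow>
    qab_aut \<Rightarrow> 'p padic_closure" where
  "conjugate_sum F \<psi> = (\<lambda>\<sigma>\<in>carrier \<G>. \<Sum>\<psi>'\<in>conjugates F \<psi>. \<psi>' \<sigma>)"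

text \<open>With \<open>F = \<rat>\<close> these are the irreducible rational characters, with \<open>F = Qp\<close> the
  irreducible p-adic ones.\<close>

definition irreducible_character ::
  "'p::prime_card padic_closure set \<Rightarrow> (qab_aut \<Rightarrow> 'p padic_closure) \<Rightarrow> bool" where
  "irreducible_character F \<chi> \<longleftrightarrow> (\<exists>\<psi>\<in>characters. \<chi> = conjugate_sum F \<psi>)"

definition terms_of :: "'p::prime_card padic_closure set \<Rightarrow> (qab_aut \<Rightarrow> 'p padic_closure) \<Rightarrow>
    (qab_aut \<Rightarrow> 'p padic_closure) set" where
  "terms_of F \<chi> = {\<psi>. \<exists>\<psi>\<^sub>0\<in>characters. \<chi> = conjugate_sum F \<psi>\<^sub>0 \<and> \<psi> \<in> conjugates F \<psi>\<^sub>0}"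

definition padic_components ::
  "(qab_aut \<Rightarrow> 'p::prime_card padic_closure) \<Rightarrow> (qab_aut \<Rightarrow> 'p padic_closure) set" where
  "padic_components \<chi> = {\<phi>. irreducible_character Qp \<phi> \<and> terms_of Qp \<phi> \<subseteq> terms_of \<rat> \<chi>}"

definition kernel_field :: "(qab_aut \<Rightarrow> 'p::prime_card padic_closure) \<Rightarrow> complex set" where
  "kernel_field \<psi> = {x \<in> Qab. \<forall>\<sigma>\<in>carrier \<G>. \<psi> \<sigma> = 1 \<longrightarrow> \<sigma> x = x}"

text \<open>All terms of an irreducible rational character have the same kernel.\<close>

definition char_field :: "(qab_aut \<Rightarrow> 'p::prime_card padic_closure) \<Rightarrow> complex set" where
  "char_field \<chi> = kernel_field (SOME \<psi>. \<psi> \<in> terms_of \<rat> \<chi>)"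

text \<open>In \<open>P_phi K \<sigma> \<phi>\<close>, \<open>\<sigma>\<close> is an element of Gal(K/Q), where \<open>K\<close> is the field fixed by the
  kernel of the terms of \<open>\<phi>\<close>. The product has coefficients in the image of the p-adic
  integers, so it is the image of a unique polynomial over them.\<close>

definition P_phi :: "complex set \<Rightarrow> (complex \<Rightarrow> complex) \<Rightarrow>
    (qab_aut \<Rightarrow> 'p::prime_card padic_closure) \<Rightarrow> 'p padic_int poly" where
  "P_phi K \<sigma> \<phi> =
     (THE P. map_poly padic_int_emb P = (\<Prod>\<psi>\<in>terms_of Qp \<phi>. [:- \<psi> (lift_aut K \<sigma>), 1:]))"


section \<open>Arithmetic families\<close>

text \<open>Modules are written additively, following \<open>module\<close>. All modules of a family are
  carried by subsets of one type \<open>'a\<close>.\<close>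

type_synonym ('p, 'a) gal_module = "(qab_aut \<Rightarrow> 'p padic_int, 'a) module"

definition norm_elem :: "(complex set \<Rightarrow> ('p::prime_card, 'a) gal_module) \<Rightarrow>
    complex set \<Rightarrow> complex set \<Rightarrow> 'a \<Rightarrow> 'a" where
  "norm_elem M K k x =
     finsum (M K) (\<lambda>\<tau>. gr_single 1 (lift_aut K \<tau>) \<odot>\<^bsub>M K\<^esub> x) (carrier (gal_group K k))"

locale arithmetic_family =
  fixes M :: "complex set \<Rightarrow> ('p::prime_card, 'a) gal_module"
    and N J :: "complex set \<Rightarrow> complex set \<Rightarrow> 'a \<Rightarrow> 'a"
  assumes modules: "K \<in> \<K> \<Longrightarrow> module (group_ring \<G>) (M K)"
    and N_hom: "\<lbrakk>k \<in> \<K>; K \<in> \<K>; k \<subseteq> K\<rbrakk> \<Longrightarrow> N K k \<in> module_hom (group_ring \<G>) (M K) (M k)"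
    and J_hom: "\<lbrakk>k \<in> \<K>; K \<in> \<K>; k \<subseteq> K\<rbrakk> \<Longrightarrow> J K k \<in> module_hom (group_ring \<G>) (M k) (M K)"
    and trivial_action: "\<lbrakk>K \<in> \<K>; \<sigma> \<in> carrier (gal_group Qab K); x \<in> carrier (M K)\<rbrakk> \<Longrightarrow>
        gr_single 1 \<sigma> \<odot>\<^bsub>M K\<^esub> x = x"
    and N_trans: "\<lbrakk>k \<in> \<K>; K \<in> \<K>; L \<in> \<K>; k \<subseteq> K; K \<subseteq> L; x \<in> carrier (M L)\<rbrakk> \<Longrightarrow>
        N K k (N L K x) = N L k x"
    and J_trans: "\<lbrakk>k \<in> \<K>; K \<in> \<K>; L \<in> \<K>; k \<subseteq> K; K \<subseteq> L; x \<in> carrier (M k)\<rbrakk> \<Longrightarrow>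
        J L K (J K k x) = J L k x"
    and J_N: "\<lbrakk>k \<in> \<K>; K \<in> \<K>; k \<subseteq> K; x \<in> carrier (M K)\<rbrakk> \<Longrightarrow>
        J K k (N K k x) = norm_elem M K k x"

definition ar_chi :: "(complex set \<Rightarrow> ('p::prime_card, 'a) gal_module) \<Rightarrow>
    (complex set \<Rightarrow> complex set \<Rightarrow> 'a \<Rightarrow> 'a) \<Rightarrow> (qab_aut \<Rightarrow> 'p padic_closure) \<Rightarrow> 'a set" where
  "ar_chi M N \<chi> =
     {x \<in> carrier (M (char_field \<chi>)).
        \<forall>k. subfield k type_ring \<and> k \<subset> char_field \<chi> \<longrightarrow> N (char_field \<chi>) k x = \<zero>\<^bsub>M k\<^esub>}"

definition ar_phi :: "(complex set \<Rightarrow> ('p::prime_card, 'a) gal_module) \<Rightarrow>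
    (complex set \<Rightarrow> complex set \<Rightarrow> 'a \<Rightarrow> 'a) \<Rightarrow> (qab_aut \<Rightarrow> 'p padic_closure) \<Rightarrow>
    (complex \<Rightarrow> complex) \<Rightarrow> (qab_aut \<Rightarrow> 'p padic_closure) \<Rightarrow> 'a set" where
  "ar_phi M N \<chi> \<sigma> \<phi> =
     {x \<in> carrier (M (char_field \<chi>)).
        gr_poly \<G> (P_phi (char_field \<chi>) \<sigma> \<phi>) (lift_aut (char_field \<chi>) \<sigma>) \<odot>\<^bsub>M (char_field \<chi>)\<^esub> x
          = \<zero>\<^bsub>M (char_field \<chi>)\<^esub> \<and>
        (\<forall>k. subfield k type_ring \<and> k \<subset> char_field \<chi> \<longrightarrow> N (char_field \<chi>) k x = \<zero>\<^bsub>M k\<^esub>)}"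

end

theory Submission
  imports Defs "Jordan_Normal_Form.Char_Poly" "HOL-Number_Theory.Residues"
begin

text \<open>Let \<open>K\<close> be the field of \<open>\<chi>\<close>. Its Galois group is cyclic of order \<open>g\<close> and its generator acts on the
  module \<open>M K\<close> through a lift \<open>s\<close> whose \<open>g\<close>-th power acts trivially. So \<open>M K\<close> is a module over the polynomials in \<open>s\<close> with
  \<open>p\<close>-adic integral coefficients, and it makes sense to say that an element is supported on a set \<open>S\<close> of
  \<open>g\<close>-th roots of unity: all polynomials that vanish on \<open>S\<close> kill it. The theorem is the decomposition of
  the set of primitive \<open>g\<close>-th roots of unity into orbits over the \<open>p\<close>-adic numbers, carried over to
  modules.

  The bridge between sets of roots and modules is a separation lemma (\<open>separating_polynomial\<close>). Given
  two Galois stable sets of \<open>g\<close>-th roots of unity such that all differences between the two are units in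
  the ring generated by a primitive root, there is a polynomial over the \<open>p\<close>-adic integers that is \<open>0\<close> on
  one set and \<open>1\<close> on the other. The differences are units as soon as the roots have different \<open>p\<close>-free
  parts (\<open>different_p_free_parts_unit\<close>).

  The elements of \<open>ar_chi\<close> are supported on the primitive roots (\<open>ar_supported\<close>). For a prime \<open>q\<close> dividing
  \<open>g\<close>, the norm to the subfield \<open>k\<close> fixed by \<open>s^(g/q)\<close> vanishes on such an element. So does
  \<open>J \<circ> N\<close>, the norm element of Gal(K/k), which is a polynomial in \<open>s\<close> whose zeros are the roots \<open>w\<close> of
  \<open>w^g = 1\<close> with \<open>w^(g/q) \<noteq> 1\<close>. The element is supported on this set for each \<open>q\<close>, and the sets intersect
  in the primitive roots. To pass to the intersection one needs separating polynomials, which exist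
  when \<open>q\<close> differs from \<open>p\<close>; the set for \<open>q = p\<close> serves as the starting point.

  The \<open>p\<close>-adic components \<open>\<phi>\<close> of \<open>\<chi>\<close> correspond to the orbits of primitive roots. Primitive roots
  with the same \<open>p\<close>-free part are conjugate over the \<open>p\<close>-adic numbers, because the extension
  generated by roots of unity of \<open>p\<close>-power order is totally ramified (\<open>padic_conjugate\<close>). So roots in
  different orbits have different \<open>p\<close>-free parts, and the orbits are separated by polynomials \<open>idem \<phi>\<close>.
  On \<open>ar_chi\<close> these act as orthogonal projections with sum \<open>1\<close>, and their images are the \<open>ar_phi\<close>, since
  \<open>P_phi\<close> is the monic polynomial whose roots form the orbit.

  Characters are linked to roots of unity by their value at the generator. That \<open>\<chi>\<close> comprises all
  primitive roots is the irreducibility of the cyclotomic polynomials (\<open>cyclotomic_conjugate\<close>), that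
  a sum of conjugate characters determines its terms is Dedekind's independence theorem, and that
  the kernel of a character is the full group Gal(Qab/K) is Artin's theorem (\<open>artin_fixed_field\<close>).\<close>

section \<open>Subfields and polynomials with coefficients in a subring\<close>

lemma type_ring_simps [simp]:
  "carrier type_ring = UNIV" "x \<otimes>\<^bsub>type_ring\<^esub> y = x * y" "x \<oplus>\<^bsub>type_ring\<^esub> y = x + y"
  "\<one>\<^bsub>type_ring\<^esub> = 1" "\<zero>\<^bsub>type_ring\<^esub> = 0"
  by (simp_all add: ring_of_type_algebra_def)

lemma field_type_ring: "field (type_ring :: 'a::field ring)"
  by (rule field_from_type_algebra)

lemma type_ring_uminus [simp]: "\<ominus>\<^bsub>type_ring\<^esub> (x::'a::field) = - x"
proof -
  interpret field "type_ring :: 'a ring" by (rule field_type_ring)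
  show ?thesis by (rule minus_equality) simp_all
qed

lemma type_ring_inverse:
  assumes "(x::'a::field) \<noteq> 0"
  shows "inv\<^bsub>type_ring\<^esub> x = inverse x"
proof -
  interpret field "type_ring :: 'a ring" by (rule field_type_ring)
  show ?thesis using assms by (intro inv_unique'[symmetric]) simp_all
qed

text \<open>Subrings and subfields of a field are plain sets here, described by closure conditions, so that
  polynomials and embeddings can be treated in the type of the ambient field.\<close>

definition ring_set :: "'a::field set \<Rightarrow> bool" where
  "ring_set S \<longleftrightarrow> 1 \<in> S \<and> (\<forall>x\<in>S. \<forall>y\<in>S. x + y \<in> S \<and> x * y \<in> S) \<and> (\<forall>x\<in>S. - x \<in> S)"

definition field_set :: "'a::field set \<Rightarrow> bool" where
  "field_set S \<longleftrightarrow> ring_set S \<and> (\<forall>x\<in>S. inverse x \<in> S)"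

lemma ring_setD:
  assumes "ring_set S"
  shows "1 \<in> S" "0 \<in> S" "x \<in> S \<Longrightarrow> y \<in> S \<Longrightarrow> x + y \<in> S" "x \<in> S \<Longrightarrow> y \<in> S \<Longrightarrow> x * y \<in> S"
    "x \<in> S \<Longrightarrow> - x \<in> S" "x \<in> S \<Longrightarrow> y \<in> S \<Longrightarrow> x - y \<in> S" "x \<in> S \<Longrightarrow> x ^ n \<in> S"
proof -
  show 1: "1 \<in> S" and a: "\<And>x y. x \<in> S \<Longrightarrow> y \<in> S \<Longrightarrow> x + y \<in> S"
    and m: "\<And>x y. x \<in> S \<Longrightarrow> y \<in> S \<Longrightarrow> x * y \<in> S" and u: "\<And>x. x \<in> S \<Longrightarrow> - x \<in> S"
    using assms by (auto simp: ring_set_def)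
  show "0 \<in> S" using a[OF 1 u[OF 1]] by simp
  show "x - y \<in> S" if "x \<in> S" "y \<in> S" using a[OF that(1) u[OF that(2)]] by simp
  show "x ^ n \<in> S" if "x \<in> S" by (induction n) (use that 1 m in auto)
qed

lemma field_setD:
  assumes "field_set S"
  shows "ring_set S" "x \<in> S \<Longrightarrow> inverse x \<in> S"
  using assms by (auto simp: field_set_def)

lemma ring_set_sum:
  assumes "ring_set S" "\<And>i. i \<in> A \<Longrightarrow> f i \<in> S"
  shows "sum f A \<in> S"
  using assms(2) by (induction A rule: infinite_finite_induct) (use ring_setD[OF assms(1)] in auto)

lemma ring_set_prod:
  assumes "ring_set S" "\<And>i. i \<in> A \<Longrightarrow> f i \<in> S"
  shows "prod f A \<in> S"
  using assms(2) by (induction A rule: infinite_finite_induct) (use ring_setD[OF assms(1)] in auto)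

lemma subfield_iff_field_set: "subfield K (type_ring :: 'a::field ring) \<longleftrightarrow> field_set K"
proof -
  interpret field "type_ring :: 'a ring" by (rule field_type_ring)
  show ?thesis
  proof
    assume K: "subfield K (type_ring :: 'a ring)"
    have R: "ring_set K"
      using subringE[OF subfieldE(1)[OF K]] by (auto simp: ring_set_def)
    have "inverse x \<in> K" if "x \<in> K" for x
      using subfield_m_inv(1)[OF K, of x] that ring_setD(2)[OF R]
      by (cases "x = 0") (auto simp: type_ring_inverse)
    with R show "field_set K" by (simp add: field_set_def)
  next
    assume K: "field_set K"
    note R = ring_setD[OF field_setD(1)[OF K]]
    show "subfield K (type_ring :: 'a ring)"
      by (intro subfieldI' subringI) (use R field_setD(2)[OF K] in \<open>auto simp: type_ring_inverse\<close>)
  qed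
qed

lemma field_set_generate: "field_set (generate_field type_ring H)"
proof -
  interpret field "type_ring :: 'a ring" by (rule field_type_ring)
  show ?thesis
    unfolding subfield_iff_field_set[symmetric] by (rule generate_field_is_subfield) simp
qed

lemma generate_field_subset:
  assumes "field_set E" "H \<subseteq> E"
  shows "generate_field type_ring H \<subseteq> E"
proof -
  interpret field "type_ring :: 'a ring" by (rule field_type_ring)
  show ?thesis
    by (rule generate_field_min_subfield1) (use assms in \<open>simp_all add: subfield_iff_field_set\<close>)
qed

definition poly_over :: "'a::zero set \<Rightarrow> 'a poly set" where
  "poly_over S = {p. \<forall>i. coeff p i \<in> S}"

lemma poly_overI: "(\<And>i. coeff p i \<in> S) \<Longrightarrow> p \<in> poly_over S"
  by (simp add: poly_over_def)

lemma poly_overD: "p \<in> poly_over S \<Longrightarrow> coeff p i \<in> S"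
  by (simp add: poly_over_def)

lemma poly_over_mono: "S \<subseteq> S' \<Longrightarrow> poly_over S \<subseteq> poly_over S'"
  by (auto simp: poly_over_def)

lemma poly_over_closed:
  assumes "ring_set S"
  shows "p \<in> poly_over S \<Longrightarrow> q \<in> poly_over S \<Longrightarrow> p + q \<in> poly_over S"
    "p \<in> poly_over S \<Longrightarrow> q \<in> poly_over S \<Longrightarrow> p - q \<in> poly_over S"
    "p \<in> poly_over S \<Longrightarrow> - p \<in> poly_over S"
    "p \<in> poly_over S \<Longrightarrow> q \<in> poly_over S \<Longrightarrow> p * q \<in> poly_over S"
    "c \<in> S \<Longrightarrow> p \<in> poly_over S \<Longrightarrow> smult c p \<in> poly_over S"
    "c \<in> S \<Longrightarrow> monom c n \<in> poly_over S"
    "1 \<in> poly_over S" "0 \<in> poly_over S"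
    "c \<in> S \<Longrightarrow> p \<in> poly_over S \<Longrightarrow> pCons c p \<in> poly_over S"
  using ring_setD[OF assms]
  by (auto simp: poly_over_def coeff_mult coeff_pCons split: nat.splits intro!: ring_set_sum[OF assms])

lemma poly_in_ring_set:
  assumes "ring_set S" "p \<in> poly_over S" "x \<in> S"
  shows "poly p x \<in> S"
  unfolding poly_altdef
  by (intro ring_set_sum[OF assms(1)] ring_setD[OF assms(1)] poly_overD[OF assms(2)] assms(3))

lemma poly_over_prod:
  assumes "ring_set S" "\<And>i. i \<in> A \<Longrightarrow> f i \<in> poly_over S"
  shows "prod f A \<in> poly_over S"
  using assms(2)
  by (induction A rule: infinite_finite_induct) (auto intro: poly_over_closed[OF assms(1)])

lemma poly_over_divide:
  assumes S: "ring_set S" and m: "m \<in> poly_over S" "lead_coeff m = 1" and p: "p \<in> poly_over S"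
  obtains q r where "q \<in> poly_over S" "r \<in> poly_over S" "p = m * q + r"
    "r = 0 \<or> degree r < degree m"
proof -
  have "\<exists>q\<in>poly_over S. \<exists>r\<in>poly_over S. p = m * q + r \<and> (r = 0 \<or> degree r < degree m)"
    using p
  proof (induction "degree p" arbitrary: p rule: less_induct)
    case less
    show ?case
    proof (cases "p = 0 \<or> degree p < degree m")
      case True
      then show ?thesis using less.prems poly_over_closed(8)[OF S]
        by (intro bexI[of _ 0] bexI[of _ p]) auto
    next
      case False
      define t where "t = monom (lead_coeff p) (degree p - degree m)"
      have t: "t \<in> poly_over S"
        unfolding t_def using less.prems poly_over_closed(6)[OF S] poly_overD by blast
      have m0: "m \<noteq> 0" using m by auto
      have "lead_coeff p \<noteq> 0" using False by auto
      then have t0: "t \<noteq> 0" and dt: "degree t = degree p - degree m"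
        by (auto simp: t_def degree_monom_eq)
      have dmt: "degree (m * t) = degree p"
        using m0 t0 dt False by (simp add: degree_mult_eq)
      have lmt: "coeff (m * t) (degree p) = lead_coeff p"
        using lead_coeff_mult[of m t] dmt dt m(2) by (simp add: t_def)
      define p' where "p' = p - m * t"
      have p': "p' \<in> poly_over S"
        unfolding p'_def by (intro poly_over_closed(2)[OF S] poly_over_closed(4)[OF S] less.prems m t)
      show ?thesis
      proof (cases "p' = 0")
        case True
        then show ?thesis using t poly_over_closed(8)[OF S]
          by (intro bexI[of _ t] bexI[of _ 0]) (auto simp: p'_def)
      next
        case False
        have "coeff p' (degree p) = 0" by (simp add: p'_def lmt)
        moreover have "degree p' \<le> degree p"
          unfolding p'_def by (rule degree_diff_le) (auto simp: dmt)
        ultimately have "degree p' < degree p"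
          using False by (metis le_neq_implies_less leading_coeff_0_iff)
        from less.hyps[OF this p'] obtain q r where "q \<in> poly_over S" "r \<in> poly_over S"
          "p' = m * q + r" "r = 0 \<or> degree r < degree m" by blast
        then show ?thesis using t poly_over_closed(1)[OF S]
          by (intro bexI[of _ "q + t"] bexI[of _ r]) (auto simp: p'_def algebra_simps)
      qed
    qed
  qed
  then show ?thesis using that by blast
qed

definition algebraic_over :: "'a::field set \<Rightarrow> 'a \<Rightarrow> bool" where
  "algebraic_over S x \<longleftrightarrow> (\<exists>p\<in>poly_over S. p \<noteq> 0 \<and> poly p x = 0)"

lemma minimal_polynomial:
  assumes S: "field_set S" and x: "algebraic_over S x"
  obtains m where "m \<in> poly_over S" "lead_coeff m = 1" "poly m x = 0"
    "\<And>p. p \<in> poly_over S \<Longrightarrow> poly p x = 0 \<Longrightarrow> \<exists>q\<in>poly_over S. p = m * q"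
proof -
  note R = field_setD(1)[OF S]
  define P where "P p \<longleftrightarrow> p \<in> poly_over S \<and> p \<noteq> 0 \<and> poly p x = 0" for p
  have "\<exists>p. P p" using x by (auto simp: P_def algebraic_over_def)
  then obtain p where p: "P p" and min: "\<And>q. P q \<Longrightarrow> degree p \<le> degree q"
    using ex_has_least_nat[of P _ degree] by blast
  define m where "m = smult (inverse (lead_coeff p)) p"
  have p0: "p \<noteq> 0" using p by (simp add: P_def)
  have m: "m \<in> poly_over S" "poly m x = 0" "lead_coeff m = 1" "degree m = degree p"
    using p p0 poly_over_closed(5)[OF R field_setD(2)[OF S poly_overD[of p S "degree p"]]]
    by (auto simp: m_def P_def)
  have "\<exists>q\<in>poly_over S. r = m * q" if r: "r \<in> poly_over S" "poly r x = 0" for r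
  proof -
    obtain q s where qs: "q \<in> poly_over S" "s \<in> poly_over S" "r = m * q + s"
      "s = 0 \<or> degree s < degree m" using poly_over_divide[OF R m(1,3) r(1)] by blast
    have "poly s x = 0" using qs(3) r(2) m(2) by simp
    then have "s = 0" using qs(2,4) min[of s] m(4) by (fastforce simp: P_def)
    then show ?thesis using qs by auto
  qed
  with m that show ?thesis by blast
qed

text \<open>Dividing the minimal polynomial relation of \<open>x\<close> by its nonzero constant term exhibits the
  inverse of \<open>x\<close> as a polynomial in \<open>x\<close>.\<close>

lemma field_set_if_algebraic:
  assumes E: "field_set E" and R: "ring_set R" "E \<subseteq> R" and alg: "\<And>x. x \<in> R \<Longrightarrow> algebraic_over E x"
  shows "field_set R"
  unfolding field_set_def
proof (intro conjI ballI)
  fix x assume x: "x \<in> R"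
  obtain m where m: "m \<in> poly_over E" "lead_coeff m = 1" "poly m x = 0"
    "\<And>p. p \<in> poly_over E \<Longrightarrow> poly p x = 0 \<Longrightarrow> \<exists>q\<in>poly_over E. p = m * q"
    using minimal_polynomial[OF E alg[OF x]] by blast
  obtain c q where cq: "m = pCons c q" by (cases m)
  have q: "q \<in> poly_over E"
  proof (rule poly_overI)
    fix i show "coeff q i \<in> E" using poly_overD[OF m(1), of "Suc i"] by (simp add: cq)
  qed
  have c: "c \<in> E" using poly_overD[OF m(1), of 0] by (simp add: cq)
  show "inverse x \<in> R"
  proof (cases "x = 0")
    case True then show ?thesis using ring_setD[OF R(1)] by simp
  next
    case False
    have e: "c + x * poly q x = 0" using m(3) by (simp add: cq)
    have "c \<noteq> 0"
    proof
      assume "c = 0"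
      then have "poly q x = 0" using e False by simp
      then obtain r where r: "q = m * r" using m(4)[OF q] by blast
      have q0: "q \<noteq> 0" using m(2) \<open>c = 0\<close> by (auto simp: cq)
      then have "degree q < degree m" by (simp add: cq)
      moreover have "degree m \<le> degree q" using r q0 by (metis degree_mult_right_le mult_eq_0_iff)
      ultimately show False by simp
    qed
    have "inverse x = - inverse c * poly q x"
      using e False \<open>c \<noteq> 0\<close> by (simp add: field_simps) (metis add_eq_0_iff minus_minus)
    moreover have "- inverse c \<in> R" using c field_setD(2)[OF E] R ring_setD(5)[OF R(1)] by blast
    moreover have "poly q x \<in> R"
      using poly_in_ring_set[OF R(1) _ x] poly_over_mono[OF R(2)] q by blast
    ultimately show ?thesis using ring_setD(4)[OF R(1)] by metis
  qed
qed (fact R(1))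

lemma ring_set_adjoin:
  assumes S: "ring_set S"
  shows "ring_set {poly p x | p. p \<in> poly_over S}" (is "ring_set ?T")
    and "S \<subseteq> {poly p x | p. p \<in> poly_over S}" and "x \<in> {poly p x | p. p \<in> poly_over S}"
proof -
  show "ring_set ?T"
    unfolding ring_set_def
  proof (intro conjI ballI)
    show "1 \<in> ?T" using poly_over_closed(7)[OF S] by (intro CollectI exI[of _ 1]) simp
    fix a b assume "a \<in> ?T" "b \<in> ?T"
    then obtain p q where pq: "p \<in> poly_over S" "q \<in> poly_over S" "a = poly p x" "b = poly q x" by blast
    show "a + b \<in> ?T" using pq poly_over_closed(1)[OF S]
      by (intro CollectI exI[of _ "p + q"]) simp
    show "a * b \<in> ?T" using pq poly_over_closed(4)[OF S]
      by (intro CollectI exI[of _ "p * q"]) simp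
  next
    fix a assume "a \<in> ?T"
    then obtain p where "p \<in> poly_over S" "a = poly p x" by blast
    then show "- a \<in> ?T" using poly_over_closed(3)[OF S]
      by (intro CollectI exI[of _ "- p"]) simp
  qed
  show "S \<subseteq> ?T"
  proof
    fix c assume "c \<in> S"
    then show "c \<in> ?T" using poly_over_closed(9,8)[OF S] by (intro CollectI exI[of _ "[:c:]"]) simp
  qed
  show "x \<in> ?T" using poly_over_closed(8,9)[OF S] ring_setD[OF S]
    by (intro CollectI exI[of _ "[:0, 1:]"]) simp
qed

section \<open>Extension of embeddings\<close>

definition ring_emb :: "'a::field set \<Rightarrow> ('a \<Rightarrow> 'b::field) \<Rightarrow> bool" where
  "ring_emb S f \<longleftrightarrow> f 1 = 1 \<and> (\<forall>x\<in>S. \<forall>y\<in>S. f (x + y) = f x + f y \<and> f (x * y) = f x * f y)"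

lemma ring_embD:
  assumes "ring_emb S f" "ring_set S"
  shows "f 1 = 1" "x \<in> S \<Longrightarrow> y \<in> S \<Longrightarrow> f (x + y) = f x + f y"
    "x \<in> S \<Longrightarrow> y \<in> S \<Longrightarrow> f (x * y) = f x * f y" "f 0 = 0"
    "x \<in> S \<Longrightarrow> f (- x) = - f x" "x \<in> S \<Longrightarrow> y \<in> S \<Longrightarrow> f (x - y) = f x - f y"
    "x \<in> S \<Longrightarrow> f (x ^ n) = f x ^ n"
proof -
  note R = ring_setD[OF assms(2)]
  show 1: "f 1 = 1" and a: "\<And>x y. x \<in> S \<Longrightarrow> y \<in> S \<Longrightarrow> f (x + y) = f x + f y"
    and m: "\<And>x y. x \<in> S \<Longrightarrow> y \<in> S \<Longrightarrow> f (x * y) = f x * f y"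
    using assms(1) by (auto simp: ring_emb_def)
  show 0: "f 0 = 0" using a[OF R(2) R(2)] by (metis add_cancel_right_right)
  show u: "f (- x) = - f x" if "x \<in> S" for x
    using a[OF that R(5)[OF that]] 0 by (simp add: eq_neg_iff_add_eq_0 add.commute)
  show "f (x - y) = f x - f y" if "x \<in> S" "y \<in> S"
    using a[OF that(1) R(5)[OF that(2)]] u[OF that(2)] by simp
  show "f (x ^ n) = f x ^ n" if "x \<in> S"
    by (induction n) (use that 1 m R(7) in auto)
qed

lemma ring_emb_inverse:
  assumes "ring_emb S f" "field_set S" "x \<in> S"
  shows "f (inverse x) = inverse (f x)"
proof (cases "x = 0")
  case True then show ?thesis using ring_embD(4)[OF assms(1) field_setD(1)[OF assms(2)]] by simp
next
  case False
  have "f x * f (inverse x) = 1"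
    using False ring_embD[OF assms(1) field_setD(1)[OF assms(2)]] field_setD(2)[OF assms(2)] assms(3)
    by (metis right_inverse)
  then show ?thesis by (metis inverse_unique)
qed

lemma ring_emb_inj:
  assumes "ring_emb S f" "field_set S"
  shows "inj_on f S"
proof (rule inj_onI)
  note R = field_setD(1)[OF assms(2)]
  fix x y assume xy: "x \<in> S" "y \<in> S" "f x = f y"
  show "x = y"
  proof (rule ccontr)
    assume "x \<noteq> y"
    then have "(x - y) * inverse (x - y) = 1" by simp
    moreover have d: "x - y \<in> S" using ring_setD(6)[OF R] xy by blast
    ultimately have "f (x - y) * f (inverse (x - y)) = 1"
      using ring_embD(1,3)[OF assms(1) R] field_setD(2)[OF assms(2)] by metis
    then show False using ring_embD(6)[OF assms(1) R] xy by simp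
  qed
qed

lemma ring_emb_sum:
  assumes "ring_emb S f" "ring_set S" "\<And>i. i \<in> A \<Longrightarrow> g i \<in> S"
  shows "f (sum g A) = (\<Sum>i\<in>A. f (g i))"
  using assms(3)
  by (induction A rule: infinite_finite_induct)
     (auto simp: ring_embD[OF assms(1,2)] ring_set_sum[OF assms(2)])

lemma ring_emb_map_poly:
  assumes f: "ring_emb S f" "ring_set S"
  shows "coeff (map_poly f p) i = f (coeff p i)"
    "p \<in> poly_over S \<Longrightarrow> q \<in> poly_over S \<Longrightarrow> map_poly f (p + q) = map_poly f p + map_poly f q"
    "p \<in> poly_over S \<Longrightarrow> q \<in> poly_over S \<Longrightarrow> map_poly f (p * q) = map_poly f p * map_poly f q"
    "p \<in> poly_over S \<Longrightarrow> x \<in> S \<Longrightarrow> f (poly p x) = poly (map_poly f p) (f x)"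
proof -
  note D = ring_embD[OF f] and R = ring_setD[OF f(2)]
  show c: "coeff (map_poly f p) i = f (coeff p i)" for p i by (simp add: coeff_map_poly D)
  show "map_poly f (p + q) = map_poly f p + map_poly f q"
    if "p \<in> poly_over S" "q \<in> poly_over S" for p q
    using that by (intro poly_eqI) (auto simp: c D poly_overD)
  show "map_poly f (p * q) = map_poly f p * map_poly f q"
    if pq: "p \<in> poly_over S" "q \<in> poly_over S" for p q
  proof (rule poly_eqI)
    fix n
    have "f (\<Sum>i\<le>n. coeff p i * coeff q (n - i)) = (\<Sum>i\<le>n. f (coeff p i * coeff q (n - i)))"
      using pq by (intro ring_emb_sum[OF f] R(4)) (auto simp: poly_overD)
    also have "\<dots> = (\<Sum>i\<le>n. f (coeff p i) * f (coeff q (n - i)))"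
      using pq by (intro sum.cong refl D(3)) (auto simp: poly_overD)
    finally show "coeff (map_poly f (p * q)) n = coeff (map_poly f p * map_poly f q) n"
      by (simp add: c coeff_mult)
  qed
  show "f (poly p x) = poly (map_poly f p) (f x)" if "p \<in> poly_over S" "x \<in> S" for p x
    using that
  proof (induction p)
    case (pCons a p)
    have p: "p \<in> poly_over S"
    proof (rule poly_overI)
      fix i show "coeff p i \<in> S" using poly_overD[OF pCons.prems(1), of "Suc i"] by simp
    qed
    have a: "a \<in> S" using poly_overD[OF pCons.prems(1), of 0] by simp
    show ?case
      using pCons.IH[OF p pCons.prems(2)] a pCons.prems(2) poly_in_ring_set[OF f(2) p pCons.prems(2)]
      by (simp add: Polynomial.map_poly_pCons D R)
  qed (simp add: D)
qed

text \<open>The image of \<open>poly p x\<close> has to be \<open>poly (map_poly f p) b\<close>; the assumption on \<open>b\<close> makes this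
  independent of the choice of \<open>p\<close>.\<close>

lemma ring_emb_adjoin:
  assumes S: "ring_set S" and f: "ring_emb S f"
    and b: "\<And>p. p \<in> poly_over S \<Longrightarrow> poly p x = 0 \<Longrightarrow> poly (map_poly f p) b = 0"
  obtains g where "ring_emb {poly p x | p. p \<in> poly_over S} g" "\<And>y. y \<in> S \<Longrightarrow> g y = f y" "g x = b"
proof -
  define T where "T = {poly p x | p. p \<in> poly_over S}"
  define g where "g y = poly (map_poly f (SOME p. p \<in> poly_over S \<and> poly p x = y)) b" for y
  note M = ring_emb_map_poly[OF f S]
  have g: "g (poly p x) = poly (map_poly f p) b" if p: "p \<in> poly_over S" for p
  proof -
    define q where "q = (SOME q. q \<in> poly_over S \<and> poly q x = poly p x)"
    have q: "q \<in> poly_over S \<and> poly q x = poly p x"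
      unfolding q_def by (rule someI_ex) (use p in blast)
    then have "poly (map_poly f (q - p)) b = 0"
      using p by (intro b poly_over_closed(2)[OF S]) auto
    moreover have "map_poly f (q - p) = map_poly f q - map_poly f p"
      by (intro poly_eqI) (use p q in \<open>simp add: M(1) ring_embD(6)[OF f S] poly_overD\<close>)
    ultimately show ?thesis
      unfolding g_def q_def[symmetric] by simp
  qed
  have "ring_emb T g"
    unfolding ring_emb_def
  proof (intro conjI ballI)
    have "g (poly 1 x) = poly (map_poly f 1) b" by (rule g) (rule poly_over_closed(7)[OF S])
    then show "g 1 = 1" by (simp add: ring_embD[OF f S])
    fix y z assume "y \<in> T" "z \<in> T"
    then obtain p q where pq: "p \<in> poly_over S" "q \<in> poly_over S" "y = poly p x" "z = poly q x"
      by (auto simp: T_def)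
    show "g (y + z) = g y + g z"
      using g[of "p + q"] g[OF pq(1)] g[OF pq(2)] M(2)[OF pq(1,2)] poly_over_closed(1)[OF S pq(1,2)] pq
      by simp
    show "g (y * z) = g y * g z"
      using g[of "p * q"] g[OF pq(1)] g[OF pq(2)] M(3)[OF pq(1,2)] poly_over_closed(4)[OF S pq(1,2)] pq
      by simp
  qed
  moreover have "g y = f y" if "y \<in> S" for y
    using g[of "[:y:]"] that poly_over_closed(8,9)[OF S]
    by (simp add: Polynomial.map_poly_pCons ring_embD[OF f S])
  moreover have "g x = b"
    using g[of "[:0, 1:]"] poly_over_closed(8,9)[OF S] ring_setD[OF S]
    by (simp add: Polynomial.map_poly_pCons ring_embD[OF f S])
  ultimately show ?thesis using that by (auto simp: T_def)
qed

text \<open>A root \<open>b\<close> of the image of the minimal polynomial of \<open>x\<close> will do, because the minimal polynomial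
  divides every \<open>p\<close>.\<close>

lemma exists_conjugate_root:
  fixes f :: "'a::field \<Rightarrow> 'b::alg_closed_field"
  assumes S: "field_set S" and f: "ring_emb S f" and x: "algebraic_over S x"
  obtains b where "\<And>p. p \<in> poly_over S \<Longrightarrow> poly p x = 0 \<Longrightarrow> poly (map_poly f p) b = 0"
proof -
  note R = field_setD(1)[OF S]
  obtain m where m: "m \<in> poly_over S" "lead_coeff m = 1" "poly m x = 0"
    "\<And>p. p \<in> poly_over S \<Longrightarrow> poly p x = 0 \<Longrightarrow> \<exists>q\<in>poly_over S. p = m * q"
    using minimal_polynomial[OF S x] by blast
  note M = ring_emb_map_poly[OF f R]
  have "degree m > 0"
  proof (rule ccontr)
    assume "\<not> degree m > 0"
    then have "m = 1" using m(2) by (metis degree_0_id gr0I one_pCons)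
    then show False using m(3) by simp
  qed
  moreover have "coeff (map_poly f m) (degree m) = 1"
    using m(2) by (simp add: M(1) ring_embD[OF f R])
  ultimately have "degree (map_poly f m) > 0"
    by (metis le_degree less_le_trans zero_neq_one)
  then obtain b where b: "poly (map_poly f m) b = 0"
    using alg_closed_imp_poly_has_root by blast
  show ?thesis
  proof (rule that)
    fix p assume "p \<in> poly_over S" "poly p x = 0"
    then obtain q where "q \<in> poly_over S" "p = m * q" using m(4) by blast
    then show "poly (map_poly f p) b = 0" using M(3)[OF m(1)] b by simp
  qed
qed

lemma algebraic_over_mono: "algebraic_over E x \<Longrightarrow> E \<subseteq> S \<Longrightarrow> algebraic_over S x"
  using poly_over_mono unfolding algebraic_over_def by blast

text \<open>Zorn's lemma, applied to the graphs of the extensions of \<open>f\<close> to rings between \<open>E\<close> and \<open>W\<close>: being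
  a single-valued subring of the product is preserved under unions of chains. A maximal graph has
  domain \<open>W\<close>, since a further element \<open>x\<close> could be sent to a root of the image of its minimal
  polynomial.\<close>

theorem ring_emb_extends:
  fixes f :: "'a::field \<Rightarrow> 'b::alg_closed_field"
  assumes E: "field_set E" and W: "field_set W" "E \<subseteq> W"
    and alg: "\<And>x. x \<in> W \<Longrightarrow> algebraic_over E x" and f: "ring_emb E f"
  obtains g where "ring_emb W g" "\<And>x. x \<in> E \<Longrightarrow> g x = f x"
proof -
  note RE = field_setD(1)[OF E] and RW = field_setD(1)[OF W(1)]
  define C where "C G \<longleftrightarrow> single_valued G \<and> (\<forall>a\<in>G. \<forall>b\<in>G.
      (fst a + fst b, snd a + snd b) \<in> G \<and> (fst a * fst b, snd a * snd b) \<in> G) \<and>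
      (\<forall>a\<in>G. (- fst a, - snd a) \<in> G)" for G :: "('a \<times> 'b) set"
  define \<A> where "\<A> = {G. fst ` G \<subseteq> W \<and> (\<lambda>x. (x, f x)) ` E \<subseteq> G \<and> C G}"
  have graph: "(\<lambda>x. (x, g x)) ` S \<in> \<A>"
    if S: "ring_set S" "E \<subseteq> S" "S \<subseteq> W" and g: "ring_emb S g" "\<And>x. x \<in> E \<Longrightarrow> g x = f x" for S g
  proof -
    have "C ((\<lambda>x. (x, g x)) ` S)"
      unfolding C_def using ring_setD[OF S(1)] ring_embD[OF g(1) S(1)]
      by (auto simp: single_valued_def)
    then show ?thesis using S g(2) by (auto simp: \<A>_def intro!: image_eqI)
  qed
  have "\<exists>M\<in>\<A>. \<forall>Y\<in>\<A>. M \<subseteq> Y \<longrightarrow> Y = M"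
  proof (rule subset_Zorn_nonempty)
    show "\<A> \<noteq> {}" using graph[OF RE order.refl W(2) f] by blast
    fix \<C> assume ne: "\<C> \<noteq> {}" and ch: "subset.chain \<A> \<C>"
    have two: "\<exists>G\<in>\<C>. a \<in> G \<and> b \<in> G" if "a \<in> \<Union>\<C>" "b \<in> \<Union>\<C>" for a b
      using that ch unfolding subset_chain_def by blast
    have CC: "C G" if "G \<in> \<C>" for G using that ch by (auto simp: subset_chain_def \<A>_def)
    have "C (\<Union>\<C>)"
      unfolding C_def
    proof (intro conjI ballI)
      show "single_valued (\<Union>\<C>)"
      proof (rule single_valuedI)
        fix x y z assume "(x, y) \<in> \<Union>\<C>" "(x, z) \<in> \<Union>\<C>"
        then obtain G where "G \<in> \<C>" "(x, y) \<in> G" "(x, z) \<in> G" using two by blast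
        then show "y = z" using CC[of G] by (auto simp: C_def single_valued_def)
      qed
      fix a b assume "a \<in> \<Union>\<C>" "b \<in> \<Union>\<C>"
      then obtain G where "G \<in> \<C>" "a \<in> G" "b \<in> G" using two by blast
      then show "(fst a + fst b, snd a + snd b) \<in> \<Union>\<C>" "(fst a * fst b, snd a * snd b) \<in> \<Union>\<C>"
        using CC[of G] by (auto simp: C_def)
    next
      fix a assume "a \<in> \<Union>\<C>"
      then show "(- fst a, - snd a) \<in> \<Union>\<C>" using CC unfolding C_def by blast
    qed
    moreover have "fst ` G \<subseteq> W" "(\<lambda>x. (x, f x)) ` E \<subseteq> G" if "G \<in> \<C>" for G
      using that ch unfolding subset_chain_def \<A>_def by blast+
    then have "fst ` \<Union>\<C> \<subseteq> W" "(\<lambda>x. (x, f x)) ` E \<subseteq> \<Union>\<C>" using ne by blast+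
    ultimately show "\<Union>\<C> \<in> \<A>" unfolding \<A>_def by simp
  qed
  then obtain M where M: "M \<in> \<A>" and max: "\<And>Y. Y \<in> \<A> \<Longrightarrow> M \<subseteq> Y \<Longrightarrow> Y = M" by blast
  define S where "S = fst ` M"
  define h where "h x = (THE y. (x, y) \<in> M)" for x
  have CM: "C M" and EM: "(\<lambda>x. (x, f x)) ` E \<subseteq> M" and SW: "S \<subseteq> W"
    using M by (auto simp: \<A>_def S_def)
  have hM: "h x = y" if "(x, y) \<in> M" for x y
    unfolding h_def using that CM by (intro the_equality) (auto simp: C_def single_valued_def)
  have Mh: "(x, h x) \<in> M" if "x \<in> S" for x
    using that hM by (auto simp: S_def)
  have fE: "h x = f x" if "x \<in> E" for x using EM that by (intro hM) auto
  have ES: "E \<subseteq> S" using EM by (force simp: S_def)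
  have cl: "(x + y, h x + h y) \<in> M" "(x * y, h x * h y) \<in> M" "(- x, - h x) \<in> M"
    if "x \<in> S" "y \<in> S" for x y
    using CM Mh[OF that(1)] Mh[OF that(2)] unfolding C_def by fastforce+
  have mS: "x \<in> S" if "(x, y) \<in> M" for x y using that unfolding S_def by (rule image_eqI[rotated]) simp
  have RS: "ring_set S"
    unfolding ring_set_def
  proof (intro conjI ballI)
    show "1 \<in> S" using ES ring_setD(1)[OF RE] by (rule subsetD)
    fix x assume x: "x \<in> S"
    show "- x \<in> S" by (rule mS[OF cl(3)[OF x x]])
    fix y assume y: "y \<in> S"
    show "x + y \<in> S" by (rule mS[OF cl(1)[OF x y]])
    show "x * y \<in> S" by (rule mS[OF cl(2)[OF x y]])
  qed
  have hS: "ring_emb S h"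
    unfolding ring_emb_def using fE[of 1] ring_embD(1)[OF f RE] ring_setD(1)[OF RE] hM[OF cl(1)] hM[OF cl(2)]
    by auto
  \<comment> \<open>maximality: adjoining an element of \<open>W\<close> to \<open>S\<close> does not enlarge \<open>M\<close>\<close>
  have "W \<subseteq> S"
  proof
    fix x assume x: "x \<in> W"
    have FS: "field_set S"
      by (rule field_set_if_algebraic[OF E RS ES]) (use SW alg in blast)
    obtain b where "\<And>p. p \<in> poly_over S \<Longrightarrow> poly p x = 0 \<Longrightarrow> poly (map_poly h p) b = 0"
      using exists_conjugate_root[OF FS hS algebraic_over_mono[OF alg[OF x] ES]] by blast
    then obtain g where g: "ring_emb {poly p x | p. p \<in> poly_over S} g" "\<And>y. y \<in> S \<Longrightarrow> g y = h y"
      using ring_emb_adjoin[OF RS hS] by blast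
    define T where "T = {poly p x | p. p \<in> poly_over S}"
    note T = ring_set_adjoin[OF RS, of x, folded T_def]
    have "T \<subseteq> W" unfolding T_def using poly_in_ring_set[OF RW _ x] poly_over_mono[OF SW] by blast
    then have "(\<lambda>x. (x, g x)) ` T \<in> \<A>"
      using g T ES fE by (intro graph) (auto simp: T_def[symmetric])
    moreover have "M \<subseteq> (\<lambda>x. (x, g x)) ` T"
      using T(2) g(2) hM by (force simp: S_def)
    ultimately have "(\<lambda>x. (x, g x)) ` T = M" using max by blast
    then show "x \<in> S" using T(3) by (force simp: S_def)
  qed
  with SW have "S = W" by blast
  then show ?thesis using that[of h] hS fE by blast
qed

text \<open>The minimal polynomial of \<open>x\<close> is not linear and, in characteristic 0, has no double roots. Sending
  \<open>x\<close> to another root gives an embedding of the field generated by \<open>x\<close>, which extends to \<open>W\<close>.\<close>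

theorem ring_emb_moves:
  fixes E :: "'a::{alg_closed_field, field_char_0} set"
  assumes E: "field_set E" and W: "field_set W" "E \<subseteq> W"
    and alg: "\<And>x. x \<in> W \<Longrightarrow> algebraic_over E x" and x: "x \<in> W" "x \<notin> E"
  obtains g :: "'a \<Rightarrow> 'a" where "ring_emb W g" "\<And>y. y \<in> E \<Longrightarrow> g y = y" "g x \<noteq> x"
proof -
  note RE = field_setD(1)[OF E] and RW = field_setD(1)[OF W(1)]
  obtain m where m: "m \<in> poly_over E" "lead_coeff m = 1" "poly m x = 0"
    "\<And>p. p \<in> poly_over E \<Longrightarrow> poly p x = 0 \<Longrightarrow> \<exists>q\<in>poly_over E. p = m * q"
    using minimal_polynomial[OF E alg[OF x(1)]] by blast
  have m0: "m \<noteq> 0" using m(2) by auto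
  obtain h where h: "m = [:- x, 1:] * h" using m(3) by (auto simp: poly_eq_0_iff_dvd elim: dvdE)
  have h0: "h \<noteq> 0" using h m0 by auto
  have lh: "lead_coeff h = 1" using m(2) unfolding h lead_coeff_mult by simp
  have "degree h > 0"
  proof (rule ccontr)
    assume "\<not> degree h > 0"
    then have "h = 1" using lh by (metis degree_0_id gr0I one_pCons)
    then have "coeff m 0 = - x" using h by simp
    then have "- (- x) \<in> E" using poly_overD[OF m(1), of 0] ring_setD(5)[OF RE] by metis
    then show False using x by simp
  qed
  then obtain b where b: "poly h b = 0" using alg_closed_imp_poly_has_root by blast
  \<comment> \<open>a double root would be a root of the derivative, whose degree is too small\<close>
  have "b \<noteq> x"
  proof
    assume "b = x"
    then have "poly (pderiv m) x = 0" unfolding h pderiv_mult poly_add poly_mult using b by simp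
    moreover have "pderiv m \<in> poly_over E"
    proof (rule poly_overI)
      fix i
      have "of_nat n \<in> E" for n by (induction n) (use ring_setD[OF RE] in auto)
      then show "coeff (pderiv m) i \<in> E"
        unfolding coeff_pderiv using poly_overD[OF m(1)] ring_setD(4)[OF RE] by blast
    qed
    ultimately obtain q where q: "pderiv m = m * q" using m(4) by blast
    have "degree m > 0" unfolding h using h0 by (subst degree_mult_eq) auto
    then have d0: "pderiv m \<noteq> 0" by (simp add: pderiv_eq_0_iff)
    then have "degree m \<le> degree (pderiv m)" using q by (metis degree_mult_right_le mult_eq_0_iff)
    then show False using \<open>degree m > 0\<close> by (simp add: degree_pderiv)
  qed
  have idE: "ring_emb E (\<lambda>y. y)" by (simp add: ring_emb_def)
  have "poly (map_poly (\<lambda>y. y) p) b = 0" if p: "p \<in> poly_over E" "poly p x = 0" for p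
  proof -
    obtain q where "p = m * q" using m(4) p by blast
    then show ?thesis using b h by (simp add: map_poly_idI)
  qed
  then obtain g where g: "ring_emb {poly p x | p. p \<in> poly_over E} g" "\<And>y. y \<in> E \<Longrightarrow> g y = y" "g x = b"
    using ring_emb_adjoin[OF RE idE] by blast
  define T where "T = {poly p x | p. p \<in> poly_over E}"
  note T = ring_set_adjoin[OF RE, of x, folded T_def]
  have TW: "T \<subseteq> W" unfolding T_def using poly_in_ring_set[OF RW _ x(1)] poly_over_mono[OF W(2)] by blast
  have "field_set T" by (rule field_set_if_algebraic[OF E T(1,2)]) (use TW alg in blast)
  moreover have "algebraic_over T y" if "y \<in> W" for y using algebraic_over_mono[OF alg[OF that] T(2)] .
  ultimately obtain g' where g': "ring_emb W g'" "\<And>y. y \<in> T \<Longrightarrow> g' y = g y"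
    using ring_emb_extends[OF _ W(1) TW, of g] g(1) T_def by blast
  show ?thesis
  proof (rule that[OF g'(1)])
    show "g' y = y" if "y \<in> E" for y using that g'(2) g(2) T(2) by auto
    show "g' x \<noteq> x" using g'(2)[OF T(3)] g(3) \<open>b \<noteq> x\<close> by simp
  qed
qed

section \<open>Linear independence of multiplicative functions\<close>

text \<open>Dedekind's argument: the relation at \<open>mlt y x\<close> minus \<open>f0 y\<close> times the relation at \<open>x\<close> is a
  relation without \<open>f0\<close>, whose coefficient at \<open>f1\<close> is multiplied by \<open>f1 y - f0 y \<noteq> 0\<close>.\<close>

theorem multiplicative_functions_independent:
  fixes D :: "'x set" and mlt :: "'x \<Rightarrow> 'x \<Rightarrow> 'x" and A :: "('x \<Rightarrow> 'l::field) set"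
  assumes "finite A" "A \<subseteq> extensional D" and D: "\<And>x y. x \<in> D \<Longrightarrow> y \<in> D \<Longrightarrow> mlt x y \<in> D"
    and "\<And>f x y. f \<in> A \<Longrightarrow> x \<in> D \<Longrightarrow> y \<in> D \<Longrightarrow> f (mlt x y) = f x * f y"
    and "\<And>f. f \<in> A \<Longrightarrow> \<exists>x\<in>D. f x \<noteq> 0"
    and "\<And>x. x \<in> D \<Longrightarrow> (\<Sum>f\<in>A. c f * f x) = 0"
    and "f \<in> A"
  shows "c f = 0"
  using assms(1,2,4-7)
proof (induction A arbitrary: c f rule: finite_induct)
  case (insert f0 A)
  have *: "c f1 = 0" if f1: "f1 \<in> A" for f1
  proof -
    have "\<exists>y\<in>D. f0 y \<noteq> f1 y"
    proof (rule ccontr)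
      assume "\<not> ?thesis"
      then have "f0 = f1" using insert.prems(1) f1
        by (intro extensionalityI[of _ D]) auto
      then show False using insert.hyps f1 by simp
    qed
    then obtain y where y: "y \<in> D" "f0 y \<noteq> f1 y" by blast
    have "c f1 * (f1 y - f0 y) = 0"
    proof (rule insert.IH[where c = "\<lambda>f. c f * (f y - f0 y)"])
      fix x assume x: "x \<in> D"
      have "0 = (\<Sum>f\<in>insert f0 A. c f * f (mlt y x)) - f0 y * (\<Sum>f\<in>insert f0 A. c f * f x)"
        using insert.prems(4) D x y(1) by simp
      also have "\<dots> = (\<Sum>f\<in>insert f0 A. c f * (f y * f x)) - f0 y * (\<Sum>f\<in>insert f0 A. c f * f x)"
        using insert.prems(2) x y(1) by (intro arg_cong2[where f = minus] sum.cong refl) auto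
      also have "\<dots> = (\<Sum>f\<in>insert f0 A. c f * (f y - f0 y) * f x)"
        by (simp add: sum_distrib_left sum_subtractf[symmetric] algebra_simps)
      also have "\<dots> = (\<Sum>f\<in>A. c f * (f y - f0 y) * f x)"
        using insert.hyps by simp
      finally show "(\<Sum>f\<in>A. c f * (f y - f0 y) * f x) = 0" by simp
    qed (use insert.prems f1 in auto)
    then show ?thesis using y(2) by simp
  qed
  have "c f0 = 0"
  proof -
    obtain x where x: "x \<in> D" "f0 x \<noteq> 0" using insert.prems(3) by blast
    have "(\<Sum>f\<in>A. c f * f x) = 0" using * by (intro sum.neutral) auto
    then have "c f0 * f0 x = 0" using insert.prems(4)[OF x(1)] insert.hyps by simp
    then show ?thesis using x by simp
  qed
  with * show ?case using insert.prems(5) by auto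
qed simp

text \<open>The difference of the two sums is a linear relation with coefficients \<open>1\<close>, \<open>0\<close> and \<open>-1\<close>. The lemma
  serves twice: for embeddings of fields, and to recover the terms of a sum of characters.\<close>

corollary multiplicative_sums_eq:
  fixes A B :: "('x \<Rightarrow> 'l::field) set"
  assumes fin: "finite A" "finite B" and ext: "A \<subseteq> extensional D" "B \<subseteq> extensional D"
    and D: "\<And>x y. x \<in> D \<Longrightarrow> y \<in> D \<Longrightarrow> mlt x y \<in> D"
    and mult: "\<And>f x y. f \<in> A \<union> B \<Longrightarrow> x \<in> D \<Longrightarrow> y \<in> D \<Longrightarrow> f (mlt x y) = f x * f y"
    and nz: "\<And>f. f \<in> A \<union> B \<Longrightarrow> \<exists>x\<in>D. f x \<noteq> 0"
    and eq: "\<And>x. x \<in> D \<Longrightarrow> (\<Sum>f\<in>A. f x) = (\<Sum>f\<in>B. f x)"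
  shows "A = B"
proof -
  have "(if f \<in> A then 1 else 0) - (if f \<in> B then 1 else 0) = (0::'l)" if "f \<in> A \<union> B" for f
  proof (rule multiplicative_functions_independent[where A = "A \<union> B" and D = D and mlt = mlt
        and c = "\<lambda>f. (if f \<in> A then 1 else 0) - (if f \<in> B then 1 else 0)"])
    fix x assume x: "x \<in> D"
    have "(\<Sum>f\<in>A \<union> B. ((if f \<in> A then 1 else 0) - (if f \<in> B then 1 else 0)) * f x) =
        (\<Sum>f\<in>A \<union> B. (if f \<in> A then f x else 0)) - (\<Sum>f\<in>A \<union> B. (if f \<in> B then f x else 0))"
      unfolding sum_subtractf[symmetric] by (intro sum.cong) auto
    also have "\<dots> = (\<Sum>f\<in>A. f x) - (\<Sum>f\<in>B. f x)"
      using fin by (simp add: sum.inter_restrict[symmetric] Int_absorb1)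
    finally show "(\<Sum>f\<in>A \<union> B. ((if f \<in> A then 1 else 0) - (if f \<in> B then 1 else 0)) * f x) = 0"
      using eq[OF x] by simp
  qed (use assms that in auto)
  note * = this
  have "f \<in> A \<longleftrightarrow> f \<in> B" if "f \<in> A \<union> B" for f
    using *[OF that] by (cases "f \<in> A"; cases "f \<in> B") auto
  then show ?thesis by blast
qed

text \<open>Both sides of the equation between the traces are sums of embeddings of \<open>K\<close>, which therefore
  agree term by term.\<close>

lemma trace_permutes:
  fixes \<rho> :: "'a::field \<Rightarrow> 'b::field" and H :: "('k::field \<Rightarrow> 'a) set"
  assumes K: "field_set K" and W: "field_set W" and H: "finite H" "H \<subseteq> extensional K"
    "\<And>h. h \<in> H \<Longrightarrow> ring_emb K h" "\<And>h. h \<in> H \<Longrightarrow> h ` K \<subseteq> W"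
    and r: "ring_emb W \<rho>" and H': "finite H'" "H' \<subseteq> extensional K" "\<And>h. h \<in> H' \<Longrightarrow> ring_emb K h"
    and fix': "\<And>x. x \<in> K \<Longrightarrow> \<rho> (\<Sum>h\<in>H. h x) = (\<Sum>h\<in>H'. h x)"
  shows "(\<lambda>h. restrict (\<rho> \<circ> h) K) ` H = H'"
proof (rule multiplicative_sums_eq[where D = K and mlt = "(*)"])
  note RK = field_setD(1)[OF K] and RW = field_setD(1)[OF W]
  have inj: "inj_on (\<lambda>h. restrict (\<rho> \<circ> h) K) H"
  proof (rule inj_onI)
    fix h h' assume hh: "h \<in> H" "h' \<in> H" "restrict (\<rho> \<circ> h) K = restrict (\<rho> \<circ> h') K"
    show "h = h'"
    proof (rule extensionalityI[of _ K])
      fix x assume x: "x \<in> K"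
      then have "\<rho> (h x) = \<rho> (h' x)" using fun_cong[OF hh(3), of x] by simp
      then show "h x = h' x" using inj_onD[OF ring_emb_inj[OF r W]] H(4) hh x by blast
    qed (use hh H in auto)
  qed
  show "(\<Sum>f\<in>(\<lambda>h. restrict (\<rho> \<circ> h) K) ` H. f x) = (\<Sum>f\<in>H'. f x)" if "x \<in> K" for x
  proof -
    have "(\<Sum>f\<in>(\<lambda>h. restrict (\<rho> \<circ> h) K) ` H. f x) = (\<Sum>h\<in>H. \<rho> (h x))"
      using that by (simp add: sum.reindex[OF inj])
    also have "\<dots> = \<rho> (\<Sum>h\<in>H. h x)"
      using that H(4) by (intro ring_emb_sum[OF r RW, symmetric]) auto
    finally show ?thesis using fix'[OF that] by simp
  qed
  show "f (x * y) = f x * f y" if "f \<in> (\<lambda>h. restrict (\<rho> \<circ> h) K) ` H \<union> H'" "x \<in> K" "y \<in> K" for f x y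
  proof (cases "f \<in> H'")
    case False
    with that(1) obtain h where h: "h \<in> H" "f = restrict (\<rho> \<circ> h) K" by blast
    have "h x \<in> W" "h y \<in> W" using H(4)[OF h(1)] that by auto
    then show ?thesis
      using that ring_setD(4)[OF RK] ring_embD(3)[OF H(3)[OF h(1)] RK] ring_embD(3)[OF r RW]
      by (simp add: h(2))
  qed (use that ring_embD(3)[OF H'(3) RK] in auto)
  show "\<exists>x\<in>K. f x \<noteq> 0" if "f \<in> (\<lambda>h. restrict (\<rho> \<circ> h) K) ` H \<union> H'" for f
  proof
    show "1 \<in> K" by (rule ring_setD[OF RK])
    have "\<forall>h\<in>H. h 1 = 1" "\<forall>h\<in>H'. h 1 = 1"
      using ring_embD(1)[OF H(3) RK] ring_embD(1)[OF H'(3) RK] by simp_all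
    then have "f 1 = 1" using that ring_setD(1)[OF RK] ring_embD(1)[OF r RW] by auto
    then show "f 1 \<noteq> 0" by simp
  qed
qed (use H H' ring_setD(4)[OF field_setD(1)[OF K]] in auto)

lemma fixed_traces:
  fixes H :: "('k::field \<Rightarrow> 'a::field) set" and A :: "('a \<Rightarrow> 'a) set"
  assumes K: "field_set K" and W: "field_set W" and H: "finite H" "H \<subseteq> extensional K"
    "\<And>h. h \<in> H \<Longrightarrow> ring_emb K h" "\<And>h. h \<in> H \<Longrightarrow> h ` K \<subseteq> W"
    and k: "ring_emb W k" "\<And>h. h \<in> H \<Longrightarrow> restrict (k \<circ> h) K \<in> H" and x: "x \<in> K"
  shows "k (\<Sum>h\<in>H. h x) = (\<Sum>h\<in>H. h x)"
proof -
  let ?c = "\<lambda>h. restrict (k \<circ> h) K"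
  have inj: "inj_on ?c H"
  proof (rule inj_onI)
    fix h h' assume hh: "h \<in> H" "h' \<in> H" "?c h = ?c h'"
    show "h = h'"
    proof (rule extensionalityI[of _ K])
      fix x assume x: "x \<in> K"
      then have "k (h x) = k (h' x)" using fun_cong[OF hh(3), of x] by simp
      then show "h x = h' x" using inj_onD[OF ring_emb_inj[OF k(1) W]] H(4) hh x by blast
    qed (use hh H in auto)
  qed
  have im: "?c ` H = H" by (rule endo_inj_surj[OF H(1) _ inj]) (use k(2) in auto)
  have "k (\<Sum>h\<in>H. h x) = (\<Sum>h\<in>H. k (h x))"
    using x H(4) by (intro ring_emb_sum[OF k(1) field_setD(1)[OF W]]) auto
  also have "\<dots> = (\<Sum>h\<in>H. ?c h x)" using x by simp
  also have "\<dots> = (\<Sum>h\<in>?c ` H. h x)" by (simp add: sum.reindex[OF inj])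
  finally show ?thesis by (simp only: im)
qed

text \<open>Artin's theorem. The traces over \<open>H\<close> are fixed by \<open>A\<close>, hence by \<open>\<rho>\<close>, which therefore permutes \<open>H\<close>.
  Here \<open>A\<close> may be an infinite set of automorphisms of a big field \<open>W\<close>, as long as it permutes a finite
  set \<open>H\<close> of embeddings of a smaller field \<open>K\<close>. This covers both the Galois groups of number fields
  and closed subgroups of the Galois group of \<open>Qab\<close>.\<close>

theorem artin_fixed_field:
  fixes H :: "('k::field \<Rightarrow> 'a::field) set" and A :: "('a \<Rightarrow> 'a) set"
  assumes K: "field_set K" and W: "field_set W" and H: "finite H" "H \<subseteq> extensional K"
    "\<And>h. h \<in> H \<Longrightarrow> ring_emb K h" "\<And>h. h \<in> H \<Longrightarrow> h ` K \<subseteq> W"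
    and A: "\<And>k. k \<in> A \<Longrightarrow> ring_emb W k" "\<And>k h. k \<in> A \<Longrightarrow> h \<in> H \<Longrightarrow> restrict (k \<circ> h) K \<in> H"
    and r: "ring_emb W \<rho>" "\<And>y. y \<in> W \<Longrightarrow> (\<And>k. k \<in> A \<Longrightarrow> k y = y) \<Longrightarrow> \<rho> y = y"
    and h: "h \<in> H"
  shows "restrict (\<rho> \<circ> h) K \<in> H"
proof -
  have "(\<lambda>h. restrict (\<rho> \<circ> h) K) ` H = H"
  proof (rule trace_permutes[OF K W H r(1) H(1-3)])
    fix x assume x: "x \<in> K"
    show "\<rho> (\<Sum>h\<in>H. h x) = (\<Sum>h\<in>H. h x)"
    proof (rule r(2))
      show "(\<Sum>h\<in>H. h x) \<in> W" using H(4) x by (intro ring_set_sum[OF field_setD(1)[OF W]]) auto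
      show "k (\<Sum>h\<in>H. h x) = (\<Sum>h\<in>H. h x)" if "k \<in> A" for k
        using fixed_traces[OF K W H A(1)[OF that] A(2)[OF that] x] .
    qed
  qed
  then show ?thesis using h by blast
qed

section \<open>Galois groups\<close>

lemma gal_group_iff:
  assumes "field_set L"
  shows "\<tau> \<in> carrier (gal_group L F) \<longleftrightarrow>
    \<tau> \<in> extensional L \<and> bij_betw \<tau> L L \<and> ring_emb L \<tau> \<and> (\<forall>x\<in>F. \<tau> x = x)"
  using ring_setD(1)[OF field_setD(1)[OF assms]] ring_setD(3,4)[OF field_setD(1)[OF assms]]
  by (auto simp: gal_group_def Bij_def ring_iso_def Ring.ring_hom_def ring_emb_def bij_betw_def)

lemma gal_groupD:
  assumes "field_set L" "\<tau> \<in> carrier (gal_group L F)"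
  shows "\<tau> \<in> extensional L" "bij_betw \<tau> L L" "ring_emb L \<tau>" "x \<in> F \<Longrightarrow> \<tau> x = x" "x \<in> L \<Longrightarrow> \<tau> x \<in> L"
  using assms by (auto simp: gal_group_iff bij_betw_def)

lemma gal_group_mono:
  "F \<subseteq> F' \<Longrightarrow> carrier (gal_group L F') \<subseteq> carrier (gal_group L F)"
  by (auto simp: gal_group_def)

lemma gal_group_mult_one:
  assumes "field_set L"
  shows "\<sigma> \<in> carrier (gal_group L F) \<Longrightarrow> \<tau> \<in> carrier (gal_group L F) \<Longrightarrow>
      \<sigma> \<otimes>\<^bsub>gal_group L F\<^esub> \<tau> = compose L \<sigma> \<tau>"
    "\<one>\<^bsub>gal_group L F\<^esub> = (\<lambda>x\<in>L. x)"
  by (auto simp: gal_group_def BijGroup_def)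

lemma group_gal_group:
  assumes L: "field_set L" and F: "F \<subseteq> L"
  shows "group (gal_group L F)"
proof -
  note R = field_setD(1)[OF L]
  define H where "H = carrier (gal_group L F)"
  have eq: "gal_group L F = BijGroup L\<lparr>carrier := H\<rparr>" by (simp add: H_def gal_group_def)
  have HB: "H \<subseteq> Bij L" by (auto simp: H_def gal_group_def)
  have "subgroup H (BijGroup L)"
  proof (rule group.subgroupI[OF group_BijGroup])
    show "H \<subseteq> carrier (BijGroup L)" using HB by (simp add: BijGroup_def)
    have "(\<lambda>x\<in>L. x) \<in> H"
      using F ring_setD[OF R] by (auto simp: H_def gal_group_iff[OF L] ring_emb_def bij_betw_def inj_on_def)
    then show "H \<noteq> {}" by blast
    fix a assume a: "a \<in> H"
    note A = gal_groupD[OF L a[unfolded H_def]]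
    define b where "b = restrict (inv_into L a) L"
    have ab: "a (b x) = x" "b x \<in> L" if "x \<in> L" for x
      using that A(2) by (auto simp: b_def bij_betw_def f_inv_into_f inv_into_into)
    have ba: "b (a x) = x" if "x \<in> L" for x
      using that A(2,5) by (auto simp: b_def bij_betw_def)
    have "ring_emb L b"
      unfolding ring_emb_def
    proof (intro conjI ballI)
      show "b 1 = 1" using ba[of 1] ring_setD(1)[OF R] ring_embD(1)[OF A(3) R] by simp
      fix x y assume x: "x \<in> L" and y: "y \<in> L"
      show "b (x + y) = b x + b y"
        using ba[of "b x + b y"] ab[OF x] ab[OF y] ring_embD(2)[OF A(3) R] ring_setD(3)[OF R] by simp
      show "b (x * y) = b x * b y"
        using ba[of "b x * b y"] ab[OF x] ab[OF y] ring_embD(3)[OF A(3) R] ring_setD(4)[OF R] by simp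
    qed
    moreover have "bij_betw b L L"
      using bij_betw_inv_into[OF A(2)] by (simp add: b_def bij_betw_cong[of L "restrict (inv_into L a) L" "inv_into L a"])
    moreover have "b x = x" if "x \<in> F" for x using ba[of x] A(4)[OF that] F that by auto
    ultimately have "b \<in> H" by (auto simp: H_def gal_group_iff[OF L] b_def)
    then show "inv\<^bsub>BijGroup L\<^esub> a \<in> H" using inv_BijGroup[of a L] HB a by (auto simp: b_def)
    fix c assume c: "c \<in> H"
    note C = gal_groupD[OF L c[unfolded H_def]]
    have "compose L a c \<in> H"
      using A(1,4) C bij_betw_compose[OF C(2) A(2)] F
        ring_embD(1-3)[OF A(3) R] ring_embD(1-3)[OF C(3) R] ring_setD(1,3,4)[OF R]
      by (auto simp: H_def gal_group_iff[OF L] compose_def ring_emb_def subset_iff)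
    then show "a \<otimes>\<^bsub>BijGroup L\<^esub> c \<in> H" using a c HB by (auto simp: BijGroup_def)
  qed
  then show ?thesis unfolding eq by (rule subgroup.subgroup_is_group[OF _ group_BijGroup])
qed

lemma gal_group_apply:
  assumes L: "field_set L" and F: "F \<subseteq> L" and s: "\<sigma> \<in> carrier (gal_group L F)" and x: "x \<in> L"
  shows "\<tau> \<in> carrier (gal_group L F) \<Longrightarrow> (\<sigma> \<otimes>\<^bsub>gal_group L F\<^esub> \<tau>) x = \<sigma> (\<tau> x)"
    "(\<sigma> [^]\<^bsub>gal_group L F\<^esub> (n::nat)) x = (\<sigma> ^^ n) x"
    "(inv\<^bsub>gal_group L F\<^esub> \<sigma>) (\<sigma> x) = x" "\<one>\<^bsub>gal_group L F\<^esub> x = x"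
proof -
  interpret group "gal_group L F" by (rule group_gal_group[OF L F])
  note m = gal_group_mult_one[OF L]
  have mult: "(\<sigma> \<otimes>\<^bsub>gal_group L F\<^esub> \<tau>) x = \<sigma> (\<tau> x)"
    if "\<sigma> \<in> carrier (gal_group L F)" "\<tau> \<in> carrier (gal_group L F)" "x \<in> L" for \<sigma> \<tau> x
    using that by (simp add: m compose_def)
  show "(\<sigma> \<otimes>\<^bsub>gal_group L F\<^esub> \<tau>) x = \<sigma> (\<tau> x)" if "\<tau> \<in> carrier (gal_group L F)"
    using mult[OF s that x] .
  show one: "\<one>\<^bsub>gal_group L F\<^esub> x = x" using x by (simp add: m)
  show "(inv\<^bsub>gal_group L F\<^esub> \<sigma>) (\<sigma> x) = x"
    using mult[of "inv\<^bsub>gal_group L F\<^esub> \<sigma>" \<sigma> x] s x one by simp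
  show "(\<sigma> [^]\<^bsub>gal_group L F\<^esub> n) x = (\<sigma> ^^ n) x" using x
  proof (induction n arbitrary: x)
    case 0
    then show ?case by (simp add: m)
  next
    case (Suc n)
    then show ?case using s mult[OF nat_pow_closed[OF s] s Suc.prems] gal_groupD(5)[OF L s]
      by (simp add: funpow_swap1)
  qed
qed

text \<open>Artin's theorem for a finite group \<open>H\<close> acting on \<open>L\<close> itself, evaluated at the identity in \<open>H\<close>.\<close>

lemma artin_gal_group:
  assumes L: "field_set L" and F: "F \<subseteq> L" and H: "subgroup H (gal_group L F)" "finite H"
    and r: "\<rho> \<in> carrier (gal_group L F')" "\<And>y. y \<in> L \<Longrightarrow> (\<And>h. h \<in> H \<Longrightarrow> h y = y) \<Longrightarrow> \<rho> y = y"
  shows "\<rho> \<in> H"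
proof -
  interpret group "gal_group L F" by (rule group_gal_group[OF L F])
  have HC: "H \<subseteq> carrier (gal_group L F)" by (rule subgroup.subset[OF H(1)])
  have "restrict (\<rho> \<circ> \<one>\<^bsub>gal_group L F\<^esub>) L \<in> H"
  proof (rule artin_fixed_field[OF L L H(2), where A = H])
    show "H \<subseteq> extensional L" using HC gal_groupD(1)[OF L] by auto
    show "ring_emb L h" "h ` L \<subseteq> L" if "h \<in> H" for h
      using that gal_groupD(3,5)[OF L subsetD[OF HC that]] by auto
    fix k h assume kh: "k \<in> H" "h \<in> H"
    have "restrict (k \<circ> h) L = k \<otimes>\<^bsub>gal_group L F\<^esub> h"
      using kh HC by (subst gal_group_mult_one(1)[OF L]) (auto simp: compose_def)
    then show "restrict (k \<circ> h) L \<in> H" using subgroup.m_closed[OF H(1) kh] by simp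
  qed (use r gal_groupD[OF L r(1)] gal_groupD(3)[OF L subsetD[OF HC]] subgroup.one_closed[OF H(1)] in auto)
  moreover have "restrict (\<rho> \<circ> \<one>\<^bsub>gal_group L F\<^esub>) L = \<rho>"
    by (rule extensionalityI[of _ L]) (auto simp: gal_groupD(1)[OF L r(1)] gal_group_mult_one(2)[OF L])
  ultimately show ?thesis by simp
qed

lemma Rats_subset_field_set:
  fixes E :: "'a::field_char_0 set"
  assumes "field_set E"
  shows "\<rat> \<subseteq> E"
proof
  note R = ring_setD[OF field_setD(1)[OF assms]]
  fix x :: 'a assume "x \<in> \<rat>"
  then obtain q where q: "x = of_rat q" by (auto elim: Rats_cases)
  obtain a b where ab: "quotient_of q = (a, b)" by (cases "quotient_of q")
  have n: "of_nat n \<in> E" for n by (induction n) (use R in auto)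
  have "of_int i \<in> E" for i using n R(5)[OF n] by (cases i rule: int_cases2) auto
  then have "of_int a * inverse (of_int b) \<in> E" using R(4) field_setD(2)[OF assms] by blast
  moreover have "x = of_int a * inverse (of_int b)"
    unfolding q quotient_of_div[OF ab] by (simp add: of_rat_divide divide_inverse[symmetric])
  ultimately show "x \<in> E" by simp
qed

lemma field_set_Rats: "field_set (\<rat> :: 'a::field_char_0 set)"
  by (auto simp: field_set_def ring_set_def)

lemma ring_emb_fixes_Rats:
  fixes f :: "'a::field_char_0 \<Rightarrow> 'a"
  assumes f: "ring_emb E f" and E: "field_set E" and x: "x \<in> \<rat>"
  shows "f x = x"
proof -
  note R = field_setD(1)[OF E]
  have "field_set {x \<in> E. f x = x}"
    unfolding field_set_def ring_set_def
    using ring_setD[OF R] ring_embD[OF f R] ring_emb_inverse[OF f E] field_setD(2)[OF E] by auto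
  from subsetD[OF Rats_subset_field_set[OF this] x] show ?thesis by simp
qed

lemma ring_emb_subset: "ring_emb S f \<Longrightarrow> T \<subseteq> S \<Longrightarrow> ring_emb T f"
  by (auto simp: ring_emb_def)

lemma ring_emb_prod_linear:
  assumes f: "ring_emb S f" "ring_set S" and A: "\<And>a. a \<in> A \<Longrightarrow> u a \<in> S"
  shows "(\<Prod>a\<in>A. [:- u a, 1:]) \<in> poly_over S"
    "map_poly f (\<Prod>a\<in>A. [:- u a, 1:]) = (\<Prod>a\<in>A. [:- f (u a), 1:])"
proof -
  have l: "[:- a, 1:] \<in> poly_over S" if "a \<in> S" for a
    using that ring_setD[OF f(2)] by (intro poly_over_closed[OF f(2)]) auto
  have *: "(\<Prod>a\<in>A. [:- u a, 1:]) \<in> poly_over S" if "\<And>a. a \<in> A \<Longrightarrow> u a \<in> S" for A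
    using that by (intro poly_over_prod[OF f(2)] l) auto
  show "(\<Prod>a\<in>A. [:- u a, 1:]) \<in> poly_over S" by (rule *[OF A])
  show "map_poly f (\<Prod>a\<in>A. [:- u a, 1:]) = (\<Prod>a\<in>A. [:- f (u a), 1:])"
    using A
  proof (induction A rule: infinite_finite_induct)
    case (insert x A)
    then show ?case
      using ring_emb_map_poly(3)[OF f l *] ring_embD[OF f]
      by (simp add: Polynomial.map_poly_pCons del: mult_pCons_left)
  qed (auto simp: ring_embD[OF f])
qed

lemma ring_emb_root:
  fixes f :: "'a::field \<Rightarrow> 'a"
  assumes f: "ring_emb L f" "ring_set L" and p: "p \<in> poly_over E" "poly p x = 0"
    and E: "E \<subseteq> L" "\<And>y. y \<in> E \<Longrightarrow> f y = y" and x: "x \<in> L"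
  shows "poly p (f x) = 0"
proof -
  have pL: "p \<in> poly_over L" using p(1) poly_over_mono[OF E(1)] by blast
  have "map_poly f p = p"
    by (intro poly_eqI) (simp add: ring_emb_map_poly(1)[OF f] poly_overD[OF p(1)] E(2))
  then show ?thesis
    using ring_emb_map_poly(4)[OF f pL x] p(2) ring_embD(4)[OF f] by simp
qed

text \<open>The monic polynomial whose roots are the Galois conjugates of \<open>x\<close> has coefficients that are fixed by
  the Galois group, hence rational. So \<open>g\<close> permutes its roots.\<close>

lemma galois_extension_normal:
  fixes L :: "'a::field_char_0 set"
  assumes L: "field_set L" and alg: "\<And>x. x \<in> L \<Longrightarrow> algebraic_over \<rat> x"
    and fixed: "{x \<in> L. \<forall>\<sigma>\<in>carrier (gal_group L \<rat>). \<sigma> x = x} = \<rat>"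
    and g: "ring_emb L g"
  shows "g ` L = L"
proof -
  note R = field_setD(1)[OF L]
  have QL: "\<rat> \<subseteq> L" by (rule Rats_subset_field_set[OF L])
  interpret group "gal_group L \<rat>" by (rule group_gal_group[OF L QL])
  have "\<exists>A\<subseteq>L. x \<in> A \<and> g ` A = A" if x: "x \<in> L" for x
  proof -
    define A where "A = (\<lambda>\<sigma>. \<sigma> x) ` carrier (gal_group L \<rat>)"
    have AL: "A \<subseteq> L" using gal_groupD(5)[OF L _ x] by (auto simp: A_def)
    obtain p where p: "p \<in> poly_over \<rat>" "p \<noteq> 0" "poly p x = 0"
      using alg[OF x] by (auto simp: algebraic_over_def)
    define Z where "Z = {y. poly p y = 0}"
    have Z: "finite Z" unfolding Z_def by (rule poly_roots_finite[OF p(2)])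
    have "A \<subseteq> Z"
      using ring_emb_root[OF gal_groupD(3)[OF L] R p(1,3) QL gal_groupD(4)[OF L] x]
      by (auto simp: A_def Z_def)
    then have finA: "finite A" using Z finite_subset by blast
    have xA: "x \<in> A"
      unfolding A_def using gal_group_apply(4)[OF L QL one_closed x]
      by (intro image_eqI[OF _ one_closed]) simp
    define P where "P = (\<Prod>a\<in>A. [:- a, 1:])"
    have fac: "P \<in> poly_over L" "map_poly h P = (\<Prod>a\<in>A. [:- h a, 1:])" if "ring_emb L h" for h :: "'a \<Rightarrow> 'a"
      unfolding P_def by (rule ring_emb_prod_linear[OF that R, of A "\<lambda>a. a"], use AL in blast)+
    have PQ: "P \<in> poly_over \<rat>"
    proof (rule poly_overI)
      fix i
      have "\<sigma> (coeff P i) = coeff P i" if s: "\<sigma> \<in> carrier (gal_group L \<rat>)" for \<sigma>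
      proof -
        note S = gal_groupD[OF L s]
        have sub: "\<sigma> ` A \<subseteq> A"
        proof
          fix y assume "y \<in> \<sigma> ` A"
          then obtain \<tau> where t: "\<tau> \<in> carrier (gal_group L \<rat>)" "y = \<sigma> (\<tau> x)" by (auto simp: A_def)
          then have "y = (\<sigma> \<otimes>\<^bsub>gal_group L \<rat>\<^esub> \<tau>) x" using gal_group_apply(1)[OF L QL s x t(1)] by simp
          then show "y \<in> A" using m_closed[OF s t(1)] by (auto simp: A_def)
        qed
        have inj: "inj_on \<sigma> A" using inj_on_subset[OF ring_emb_inj[OF S(3) L] AL] .
        have "map_poly \<sigma> P = (\<Prod>a\<in>A. [:- \<sigma> a, 1:])" by (rule fac(2)[OF S(3)])
        also have "\<dots> = (\<Prod>a\<in>\<sigma> ` A. [:- a, 1:])" by (simp add: prod.reindex[OF inj])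
        also have "\<sigma> ` A = A" by (rule endo_inj_surj[OF finA sub inj])
        finally have "map_poly \<sigma> P = P" by (simp add: P_def)
        then show ?thesis using ring_emb_map_poly(1)[OF S(3) R, of P i] by simp
      qed
      moreover have "coeff P i \<in> L" using poly_overD[OF fac(1)[OF g]] .
      ultimately show "coeff P i \<in> \<rat>" using fixed by blast
    qed
    have "g ` A \<subseteq> A"
    proof
      fix y assume "y \<in> g ` A"
      then obtain a where a: "a \<in> A" "y = g a" by blast
      have "poly P a = 0" using a(1) finA by (simp add: P_def poly_prod)
      then have "poly (map_poly g P) (g a) = 0"
        using ring_emb_map_poly(4)[OF g R fac(1)[OF g], of a] a AL ring_embD(4)[OF g R] by auto
      moreover have "map_poly g P = P"
        by (intro poly_eqI) (simp add: ring_emb_map_poly(1)[OF g R] ring_emb_fixes_Rats[OF g L] poly_overD[OF PQ])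
      ultimately have "(\<Prod>b\<in>A. y - b) = 0" using a(2) by (simp add: P_def poly_prod)
      then show "y \<in> A" using finA by auto
    qed
    then have "g ` A = A"
      using inj_on_subset[OF ring_emb_inj[OF g L] AL] by (rule endo_inj_surj[OF finA])
    then show ?thesis using AL xA by blast
  qed
  note A = this
  show ?thesis
  proof (intro equalityI subsetI)
    fix y assume "y \<in> g ` L"
    then obtain x where x: "x \<in> L" "y = g x" by blast
    then show "y \<in> L" using A[OF x(1)] by blast
  next
    fix x assume "x \<in> L"
    from A[OF this] obtain B where B: "B \<subseteq> L" "x \<in> g ` B" by metis
    then show "x \<in> g ` L" by blast
  qed
qed

section \<open>The maximal abelian extension and the field of a character\<close>

text \<open>Passage from polynomials represented by the list of their coefficients, with the leading one
  first, to the type of polynomials.\<close>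

lemma algebraic_over_if_not_transcendental:
  fixes E :: "'a::field set"
  assumes E: "field_set E" and x: "\<not> ring.transcendental type_ring E x"
  shows "algebraic_over E x"
proof -
  interpret field "type_ring :: 'a ring" by (rule field_type_ring)
  have sub: "subring E type_ring" by (rule subfieldE(1)) (use E in \<open>simp add: subfield_iff_field_set\<close>)
  have "(algebraic over E) x" using x by (simp add: over_def)
  then obtain p where p: "p \<in> carrier (univ_poly type_ring E)" "p \<noteq> []" "eval p x = 0"
    using algebraicE[OF sub, of x] by auto
  have pw: "y [^]\<^bsub>type_ring\<^esub> n = y ^ n" for y :: 'a and n :: nat
    by (induction n) (simp_all add: nat_pow_def)
  have ev: "eval q x = poly (Poly (rev q)) x" for q
    by (induction q) (simp_all add: Poly_append pw poly_monom)
  have pE: "set p \<subseteq> E" "hd p \<noteq> 0"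
    using p(1,2) by (auto simp: univ_poly_def polynomial_def)
  define P where "P = Poly (rev p)"
  have "poly.coeff P i \<in> E" for i
  proof (cases "i < length p")
    case True
    then have "rev p ! i \<in> set p" by (metis length_rev nth_mem set_rev)
    then show ?thesis using True pE by (auto simp: P_def nth_default_def)
  next
    case False
    then show ?thesis using ring_setD(2)[OF field_setD(1)[OF E]] by (simp add: P_def nth_default_def)
  qed
  moreover have "poly.coeff P (length p - 1) = hd p"
    using p(2) by (simp add: P_def nth_default_def rev_nth hd_conv_nth)
  then have "P \<noteq> 0" using pE(2) by auto
  moreover have "poly P x = 0" using p(3) ev[of p] by (simp add: P_def)
  ultimately show ?thesis unfolding algebraic_over_def poly_over_def by blast
qed

lemma finite_extension_Q_iff:
  "finite_extension_Q K \<longleftrightarrow> field_set K \<and> ring.finite_dimension type_ring \<rat> K"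
  by (simp add: finite_extension_Q_def subfield_iff_field_set)

lemma field_set_Qab: "field_set Qab"
  unfolding Qab_def by (rule field_set_generate)

lemma Rats_subset_Qab: "\<rat> \<subseteq> Qab"
  by (rule Rats_subset_field_set[OF field_set_Qab])

lemma finite_abelian_extension_subset_Qab: "finite_abelian_extension_Q K \<Longrightarrow> K \<subseteq> Qab"
  unfolding Qab_def by (auto intro: generate_field.incl)

lemma finite_extension_not_transcendental:
  assumes "finite_extension_Q K" "x \<in> K"
  shows "\<not> ring.transcendental type_ring \<rat> x"
proof -
  interpret field "type_ring :: complex ring" by (rule field_type_ring)
  have "(algebraic over \<rat>) x"
    by (rule finite_dimension_imp_algebraic[of \<rat> K])
       (use assms subfieldE(1)[of K type_ring] field_set_Rats in
          \<open>auto simp: finite_extension_Q_iff subfield_iff_field_set\<close>)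
  then show ?thesis by (simp add: over_def)
qed

lemma Qab_algebraic:
  assumes "x \<in> Qab"
  shows "algebraic_over \<rat> x"
proof -
  interpret field "type_ring :: complex ring" by (rule field_type_ring)
  have "Qab \<subseteq> {x. \<not> ring.transcendental type_ring \<rat> x}"
    unfolding Qab_def
  proof (rule generate_field_subset)
    have "subfield {x \<in> carrier type_ring. (algebraic over \<rat>) x} (type_ring :: complex ring)"
      by (rule subfield_of_algebraics) (simp add: subfield_iff_field_set field_set_Rats)
    then show "field_set {x :: complex. \<not> ring.transcendental type_ring \<rat> x}"
      by (simp add: subfield_iff_field_set over_def)
    show "\<Union> {K. finite_abelian_extension_Q K} \<subseteq> {x. \<not> ring.transcendental type_ring \<rat> x}"
      using finite_extension_not_transcendental by (auto simp: finite_abelian_extension_Q_def)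
  qed
  then show ?thesis using assms algebraic_over_if_not_transcendental[OF field_set_Rats] by blast
qed

lemma image_field_set:
  assumes f: "ring_emb S f" and S: "field_set S"
  shows "field_set (f ` S)"
proof -
  note D = ring_embD[OF f field_setD(1)[OF S], symmetric] and R = ring_setD[OF field_setD(1)[OF S]]
  show ?thesis
    unfolding field_set_def ring_set_def
  proof (intro conjI ballI)
    show "1 \<in> f ` S" using D(1) R(1) by (rule image_eqI)
    fix x assume "x \<in> f ` S"
    then obtain a where a: "a \<in> S" "x = f a" by blast
    show "- x \<in> f ` S" unfolding a(2) using D(5)[OF a(1)] R(5)[OF a(1)] by (rule image_eqI)
    show "inverse x \<in> f ` S"
      unfolding a(2) using ring_emb_inverse[OF f S a(1), symmetric] field_setD(2)[OF S a(1)] by (rule image_eqI)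
    fix y assume "y \<in> f ` S"
    then obtain b where b: "b \<in> S" "y = f b" by blast
    show "x + y \<in> f ` S" unfolding a(2) b(2) using D(2)[OF a(1) b(1)] R(3)[OF a(1) b(1)] by (rule image_eqI)
    show "x * y \<in> f ` S" unfolding a(2) b(2) using D(3)[OF a(1) b(1)] R(4)[OF a(1) b(1)] by (rule image_eqI)
  qed
qed

text \<open>Each finite abelian extension of the rationals is normal, so \<open>g\<close> maps it onto itself; together they
  generate \<open>Qab\<close>.\<close>

lemma ring_emb_Qab_image:
  assumes g: "ring_emb Qab g"
  shows "g ` Qab = Qab"
proof
  note R = field_setD(1)[OF field_set_Qab]
  have gK: "g ` K = K" if K: "finite_abelian_extension_Q K" for K
  proof (rule galois_extension_normal)
    show "field_set K" using K by (simp add: finite_abelian_extension_Q_def finite_extension_Q_iff)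
    show "algebraic_over \<rat> x" if "x \<in> K" for x
      using Qab_algebraic finite_abelian_extension_subset_Qab[OF K] that by blast
    show "{x \<in> K. \<forall>\<sigma>\<in>carrier (gal_group K \<rat>). \<sigma> x = x} = \<rat>"
      using K by (simp add: finite_abelian_extension_Q_def)
    show "ring_emb K g" by (rule ring_emb_subset[OF g finite_abelian_extension_subset_Qab[OF K]])
  qed
  have "Qab \<subseteq> {x \<in> Qab. g x \<in> Qab}"
  proof (subst (1) Qab_def, rule generate_field_subset)
    show "field_set {x \<in> Qab. g x \<in> Qab}"
      unfolding field_set_def ring_set_def
      using ring_setD[OF R] ring_embD[OF g R] ring_emb_inverse[OF g field_set_Qab] field_setD(2)[OF field_set_Qab]
      by auto
    show "\<Union> {K. finite_abelian_extension_Q K} \<subseteq> {x \<in> Qab. g x \<in> Qab}"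
    proof
      fix x assume "x \<in> \<Union> {K. finite_abelian_extension_Q K}"
      then obtain K where K: "finite_abelian_extension_Q K" "x \<in> K" by blast
      then have "g x \<in> K" using gK[OF K(1)] by (metis imageI)
      then show "x \<in> {x \<in> Qab. g x \<in> Qab}" using K finite_abelian_extension_subset_Qab[OF K(1)] by auto
    qed
  qed
  then show "g ` Qab \<subseteq> Qab" by blast
  show "Qab \<subseteq> g ` Qab"
  proof (subst (1) Qab_def, rule generate_field_subset[OF image_field_set[OF g field_set_Qab]])
    show "\<Union> {K. finite_abelian_extension_Q K} \<subseteq> g ` Qab"
    proof
      fix x assume "x \<in> \<Union> {K. finite_abelian_extension_Q K}"
      then obtain K where K: "finite_abelian_extension_Q K" "x \<in> K" by blast
      then have "x \<in> g ` K" using gK[OF K(1)] by simp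
      then show "x \<in> g ` Qab" using finite_abelian_extension_subset_Qab[OF K(1)] by blast
    qed
  qed
qed

text \<open>The fixed field of Gal(Qab/E) is \<open>E\<close>: some embedding of \<open>Qab\<close> over \<open>E\<close> moves \<open>x\<close>, and it is an
  automorphism by normality.\<close>

theorem gal_group_Qab_moves:
  assumes E: "field_set E" "E \<subseteq> Qab" and x: "x \<in> Qab" "x \<notin> E"
  obtains \<sigma> where "\<sigma> \<in> carrier (gal_group Qab E)" "\<sigma> x \<noteq> x"
proof -
  have "algebraic_over E y" if "y \<in> Qab" for y
    by (rule algebraic_over_mono[OF Qab_algebraic[OF that] Rats_subset_field_set[OF E(1)]])
  then obtain g where g: "ring_emb Qab g" "\<And>y. y \<in> E \<Longrightarrow> g y = y" "g x \<noteq> x"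
    using ring_emb_moves[OF E(1) field_set_Qab E(2) _ x] by metis
  have "ring_emb Qab (restrict g Qab)"
    unfolding ring_emb_def
    using ring_setD[OF field_setD(1)[OF field_set_Qab]] ring_embD[OF g(1) field_setD(1)[OF field_set_Qab]] by auto
  moreover have "bij_betw (restrict g Qab) Qab Qab"
    using ring_emb_inj[OF g(1) field_set_Qab] ring_emb_Qab_image[OF g(1)] by (simp add: bij_betw_def)
  ultimately have "restrict g Qab \<in> carrier (gal_group Qab E)"
    using g(2) E(2) by (auto simp: gal_group_iff[OF field_set_Qab])
  then show ?thesis using that g(3) x(1) by auto
qed

lemma KK_iff: "K \<in> \<K> \<longleftrightarrow> field_set K \<and> ring.finite_dimension type_ring \<rat> K \<and> K \<subseteq> Qab"
  by (auto simp: finite_subextensions_def finite_extension_Q_iff)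

lemma KK_subfield:
  assumes K: "K \<in> \<K>" and k: "field_set k" "k \<subseteq> K"
  shows "k \<in> \<K>"
proof -
  interpret field "type_ring :: complex ring" by (rule field_type_ring)
  note R = field_setD(1)[OF k(1)]
  have Q: "subfield (\<rat> :: complex set) type_ring" by (simp add: subfield_iff_field_set field_set_Rats)
  have k': "subfield k (type_ring :: complex ring)" using k(1) by (simp add: subfield_iff_field_set)
  have "subalgebra \<rat> k type_ring"
    using subring.axioms(1)[OF subfieldE(1)[OF k']] ring_setD(4)[OF R] Rats_subset_field_set[OF k(1)]
    by (auto simp: subalgebra_def subalgebra_axioms_def)
  then have "finite_dimension \<rat> k"
    using subalbegra_incl_imp_finite_dimension[OF Q _ _ k(2)] K by (simp add: KK_iff)
  then show ?thesis using K k by (auto simp: KK_iff)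
qed

text \<open>An embedding is determined by its values on a finite spanning set, and each of these values is a
  root of a fixed polynomial.\<close>

lemma finite_embeddings:
  assumes K: "K \<in> \<K>"
  shows "finite {h :: complex \<Rightarrow> complex. h \<in> extensional K \<and> ring_emb K h}" (is "finite ?H")
proof -
  interpret field "type_ring :: complex ring" by (rule field_type_ring)
  have F: "field_set K" and KQ: "K \<subseteq> Qab" using K by (auto simp: KK_iff)
  note R = field_setD(1)[OF F]
  have Q: "subfield (\<rat> :: complex set) type_ring" by (simp add: subfield_iff_field_set field_set_Rats)
  have fd: "finite_dimension \<rat> K" using K by (simp add: KK_iff)
  then obtain n where "dimension n \<rat> K" by auto
  then obtain Us where Us: "Span \<rat> Us = K"
    using exists_base[OF Q] by auto
  have UsK: "set Us \<subseteq> K"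
  proof -
    have "set Us \<subseteq> Span \<rat> Us" by (rule Span_base_incl[OF Q]) simp
    then show ?thesis by (simp only: Us)
  qed
  have eq: "h x = h' x"
    if h: "ring_emb K h" "ring_emb K h'" and e: "map h Vs = map h' Vs" and V: "set Vs \<subseteq> K"
      and x: "x \<in> Span \<rat> Vs" for h h' :: "complex \<Rightarrow> complex" and Vs x
    using e V x
  proof (induction Vs arbitrary: x)
    case Nil
    then show ?case by (simp add: ring_embD(4)[OF h(1) R] ring_embD(4)[OF h(2) R])
  next
    case (Cons u Vs)
    then obtain k v where kv: "k \<in> \<rat>" "v \<in> Span \<rat> Vs" "x = k * u + v"
      by (auto simp: line_extension_mem_iff)
    have kK: "k \<in> K" using kv(1) Rats_subset_field_set[OF F] by blast
    have vK: "v \<in> K"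
    proof -
      have "Span \<rat> Vs \<subseteq> Span \<rat> Us"
        using Cons.prems(2) UsK Us by (intro mono_Span_subset[OF Q]) (simp_all only: Us, auto)
      then show ?thesis using kv(2) Us by blast
    qed
    have uK: "u \<in> K" "k * u \<in> K" using Cons.prems(2) ring_setD(4)[OF R kK] by auto
    have "h v = h' v" using Cons.IH Cons.prems kv(2) by auto
    moreover have "h k = k" "h' k = k" using ring_emb_fixes_Rats[OF _ F kv(1)] h by auto
    moreover have "h u = h' u" using Cons.prems(1) by simp
    ultimately show ?case
      using kv(3) kK uK vK by (simp add: ring_embD[OF h(1) R] ring_embD[OF h(2) R])
  qed
  have "\<exists>p. p \<in> poly_over \<rat> \<and> p \<noteq> 0 \<and> poly p u = 0" if "u \<in> K" for u
    using Qab_algebraic[of u] that KQ by (auto simp: algebraic_over_def)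
  then obtain p where p: "\<And>u. u \<in> K \<Longrightarrow> p u \<in> poly_over \<rat> \<and> p u \<noteq> 0 \<and> poly (p u) u = 0" by metis
  define Z where "Z = (\<Union>u\<in>set Us. {y. poly (p u) y = 0})"
  have finZ: "finite Z"
    unfolding Z_def using p UsK by (auto intro!: poly_roots_finite)
  have "inj_on (\<lambda>h. map h Us) ?H"
  proof (rule inj_onI)
    fix h h' assume "h \<in> ?H" "h' \<in> ?H" "map h Us = map h' Us"
    then show "h = h'" using eq[of h h' Us] UsK Us by (intro extensionalityI[of _ K]) auto
  qed
  moreover have "(\<lambda>h. map h Us) ` ?H \<subseteq> {xs. set xs \<subseteq> Z \<and> length xs = length Us}"
  proof
    fix xs assume "xs \<in> (\<lambda>h. map h Us) ` ?H"
    then obtain h where h: "ring_emb K h" "xs = map h Us" by blast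
    have "h u \<in> Z" if u: "u \<in> set Us" for u
      using ring_emb_root[OF h(1) R, of "p u" \<rat> u] p[of u] UsK u Rats_subset_field_set[OF F]
        ring_emb_fixes_Rats[OF h(1) F] by (auto simp: Z_def)
    then show "xs \<in> {xs. set xs \<subseteq> Z \<and> length xs = length Us}" using h(2) by auto
  qed
  ultimately show ?thesis
    using finite_imageD finite_subset[OF _ finite_lists_length_eq[OF finZ]] by blast
qed

lemma GalQab_mult_closed:
  assumes "\<sigma> \<in> carrier \<G>" "\<tau> \<in> carrier \<G>"
  shows "\<sigma> \<otimes>\<^bsub>\<G>\<^esub> \<tau> \<in> carrier \<G>" "x \<in> Qab \<Longrightarrow> (\<sigma> \<otimes>\<^bsub>\<G>\<^esub> \<tau>) x = \<sigma> (\<tau> x)"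
  using monoid.m_closed[OF group.is_monoid[OF group_gal_group[OF field_set_Qab Rats_subset_Qab]]]
    gal_group_apply(1)[OF field_set_Qab Rats_subset_Qab] assms
  by (simp_all add: GalQab_def)

lemma group_GalQab: "group \<G>"
  unfolding GalQab_def by (rule group_gal_group[OF field_set_Qab Rats_subset_Qab])

lemma gal_group_Qab_subset: "field_set E \<Longrightarrow> carrier (gal_group Qab E) \<subseteq> carrier \<G>"
  unfolding GalQab_def by (rule gal_group_mono) (rule Rats_subset_field_set)

lemma GalQabD:
  assumes "\<sigma> \<in> carrier \<G>"
  shows "ring_emb Qab \<sigma>" "x \<in> Qab \<Longrightarrow> \<sigma> x \<in> Qab" "x \<in> \<rat> \<Longrightarrow> \<sigma> x = x" "\<sigma> \<in> extensional Qab"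
    "x \<in> Qab \<Longrightarrow> (inv\<^bsub>\<G>\<^esub> \<sigma>) (\<sigma> x) = x" "x \<in> Qab \<Longrightarrow> \<sigma> ((inv\<^bsub>\<G>\<^esub> \<sigma>) x) = x"
    "x \<in> Qab \<Longrightarrow> \<one>\<^bsub>\<G>\<^esub> x = x"
proof -
  interpret group \<G> by (rule group_GalQab)
  have s: "\<sigma> \<in> carrier (gal_group Qab \<rat>)" using assms by (simp add: GalQab_def)
  show "ring_emb Qab \<sigma>" "x \<in> Qab \<Longrightarrow> \<sigma> x \<in> Qab" "x \<in> \<rat> \<Longrightarrow> \<sigma> x = x" "\<sigma> \<in> extensional Qab"
    using gal_groupD[OF field_set_Qab s] by auto
  show "x \<in> Qab \<Longrightarrow> (inv\<^bsub>\<G>\<^esub> \<sigma>) (\<sigma> x) = x"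
    using gal_group_apply(3)[OF field_set_Qab Rats_subset_Qab s] by (simp add: GalQab_def)
  show 1: "x \<in> Qab \<Longrightarrow> \<one>\<^bsub>\<G>\<^esub> x = x"
    using gal_group_apply(4)[OF field_set_Qab Rats_subset_Qab s] by (simp add: GalQab_def)
  show "x \<in> Qab \<Longrightarrow> \<sigma> ((inv\<^bsub>\<G>\<^esub> \<sigma>) x) = x"
    using GalQab_mult_closed(2)[OF assms inv_closed[OF assms], of x] 1 assms by simp
qed

lemma characterD:
  assumes "\<psi> \<in> characters"
  shows "\<sigma> \<in> carrier \<G> \<Longrightarrow> \<tau> \<in> carrier \<G> \<Longrightarrow> \<psi> (\<sigma> \<otimes>\<^bsub>\<G>\<^esub> \<tau>) = \<psi> \<sigma> * \<psi> \<tau>"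
    "\<psi> \<in> extensional (carrier \<G>)" "\<sigma> \<in> carrier \<G> \<Longrightarrow> \<psi> \<sigma> \<noteq> 0" "\<psi> \<one>\<^bsub>\<G>\<^esub> = 1"
    "\<sigma> \<in> carrier \<G> \<Longrightarrow> \<psi> (inv\<^bsub>\<G>\<^esub> \<sigma>) = inverse (\<psi> \<sigma>)"
    "\<sigma> \<in> carrier \<G> \<Longrightarrow> \<psi> (\<sigma> [^]\<^bsub>\<G>\<^esub> (n::nat)) = \<psi> \<sigma> ^ n"
proof -
  interpret group \<G> by (rule group_GalQab)
  show ext: "\<psi> \<in> extensional (carrier \<G>)" and mult: "\<And>\<sigma> \<tau>. \<sigma> \<in> carrier \<G> \<Longrightarrow> \<tau> \<in> carrier \<G> \<Longrightarrow> \<psi> (\<sigma> \<otimes>\<^bsub>\<G>\<^esub> \<tau>) = \<psi> \<sigma> * \<psi> \<tau>"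
    and nz: "\<And>\<sigma>. \<sigma> \<in> carrier \<G> \<Longrightarrow> \<psi> \<sigma> \<noteq> 0"
    using assms by (auto simp: characters_def hom_def units_of_def Units_def Pi_def dest!: bspec)
  show one: "\<psi> \<one>\<^bsub>\<G>\<^esub> = 1" using mult[of "\<one>\<^bsub>\<G>\<^esub>" "\<one>\<^bsub>\<G>\<^esub>"] nz[of "\<one>\<^bsub>\<G>\<^esub>"] by simp
  show "\<psi> (inv\<^bsub>\<G>\<^esub> \<sigma>) = inverse (\<psi> \<sigma>)" if "\<sigma> \<in> carrier \<G>"
    using mult[of \<sigma> "inv\<^bsub>\<G>\<^esub> \<sigma>"] that one by (simp add: inverse_unique)
  show "\<psi> (\<sigma> [^]\<^bsub>\<G>\<^esub> n) = \<psi> \<sigma> ^ n" if "\<sigma> \<in> carrier \<G>"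
    by (induction n) (use that one mult in auto)
qed

lemma kernel_field_subset: "kernel_field \<psi> \<subseteq> Qab"
  by (auto simp: kernel_field_def)

lemma field_set_fixed:
  assumes L: "field_set L" and A: "\<And>f. f \<in> A \<Longrightarrow> ring_emb L f"
  shows "field_set {x \<in> L. \<forall>f\<in>A. f x = x}"
proof -
  note R = field_setD(1)[OF L]
  have "f 1 = 1" if "f \<in> A" for f using ring_embD(1)[OF A[OF that] R] .
  moreover have "f (x + y) = x + y" "f (x * y) = x * y"
    if "x \<in> L" "y \<in> L" "\<forall>f\<in>A. f x = x" "\<forall>f\<in>A. f y = y" "f \<in> A" for f x y
    using ring_embD(2,3)[OF A[OF that(5)] R that(1,2)] bspec[OF that(3,5)] bspec[OF that(4,5)] by metis+
  moreover have "f (- x) = - x" "f (inverse x) = inverse x" if "x \<in> L" "\<forall>f\<in>A. f x = x" "f \<in> A" for f x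
    using ring_embD(5)[OF A[OF that(3)] R that(1)] ring_emb_inverse[OF A[OF that(3)] L that(1)] bspec[OF that(2,3)] by metis+
  ultimately show ?thesis
    unfolding field_set_def ring_set_def
    by (intro conjI ballI CollectI) (use ring_setD[OF R] field_setD(2)[OF L] in \<open>simp_all\<close>)
qed

lemma kernel_field_eq:
  "kernel_field \<psi> = {x \<in> Qab. \<forall>\<sigma>\<in>{\<sigma> \<in> carrier \<G>. \<psi> \<sigma> = 1}. \<sigma> x = x}"
  by (auto simp: kernel_field_def)

lemma field_set_kernel_field: "field_set (kernel_field \<psi>)"
  unfolding kernel_field_eq by (rule field_set_fixed[OF field_set_Qab]) (use GalQabD(1) in blast)

text \<open>By continuity, \<open>\<psi>\<close> is trivial on Gal(Qab/K) for some finite \<open>K\<close>. The field fixed by its kernel is then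
  contained in \<open>K\<close>.\<close>

lemma kernel_field_in_KK:
  assumes "\<psi> \<in> characters"
  shows "kernel_field \<psi> \<in> \<K>"
proof -
  obtain K where K: "K \<in> \<K>" "\<And>\<sigma>. \<sigma> \<in> carrier (gal_group Qab K) \<Longrightarrow> \<psi> \<sigma> = 1"
    using assms by (auto simp: characters_def)
  have F: "field_set K" "K \<subseteq> Qab" using K(1) by (auto simp: KK_iff)
  have "kernel_field \<psi> \<subseteq> K"
  proof
    fix x assume x: "x \<in> kernel_field \<psi>"
    show "x \<in> K"
    proof (rule ccontr)
      assume "x \<notin> K"
      then obtain \<sigma> where s: "\<sigma> \<in> carrier (gal_group Qab K)" "\<sigma> x \<noteq> x"
        using gal_group_Qab_moves[OF F] kernel_field_subset x by blast
      then show False using x K(2)[OF s(1)] gal_group_Qab_subset[OF F(1)] by (auto simp: kernel_field_def)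
    qed
  qed
  then show ?thesis by (rule KK_subfield[OF K(1) field_set_kernel_field])
qed

text \<open>The kernel of \<open>\<psi>\<close> is recovered from its fixed field because it is closed: it contains Gal(Qab/K) for a
  finite \<open>K\<close>, and its elements have only finitely many restrictions to \<open>K\<close>, to which Artin's theorem
  applies.\<close>

theorem kernel_of_character:
  assumes psi: "\<psi> \<in> characters" and r: "\<rho> \<in> carrier \<G>"
  shows "\<psi> \<rho> = 1 \<longleftrightarrow> (\<forall>x\<in>kernel_field \<psi>. \<rho> x = x)"
proof
  assume fix_r: "\<forall>x\<in>kernel_field \<psi>. \<rho> x = x"
  interpret group \<G> by (rule group_GalQab)
  note C = characterD[OF psi]
  obtain K where K: "K \<in> \<K>" "\<And>\<sigma>. \<sigma> \<in> carrier (gal_group Qab K) \<Longrightarrow> \<psi> \<sigma> = 1"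
    using psi by (auto simp: characters_def)
  have F: "field_set K" "K \<subseteq> Qab" using K(1) by (auto simp: KK_iff)
  define A where "A = {\<sigma> \<in> carrier \<G>. \<psi> \<sigma> = 1}"
  define H where "H = (\<lambda>h. restrict h K) ` A"
  have emb: "ring_emb K (restrict h K)" if "ring_emb Qab h" for h :: "complex \<Rightarrow> complex"
    using ring_emb_subset[OF that F(2)] ring_setD[OF field_setD(1)[OF F(1)]] by (auto simp: ring_emb_def)
  have "restrict (\<rho> \<circ> restrict \<one>\<^bsub>\<G>\<^esub> K) K \<in> H"
  proof (rule artin_fixed_field[OF F(1) field_set_Qab, where A = A])
    have "H \<subseteq> {h. h \<in> extensional K \<and> ring_emb K h}"
      using emb GalQabD(1) by (auto simp: H_def A_def)
    then show "finite H" using finite_embeddings[OF K(1)] finite_subset by blast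
    show "H \<subseteq> extensional K" by (auto simp: H_def)
    show "ring_emb K h" if "h \<in> H" for h using that emb GalQabD(1) by (auto simp: H_def A_def)
    show "h ` K \<subseteq> Qab" if "h \<in> H" for h
      using that F(2) GalQabD(2) by (auto simp: H_def A_def subset_iff)
    show "ring_emb Qab k" if "k \<in> A" for k using that GalQabD(1) by (auto simp: A_def)
    show "restrict (k \<circ> h) K \<in> H" if kh: "k \<in> A" "h \<in> H" for k h
    proof -
      obtain h' where h': "h' \<in> A" "h = restrict h' K" using kh(2) by (auto simp: H_def)
      have "k \<otimes>\<^bsub>\<G>\<^esub> h' \<in> A" using kh(1) h'(1) C(1) by (auto simp: A_def)
      moreover have "restrict (k \<circ> h) K = restrict (k \<otimes>\<^bsub>\<G>\<^esub> h') K"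
        using kh(1) h' F(2) GalQab_mult_closed(2)[of k h'] by (auto simp: A_def fun_eq_iff restrict_def subset_iff)
      ultimately show ?thesis by (auto simp: H_def)
    qed
    show "ring_emb Qab \<rho>" by (rule GalQabD(1)[OF r])
    show "\<rho> y = y" if "y \<in> Qab" "\<And>k. k \<in> A \<Longrightarrow> k y = y" for y
      using that fix_r by (auto simp: kernel_field_def A_def)
    show "restrict \<one>\<^bsub>\<G>\<^esub> K \<in> H" using C(4) by (auto simp: H_def A_def)
  qed
  then obtain h where h: "h \<in> A" "restrict (\<rho> \<circ> restrict \<one>\<^bsub>\<G>\<^esub> K) K = restrict h K" by (auto simp: H_def)
  have hG: "h \<in> carrier \<G>" using h(1) by (simp add: A_def)
  have hr: "h x = \<rho> x" if "x \<in> K" for x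
    using fun_cong[OF h(2), of x] that F(2) GalQabD(7)[OF r, of x] by (auto simp: restrict_def)
  \<comment> \<open>\<open>\<rho>\<close> agrees on \<open>K\<close> with \<open>h\<close> in the kernel, so the two differ by an element of Gal(Qab/K)\<close>
  define \<tau> where "\<tau> = inv\<^bsub>\<G>\<^esub> h \<otimes>\<^bsub>\<G>\<^esub> \<rho>"
  have t: "\<tau> \<in> carrier \<G>" using hG r by (simp add: \<tau>_def)
  have "\<tau> x = x" if x: "x \<in> K" for x
  proof -
    have xQ: "x \<in> Qab" using x F(2) by blast
    have "\<tau> x = (inv\<^bsub>\<G>\<^esub> h) (h x)"
      unfolding \<tau>_def using GalQab_mult_closed(2)[OF inv_closed[OF hG] r xQ] hr[OF x] by simp
    then show ?thesis using GalQabD(5)[OF hG xQ] by simp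
  qed
  then have "\<tau> \<in> carrier (gal_group Qab K)"
    using t by (auto simp: GalQab_def gal_group_iff[OF field_set_Qab])
  then have "\<psi> \<tau> = 1" by (rule K(2))
  moreover have "\<psi> \<tau> = inverse (\<psi> h) * \<psi> \<rho>" unfolding \<tau>_def using C(1,5) hG r by simp
  ultimately show "\<psi> \<rho> = 1" using h(1) by (simp add: A_def)
qed (use r in \<open>auto simp: kernel_field_def\<close>)

text \<open>The kernel of \<open>\<psi>\<close> is a normal subgroup.\<close>

lemma kernel_field_stable:
  assumes psi: "\<psi> \<in> characters" and s: "\<sigma> \<in> carrier \<G>" and x: "x \<in> kernel_field \<psi>"
  shows "\<sigma> x \<in> kernel_field \<psi>"
proof -
  interpret group \<G> by (rule group_GalQab)
  note C = characterD[OF psi]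
  have xQ: "x \<in> Qab" using x kernel_field_subset by blast
  have "h (\<sigma> x) = \<sigma> x" if h: "h \<in> carrier \<G>" "\<psi> h = 1" for h
  proof -
    define t where "t = inv\<^bsub>\<G>\<^esub> \<sigma> \<otimes>\<^bsub>\<G>\<^esub> (h \<otimes>\<^bsub>\<G>\<^esub> \<sigma>)"
    have t: "t \<in> carrier \<G>" "\<psi> t = 1" using s h C by (simp_all add: t_def)
    then have "t x = x" using x by (auto simp: kernel_field_def)
    moreover have "t x = (inv\<^bsub>\<G>\<^esub> \<sigma>) (h (\<sigma> x))"
      unfolding t_def using s h xQ GalQab_mult_closed(2) by simp
    ultimately show ?thesis using GalQabD(6)[OF s, of "h (\<sigma> x)"] GalQabD(2) s h(1) xQ by metis
  qed
  then show ?thesis using GalQabD(2)[OF s xQ] by (auto simp: kernel_field_def)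
qed

lemma restrict_kernel_field:
  assumes psi: "\<psi> \<in> characters" and s: "\<sigma> \<in> carrier \<G>"
  shows "restrict \<sigma> (kernel_field \<psi>) \<in> carrier (gal_group (kernel_field \<psi>) \<rat>)"
proof -
  interpret group \<G> by (rule group_GalQab)
  let ?K = "kernel_field \<psi>"
  note F = field_set_kernel_field[of \<psi>] and sub = kernel_field_subset[of \<psi>]
  have emb: "ring_emb ?K \<sigma>" by (rule ring_emb_subset[OF GalQabD(1)[OF s] sub])
  have "\<sigma> ` ?K = ?K"
  proof
    show "\<sigma> ` ?K \<subseteq> ?K" using kernel_field_stable[OF psi s] by blast
    show "?K \<subseteq> \<sigma> ` ?K"
    proof
      fix x assume x: "x \<in> ?K"
      then have "x = \<sigma> ((inv\<^bsub>\<G>\<^esub> \<sigma>) x)" using GalQabD(6)[OF s] sub by auto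
      then show "x \<in> \<sigma> ` ?K" using kernel_field_stable[OF psi inv_closed[OF s] x] by (rule image_eqI)
    qed
  qed
  moreover have "ring_emb ?K (restrict \<sigma> ?K)"
    using emb ring_setD[OF field_setD(1)[OF F]] by (auto simp: ring_emb_def)
  ultimately show ?thesis
    using ring_emb_inj[OF emb F] GalQabD(3)[OF s] Rats_subset_field_set[OF F]
    by (auto simp: gal_group_iff[OF F] bij_betw_def)
qed

text \<open>The restrictions of elements of \<open>\<G>\<close> form a finite group of automorphisms of \<open>K\<close> with fixed field
  \<open>\<rat>\<close>; by Artin's theorem they are all of Gal(K/Q).\<close>

theorem lift_from_kernel_field:
  assumes psi: "\<psi> \<in> characters" and r: "\<rho> \<in> carrier (gal_group (kernel_field \<psi>) \<rat>)"
  obtains \<sigma> where "\<sigma> \<in> carrier \<G>" "restrict \<sigma> (kernel_field \<psi>) = \<rho>"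
proof -
  interpret group \<G> by (rule group_GalQab)
  define K where "K = kernel_field \<psi>"
  have F: "field_set K" "K \<subseteq> Qab" "\<rat> \<subseteq> K"
    using field_set_kernel_field kernel_field_subset Rats_subset_field_set[OF field_set_kernel_field]
    by (simp_all add: K_def)
  interpret GK: group "gal_group K \<rat>" by (rule group_gal_group[OF F(1,3)])
  define H where "H = (\<lambda>\<sigma>. restrict \<sigma> K) ` carrier \<G>"
  have HG: "H \<subseteq> carrier (gal_group K \<rat>)" using restrict_kernel_field[OF psi] by (auto simp: H_def K_def)
  have mult: "restrict \<sigma> K \<otimes>\<^bsub>gal_group K \<rat>\<^esub> restrict \<tau> K = restrict (\<sigma> \<otimes>\<^bsub>\<G>\<^esub> \<tau>) K"
    if "\<sigma> \<in> carrier \<G>" "\<tau> \<in> carrier \<G>" for \<sigma> \<tau>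
  proof (subst gal_group_mult_one(1)[OF F(1)])
    show "compose K (restrict \<sigma> K) (restrict \<tau> K) = restrict (\<sigma> \<otimes>\<^bsub>\<G>\<^esub> \<tau>) K"
      using that kernel_field_stable[OF psi that(2)] F(2) GalQab_mult_closed(2)[OF that]
      by (auto simp: compose_def restrict_def fun_eq_iff K_def)
  qed (use restrict_kernel_field[OF psi] that in \<open>auto simp: K_def\<close>)
  have one: "restrict \<one>\<^bsub>\<G>\<^esub> K = \<one>\<^bsub>gal_group K \<rat>\<^esub>"
    using GalQabD(7) F(2) by (auto simp: gal_group_mult_one(2)[OF F(1)] restrict_def fun_eq_iff)
  have "\<rho> \<in> H"
  proof (rule artin_gal_group[OF F(1,3)])
    show "subgroup H (gal_group K \<rat>)"
    proof (rule GK.subgroupI[OF HG])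
      show "H \<noteq> {}" by (auto simp: H_def)
      fix a b assume "a \<in> H" "b \<in> H"
      then show "a \<otimes>\<^bsub>gal_group K \<rat>\<^esub> b \<in> H" using mult by (auto simp: H_def)
    next
      fix a assume "a \<in> H"
      then obtain \<sigma> where s: "\<sigma> \<in> carrier \<G>" "a = restrict \<sigma> K" by (auto simp: H_def)
      have "restrict (inv\<^bsub>\<G>\<^esub> \<sigma>) K \<otimes>\<^bsub>gal_group K \<rat>\<^esub> a = \<one>\<^bsub>gal_group K \<rat>\<^esub>"
        unfolding s(2) using mult[OF inv_closed[OF s(1)] s(1)] s(1) one by simp
      then have "inv\<^bsub>gal_group K \<rat>\<^esub> a = restrict (inv\<^bsub>\<G>\<^esub> \<sigma>) K"
        by (rule GK.inv_equality) (use s restrict_kernel_field[OF psi] in \<open>auto simp: K_def\<close>)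
      then show "inv\<^bsub>gal_group K \<rat>\<^esub> a \<in> H" using s(1) by (auto simp: H_def)
    qed
    have "H \<subseteq> {h. h \<in> extensional K \<and> ring_emb K h}"
      using HG gal_groupD(1,3)[OF F(1)] by blast
    then show "finite H" using finite_embeddings[OF kernel_field_in_KK[OF psi]] finite_subset
      unfolding K_def by blast
    show "\<rho> \<in> carrier (gal_group K \<rat>)" using r by (simp add: K_def)
    show "\<rho> y = y" if y: "y \<in> K" "\<And>h. h \<in> H \<Longrightarrow> h y = y" for y
    proof -
      have "y \<in> \<rat>"
      proof (rule ccontr)
        assume "y \<notin> \<rat>"
        then obtain \<sigma> where s: "\<sigma> \<in> carrier \<G>" "\<sigma> y \<noteq> y"
          using gal_group_Qab_moves[OF field_set_Rats Rats_subset_Qab] y(1) F(2) by (auto simp: GalQab_def)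
        then show False using y(1) y(2)[of "restrict \<sigma> K"] by (simp add: H_def)
      qed
      then show ?thesis using r by (simp add: gal_group_def)
    qed
  qed
  then show ?thesis using that by (auto simp: H_def K_def)
qed

lemma lift_aut:
  assumes psi: "\<psi> \<in> characters" and r: "\<rho> \<in> carrier (gal_group (kernel_field \<psi>) \<rat>)"
  shows "lift_aut (kernel_field \<psi>) \<rho> \<in> carrier \<G>"
    "restrict (lift_aut (kernel_field \<psi>) \<rho>) (kernel_field \<psi>) = \<rho>"
  using someI_ex[of "\<lambda>\<sigma>. \<sigma> \<in> carrier \<G> \<and> restrict \<sigma> (kernel_field \<psi>) = \<rho>"]
    lift_from_kernel_field[OF psi r] unfolding lift_aut_def by metis+

section \<open>Fields generated by a root of unity\<close>

lemma not_transcendental_iff: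
  fixes E :: "'a::field set"
  assumes E: "field_set E"
  shows "\<not> ring.transcendental type_ring E x \<longleftrightarrow> algebraic_over E x"
proof
  assume "algebraic_over E x"
  then obtain p where p: "p \<in> poly_over E" "p \<noteq> 0" "poly p x = 0" by (auto simp: algebraic_over_def)
  interpret field "type_ring :: 'a ring" by (rule field_type_ring)
  have pw: "y [^]\<^bsub>type_ring\<^esub> n = y ^ n" for y :: 'a and n :: nat
    by (induction n) (simp_all add: nat_pow_def)
  have ev: "eval q x = poly (Poly (rev q)) x" for q
    by (induction q) (simp_all add: Poly_append pw poly_monom)
  have "set (coeffs p) \<subseteq> E" using poly_overD[OF p(1)] by (auto simp: coeffs_def)
  then have "rev (coeffs p) \<in> carrier (univ_poly type_ring E)"
    using p(2) by (auto simp: univ_poly_def polynomial_def hd_rev last_coeffs_eq_coeff_degree)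
  then have "(algebraic over E) x"
    by (rule algebraicI) (use p in \<open>simp_all add: ev\<close>)
  then show "\<not> ring.transcendental type_ring E x" by (simp add: over_def)
qed (rule algebraic_over_if_not_transcendental[OF E])

lemma field_set_algebraic_elements:
  fixes E :: "'a::field set"
  assumes E: "field_set E"
  shows "field_set {x. algebraic_over E x}"
proof -
  interpret field "type_ring :: 'a ring" by (rule field_type_ring)
  have "subfield {x \<in> carrier type_ring. (algebraic over E) x} (type_ring :: 'a ring)"
    by (rule subfield_of_algebraics) (simp add: subfield_iff_field_set E)
  then show ?thesis by (simp add: subfield_iff_field_set over_def not_transcendental_iff[OF E])
qed

lemma algebraic_over_self:
  assumes "ring_set E" "x \<in> E"
  shows "algebraic_over E x"
  unfolding algebraic_over_def
  using assms ring_setD[OF assms(1)] poly_over_closed(8,9)[OF assms(1)]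
  by (intro bexI[of _ "[:- x, 1:]"]) auto

abbreviation adj :: "'a::field set \<Rightarrow> 'a \<Rightarrow> 'a set" where
  "adj F x \<equiv> generate_field type_ring (insert x F)"

lemma adj:
  assumes F: "field_set F" and x: "algebraic_over F x"
  shows "field_set (adj F x)" "F \<subseteq> adj F x" "x \<in> adj F x"
    "y \<in> adj F x \<Longrightarrow> algebraic_over F y" "adj F x = {poly p x | p. p \<in> poly_over F}"
proof -
  note R = field_setD(1)[OF F] and T = ring_set_adjoin[OF field_setD(1)[OF F], of x]
  show f: "field_set (adj F x)" by (rule field_set_generate)
  show s: "F \<subseteq> adj F x" "x \<in> adj F x" by (auto intro: generate_field.incl)
  have alg: "adj F x \<subseteq> {y. algebraic_over F y}"
    by (rule generate_field_subset[OF field_set_algebraic_elements[OF F]])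
       (use x algebraic_over_self[OF R] in auto)
  then show "y \<in> adj F x \<Longrightarrow> algebraic_over F y" by blast
  have sub: "{poly p x | p. p \<in> poly_over F} \<subseteq> adj F x"
    using poly_in_ring_set[OF field_setD(1)[OF f] _ s(2)] poly_over_mono[OF s(1)] by blast
  have "field_set {poly p x | p. p \<in> poly_over F}"
    by (rule field_set_if_algebraic[OF F T(1,2)]) (use sub alg in blast)
  then have "adj F x \<subseteq> {poly p x | p. p \<in> poly_over F}"
    using T(2,3) by (intro generate_field_subset) auto
  with sub show "adj F x = {poly p x | p. p \<in> poly_over F}" by blast
qed

definition prim_root :: "nat \<Rightarrow> 'a::field \<Rightarrow> bool" where
  "prim_root g z \<longleftrightarrow> g > 0 \<and> (\<forall>i. z ^ i = 1 \<longleftrightarrow> g dvd i)"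

lemma prim_rootD:
  assumes "prim_root g z"
  shows "g > 0" "z ^ i = 1 \<longleftrightarrow> g dvd i" "z ^ g = 1" "z \<noteq> 0"
proof -
  show "g > 0" and i: "\<And>i. z ^ i = 1 \<longleftrightarrow> g dvd i" using assms by (auto simp: prim_root_def)
  then show "z ^ g = 1" by simp
  with \<open>g > 0\<close> show "z \<noteq> 0" by (metis power_0_left zero_neq_one less_numeral_extra(3))
qed

lemma prim_root_mod:
  assumes "prim_root g z"
  shows "z ^ i = z ^ (i mod g)"
proof -
  have "z ^ i = z ^ (g * (i div g) + i mod g)" by simp
  also have "\<dots> = z ^ (i mod g)" by (simp only: power_add power_mult prim_rootD(3)[OF assms] power_one mult_1)
  finally show ?thesis .
qed

lemma prim_root_inj:
  assumes z: "prim_root g z"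
  shows "inj_on (\<lambda>i. z ^ i) {..<g}"
proof (rule inj_onI)
  have *: "i = j" if "i \<le> j" "j < g" "z ^ i = z ^ j" for i j
  proof -
    have "z ^ j = z ^ i * z ^ (j - i)" using that(1) by (simp add: power_add[symmetric])
    then have "z ^ (j - i) = 1" using that(3) prim_rootD(4)[OF z] by simp
    then have "g dvd j - i" using prim_rootD(2)[OF z] by blast
    then show ?thesis using that by (metis diff_is_0_eq dvd_imp_le le_antisym less_imp_diff_less linorder_not_less not_gr_zero)
  qed
  fix i j assume "i \<in> {..<g}" "j \<in> {..<g}" "z ^ i = z ^ j"
  then show "i = j" using *[of i j] *[of j i] by (cases "i \<le> j") auto
qed

lemma roots_of_unity_eq:
  fixes z :: "'a::field"
  assumes z: "prim_root g z"
  shows "{w. w ^ g = 1} = (\<lambda>i. z ^ i) ` {..<g}" "finite {w. w ^ g = (1::'a::field)}" "card {w::'a. w ^ g = 1} = g"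
proof -
  define p where "p = monom (1::'a) g - 1"
  have g: "g > 0" by (rule prim_rootD[OF z])
  have dp: "coeff p g = 1" using g by (simp add: p_def)
  then have p0: "p \<noteq> 0" by auto
  have "degree p \<le> g" unfolding p_def by (rule degree_diff_le) (auto simp: degree_monom_le)
  have S: "{w. w ^ g = 1} = {w. poly p w = 0}" by (simp add: p_def poly_monom)
  have fin: "finite {w::'a. w ^ g = 1}" unfolding S by (rule poly_roots_finite[OF p0])
  have sub: "(\<lambda>i. z ^ i) ` {..<g} \<subseteq> {w. w ^ g = 1}"
    using prim_rootD(3)[OF z] by (auto simp: power_mult[symmetric] mult.commute[of _ g]) (simp add: power_mult)
  have c: "card ((\<lambda>i. z ^ i) ` {..<g}) = g" using card_image[OF prim_root_inj[OF z]] by simp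
  have "card {w::'a. w ^ g = 1} \<le> g" using card_poly_roots_bound[OF p0] \<open>degree p \<le> g\<close> unfolding S by simp
  then show eq: "{w. w ^ g = 1} = (\<lambda>i. z ^ i) ` {..<g}"
    using card_seteq[OF fin sub] c by simp
  show "finite {w. w ^ g = (1::'a)}" by (fact fin)
  show "card {w::'a. w ^ g = 1} = g" unfolding eq by (fact c)
qed

lemma root_of_unity_power:
  assumes "prim_root g z" "w ^ g = 1"
  obtains i where "i < g" "w = z ^ i"
  using assms(2) roots_of_unity_eq(1)[OF assms(1)] by blast

lemma prim_root_power:
  assumes z: "prim_root g z" and d: "d dvd g"
  shows "prim_root (g div d) (z ^ d)"
  unfolding prim_root_def
proof (intro conjI allI)
  have g: "g > 0" by (rule prim_rootD[OF z])
  with d have d0: "d > 0" by (auto elim!: dvdE)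
  show "g div d > 0" using d g by (auto elim!: dvdE)
  fix i
  have "(z ^ d) ^ i = 1 \<longleftrightarrow> g dvd d * i" by (simp add: power_mult[symmetric] prim_rootD(2)[OF z])
  also have "\<dots> \<longleftrightarrow> g div d dvd i" using d d0 by (auto simp: dvd_def elim!: dvdE)
  finally show "(z ^ d) ^ i = 1 \<longleftrightarrow> g div d dvd i" .
qed

lemma prim_root_power_coprime:
  assumes z: "prim_root g z"
  shows "prim_root g (z ^ a) \<longleftrightarrow> coprime a g"
proof
  assume "coprime a g"
  then show "prim_root g (z ^ a)"
    using prim_rootD(1)[OF z]
    by (auto simp: prim_root_def power_mult[symmetric] prim_rootD(2)[OF z] coprime_dvd_mult_right_iff coprime_commute)
next
  assume w: "prim_root g (z ^ a)"
  show "coprime a g"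
  proof (rule coprimeI)
    fix d assume d: "d dvd a" "d dvd g"
    have g: "g > 0" by (rule prim_rootD[OF z])
    from d obtain k where k: "g = d * k" by (auto elim: dvdE)
    have "g dvd a * k" using d(1) k by (auto elim!: dvdE)
    then have "(z ^ a) ^ k = 1" by (simp add: power_mult[symmetric] prim_rootD(2)[OF z])
    then have "g dvd k" using prim_rootD(2)[OF w] by blast
    then show "is_unit d" using k g by (auto elim!: dvdE)
  qed
qed

lemma monic_eq_prod_roots:
  fixes p :: "'a::idom poly"
  assumes S: "finite S" "card S = degree p" and p: "lead_coeff p = 1" "\<And>s. s \<in> S \<Longrightarrow> poly p s = 0"
  shows "p = (\<Prod>s\<in>S. [:- s, 1:])"
proof (rule poly_eqI_degree_lead_coeff[where A = S and n = "degree p"])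
  have d: "degree (\<Prod>s\<in>S. [:- s, 1:]) = degree p"
    using S by (subst degree_prod_eq_sum_degree) auto
  have "lead_coeff (\<Prod>s\<in>S. [:- s, 1:]) = 1" by (simp add: lead_coeff_prod)
  then show "coeff p (degree p) = coeff (\<Prod>s\<in>S. [:- s, 1:]) (degree p)" using p(1) d by simp
  show "degree (\<Prod>s\<in>S. [:- s, 1:]) \<le> degree p" using d by simp
  show "poly p z = poly (\<Prod>s\<in>S. [:- s, 1:]) z" if "z \<in> S" for z
    using that S(1) p(2) by (auto simp: poly_prod intro!: prod_zero[symmetric])
qed (use S in auto)

lemma prod_roots_of_unity:
  fixes z :: "'a::field"
  assumes "prim_root g z"
  shows "(\<Prod>w\<in>{w. w ^ g = 1}. [:- w, 1:]) = monom (1::'a) g - 1"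
proof (rule monic_eq_prod_roots[symmetric])
  have g: "g > 0" by (rule prim_rootD[OF assms])
  have "degree (monom (1::'a) g - 1) \<le> g" by (rule degree_diff_le) (auto simp: degree_monom_le)
  moreover have c: "coeff (monom (1::'a) g - 1) g = 1" using g by simp
  ultimately have d: "degree (monom (1::'a) g - 1) = g" by (metis le_antisym le_degree zero_neq_one)
  then show "lead_coeff (monom (1::'a) g - 1) = 1" using c by simp
  show "card {w::'a. w ^ g = 1} = degree (monom (1::'a) g - 1)"
    using roots_of_unity_eq(3)[OF assms] d by simp
qed (use roots_of_unity_eq(2)[OF assms] in \<open>auto simp: poly_monom\<close>)

text \<open>With \<open>d = g div q\<close> the polynomial is the quotient of \<open>X^g - 1\<close> by \<open>X^d - 1\<close>. Evaluated at a generator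
  of a cyclic group of order \<open>g\<close>, it is the norm element of the subgroup of order \<open>q\<close>.\<close>

lemma prod_roots_of_unity_quotient:
  fixes z :: "'a::field"
  assumes z: "prim_root g z" and q: "q dvd g"
  shows "(\<Prod>w\<in>{w::'a. w ^ g = 1 \<and> w ^ (g div q) \<noteq> 1}. [:- w, 1:]) = (\<Sum>i<q. monom 1 (i * (g div q)))"
proof -
  define d where "d = g div q"
  have gd: "g = q * d" and d0: "d > 0" using q prim_rootD(1)[OF z] by (auto simp: d_def elim!: dvdE)
  have zd: "prim_root d (z ^ q)" unfolding d_def by (rule prim_root_power[OF z q])
  have sub: "w ^ g = 1" if "w ^ d = 1" for w :: 'a using that by (simp add: gd mult.commute[of q] power_mult)
  define S where "S = {w::'a. w ^ g = 1 \<and> w ^ d \<noteq> 1}"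
  have "monom 1 g - 1 = (\<Prod>w\<in>S \<union> {w. w ^ d = 1}. [:- w, 1:])"
    unfolding prod_roots_of_unity[OF z, symmetric] by (rule prod.cong) (auto simp: S_def sub)
  also have "\<dots> = (\<Prod>w\<in>S. [:- w, 1:]) * (monom 1 d - 1)"
    unfolding prod_roots_of_unity[OF zd, symmetric]
    by (rule prod.union_disjoint)
       (use roots_of_unity_eq(2)[OF z] roots_of_unity_eq(2)[OF zd] in \<open>auto simp: S_def\<close>)
  finally have 1: "monom 1 g - 1 = (\<Prod>w\<in>S. [:- w, 1:]) * (monom 1 d - 1)" .
  have "monom (1::'a) g - 1 = monom 1 d ^ q - 1" by (simp add: monom_power gd mult.commute)
  also have "\<dots> = (monom 1 d - 1) * (\<Sum>i<q. monom 1 d ^ i)" by (rule power_diff_1_eq)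
  also have "(\<Sum>i<q. monom 1 d ^ i) = (\<Sum>i<q. monom (1::'a) (i * d))"
    by (simp add: monom_power mult.commute)
  finally have 2: "monom 1 g - 1 = (monom 1 d - 1) * (\<Sum>i<q. monom (1::'a) (i * d))" .
  have "coeff (monom (1::'a) d - 1) d = 1" using d0 by simp
  then have n0: "monom (1::'a) d - 1 \<noteq> 0" by (metis coeff_0 zero_neq_one)
  have "(\<Prod>w\<in>S. [:- w, 1:]) * (monom 1 d - 1) = (\<Sum>i<q. monom (1::'a) (i * d)) * (monom 1 d - 1)"
    using 1 2 by (simp only: mult.commute[of "monom 1 d - 1"])
  then have "(\<Prod>w\<in>S. [:- w, 1:]) = (\<Sum>i<q. monom (1::'a) (i * d))"
    unfolding mult_right_cancel[OF n0] .
  then show ?thesis by (simp only: S_def d_def)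
qed

lemma prim_root_algebraic:
  fixes z :: "'a::field"
  assumes F: "field_set F" and z: "prim_root g z"
  shows "algebraic_over F z"
proof -
  note R = field_setD(1)[OF F]
  have "monom 1 g - 1 \<in> poly_over F"
    using poly_over_closed(2,6,7)[OF R] ring_setD(1)[OF R] by blast
  moreover have "coeff (monom 1 g - 1 :: 'a poly) g = 1" using prim_rootD(1)[OF z] by simp
  then have "monom 1 g - 1 \<noteq> (0 :: 'a poly)" by (metis coeff_0 zero_neq_one)
  ultimately show ?thesis
    unfolding algebraic_over_def using prim_rootD(3)[OF z] by (intro bexI) (auto simp: poly_monom)
qed

text \<open>The image of \<open>z\<close> is again a primitive root of unity, hence a power of \<open>z\<close> and conversely; so \<open>h\<close> maps
  \<open>adj F z\<close> onto itself.\<close>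

lemma prim_root_aut:
  assumes F: "field_set F" and z: "prim_root g z"
    and h: "ring_emb (adj F z) h" "\<And>x. x \<in> F \<Longrightarrow> h x = x"
  shows "restrict h (adj F z) \<in> carrier (gal_group (adj F z) F)" "prim_root g (h z)"
proof -
  note A = adj[OF F prim_root_algebraic[OF F z]]
  note R = field_setD(1)[OF A(1)]
  have pw: "h (z ^ i) = h z ^ i" for i by (rule ring_embD(7)[OF h(1) R A(3)])
  have inj: "inj_on h (adj F z)" by (rule ring_emb_inj[OF h(1) A(1)])
  have "h z ^ i = 1 \<longleftrightarrow> z ^ i = 1" for i
    using inj_onD[OF inj, of "z ^ i" 1] ring_setD(1,7)[OF R] A(3) ring_embD(1)[OF h(1) R] pw[of i] by auto
  then show hz: "prim_root g (h z)" using z by (simp add: prim_root_def)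
  obtain i where i: "h z = z ^ i" using root_of_unity_power[OF z prim_rootD(3)[OF hz]] by blast
  obtain j where j: "z = h z ^ j" using root_of_unity_power[OF hz prim_rootD(3)[OF z]] by blast
  have im: "field_set (h ` adj F z)" by (rule image_field_set[OF h(1) A(1)])
  have "z = h (z ^ j)" unfolding pw by (fact j)
  then have "z \<in> h ` adj F z" using ring_setD(7)[OF R A(3)] by blast
  moreover have "F \<subseteq> h ` adj F z" using h(2) A(2) by (metis image_eqI subset_eq)
  ultimately have "adj F z \<subseteq> h ` adj F z" by (intro generate_field_subset[OF im]) auto
  moreover have "field_set {x \<in> adj F z. h x \<in> adj F z}"
    unfolding field_set_def ring_set_def
    using ring_setD[OF R] ring_embD[OF h(1) R] ring_emb_inverse[OF h(1) A(1)] field_setD(2)[OF A(1)] by auto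
  then have "adj F z \<subseteq> {x \<in> adj F z. h x \<in> adj F z}"
    by (rule generate_field_subset) (use A h(2) i ring_setD(7)[OF R A(3)] in auto)
  ultimately have "h ` adj F z = adj F z" by blast
  moreover have "ring_emb (adj F z) (restrict h (adj F z))"
    using h(1) ring_setD[OF R] by (auto simp: ring_emb_def)
  ultimately show "restrict h (adj F z) \<in> carrier (gal_group (adj F z) F)"
    using inj h(2) A(2) by (auto simp: gal_group_iff[OF A(1)] bij_betw_def)
qed

text \<open>The field generated by a root of unity is Galois over \<open>F\<close>.\<close>

lemma prim_root_fixed:
  fixes z :: "'a::{alg_closed_field, field_char_0}"
  assumes F: "field_set F" and z: "prim_root g z" and y: "y \<in> adj F z"
    and fixed: "\<And>\<tau>. \<tau> \<in> carrier (gal_group (adj F z) F) \<Longrightarrow> \<tau> y = y"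
  shows "y \<in> F"
proof (rule ccontr)
  assume "y \<notin> F"
  note A = adj[OF F prim_root_algebraic[OF F z]]
  obtain h where h: "ring_emb (adj F z) h" "\<And>x. x \<in> F \<Longrightarrow> h x = x" "h y \<noteq> y"
    using ring_emb_moves[OF F A(1,2,4) y \<open>y \<notin> F\<close>] by metis
  then show False using fixed[OF prim_root_aut(1)[OF F z h(1,2)]] y by simp
qed

section \<open>Polynomials with prescribed roots among the roots of unity\<close>

text \<open>A ring, embedded by \<open>emb\<close> in a field \<open>F\<close> in which it is integrally closed, together with a primitive
  root of unity \<open>z\<close> of order \<open>g\<close>. The two instances are the integers in the rationals and the
  \<open>p\<close>-adic integers in the \<open>p\<close>-adic numbers. The arithmetic takes place in the ring \<open>B\<close> generated by
  \<open>z\<close>, the image of the evaluation \<open>ev\<close> at \<open>z\<close>.\<close>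

locale cyclotomic_base = inj_idom_hom emb
  for emb :: "'a::idom \<Rightarrow> 'l::{alg_closed_field, field_char_0}" +
  fixes F :: "'l set" and g :: nat and z :: 'l
  assumes field_F: "field_set F" and emb_F: "emb c \<in> F"
    and integrally_closed: "\<lbrakk>lead_coeff q = 1; y \<in> F; poly (map_poly emb q) y = 0\<rbrakk> \<Longrightarrow> y \<in> range emb"
    and z: "prim_root g z"
begin

sublocale pm: map_poly_inj_idom_hom emb ..

definition ev :: "'a poly \<Rightarrow> 'l" where "ev r = poly (map_poly emb r) z"

definition B :: "'l set" where "B = range ev"

abbreviation Gal :: "('l \<Rightarrow> 'l) set" where "Gal \<equiv> carrier (gal_group (adj F z) F)"

lemmas A = adj[OF field_F prim_root_algebraic[OF field_F z]]

lemma ev_simps [simp]: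
  "ev 0 = 0" "ev 1 = 1" "ev (r + s) = ev r + ev s" "ev (r * s) = ev r * ev s" "ev (- r) = - ev r"
  "ev (r - s) = ev r - ev s" "ev (r ^ n) = ev r ^ n" "ev [:c:] = emb c" "ev (monom c n) = emb c * z ^ n"
  by (simp_all add: ev_def hom_distribs poly_monom)

lemma ring_set_B: "ring_set B"
  unfolding ring_set_def B_def
proof (intro conjI ballI)
  show "1 \<in> range ev" by (rule image_eqI[of _ _ 1]) simp_all
  fix x y assume "x \<in> range ev" "y \<in> range ev"
  then obtain r s where "x = ev r" "y = ev s" by blast
  then show "x + y \<in> range ev" "x * y \<in> range ev"
    using rangeI[of ev "r + s"] rangeI[of ev "r * s"] by simp_all
next
  fix x assume "x \<in> range ev"
  then obtain r where "x = ev r" by blast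
  then show "- x \<in> range ev" using rangeI[of ev "- r"] by simp
qed

lemma emb_B: "emb c \<in> B" unfolding B_def by (rule image_eqI[of _ _ "[:c:]"]) simp_all

lemma z_B: "z ^ n \<in> B" unfolding B_def by (rule image_eqI[of _ _ "monom 1 n"]) simp_all

lemma root_B:
  assumes "w ^ g = 1"
  shows "w \<in> B"
  using root_of_unity_power[OF z assms] z_B by metis

lemma B_subset: "B \<subseteq> adj F z"
proof
  fix y assume "y \<in> B"
  then obtain r where "y = poly (map_poly emb r) z" by (auto simp: B_def ev_def)
  then show "y \<in> adj F z"
    unfolding A(5) using emb_F by (auto simp: poly_over_def coeff_map_poly)
qed

text \<open>\<open>y = r(z)\<close> is an eigenvalue of the matrix of multiplication by \<open>r\<close> in the basis of the powers of \<open>X\<close>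
  modulo \<open>X^g - 1\<close>, with eigenvector \<open>(1, z, z^2, \<dots>)\<close>; the characteristic polynomial of this matrix
  is monic with coefficients in the base ring.\<close>

lemma B_integral:
  assumes "y \<in> B"
  obtains q where "lead_coeff q = 1" "poly (map_poly emb q) y = 0"
proof -
  obtain r where r: "y = ev r" using assms by (auto simp: B_def)
  define a where "a i j = (\<Sum>k\<in>{k. k \<le> degree r \<and> (k + i) mod g = j}. coeff r k)" for i j
  \<comment> \<open>row \<open>i\<close> holds the coefficients of \<open>X ^ i * r\<close> modulo \<open>X ^ g - 1\<close>\<close>
  define M where "M = mat g g (\<lambda>(i, j). a i j)"
  define v where "v = vec g (\<lambda>j. z ^ j)"
  have g: "g > 0" by (rule prim_rootD[OF z])
  have M: "M \<in> carrier_mat g g" by (simp add: M_def)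
  have row: "(\<Sum>j<g. emb (a i j) * z ^ j) = y * z ^ i" for i
  proof -
    have "y * z ^ i = (\<Sum>k\<le>degree r. emb (coeff r k) * z ^ (k + i))"
      unfolding r ev_def poly_altdef by (simp add: sum_distrib_right power_add mult.assoc)
    also have "\<dots> = (\<Sum>k\<le>degree r. emb (coeff r k) * z ^ ((k + i) mod g))"
      by (intro sum.cong refl arg_cong2[where f = "(*)"] prim_root_mod[OF z])
    also have "\<dots> = (\<Sum>j<g. \<Sum>k\<in>{k. k \<in> {..degree r} \<and> (k + i) mod g = j}. emb (coeff r k) * z ^ ((k + i) mod g))"
      using g by (intro sum.group[symmetric]) auto
    also have "\<dots> = (\<Sum>j<g. emb (a i j) * z ^ j)"
      by (intro sum.cong refl) (simp add: a_def hom_sum sum_distrib_right)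
    finally show ?thesis by simp
  qed
  have "map_mat emb M *\<^sub>v v = y \<cdot>\<^sub>v v"
  proof (rule eq_vecI)
    fix i assume "i < dim_vec (y \<cdot>\<^sub>v v)"
    then have i: "i < g" by (simp add: v_def)
    have "(map_mat emb M *\<^sub>v v) $ i = (\<Sum>j\<in>{0..<g}. row (map_mat emb M) i $ j * v $ j)"
      using i by (simp add: M_def v_def scalar_prod_def)
    also have "\<dots> = (\<Sum>j\<in>{0..<g}. emb (a i j) * z ^ j)"
      using i by (intro sum.cong refl) (simp add: M_def v_def)
    finally show "(map_mat emb M *\<^sub>v v) $ i = (y \<cdot>\<^sub>v v) $ i"
      using i row[of i] by (simp add: v_def lessThan_atLeast0)
  qed (simp add: M_def v_def)
  moreover have "v \<noteq> 0\<^sub>v g"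
  proof
    assume "v = 0\<^sub>v g"
    then have "v $ 0 = 0" using g by simp
    then show False using g by (simp add: v_def)
  qed
  ultimately have "eigenvalue (map_mat emb M) y"
    unfolding eigenvalue_def eigenvector_def using M by (intro exI[of _ v]) (auto simp: v_def)
  then have "poly (map_poly emb (char_poly M)) y = 0"
    using M by (subst (asm) eigenvalue_root_char_poly[of _ g]) (auto simp: char_poly_hom[OF M])
  then show ?thesis using that degree_monic_char_poly[OF M] by auto
qed

lemma B_Int_F: "y \<in> B \<Longrightarrow> y \<in> F \<Longrightarrow> y \<in> range emb"
  using B_integral integrally_closed by metis

lemma Gal_root:
  assumes "\<tau> \<in> Gal"
  shows "prim_root g (\<tau> z)" "\<tau> (z ^ i) = \<tau> z ^ i" "y \<in> B \<Longrightarrow> \<tau> y \<in> B"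
    "w ^ g = 1 \<Longrightarrow> \<tau> w ^ g = 1" "inj_on \<tau> B"
    "w ^ g = 1 \<Longrightarrow> \<tau> (poly (map_poly emb r) w) = poly (map_poly emb r) (\<tau> w)"
proof -
  note D = gal_groupD[OF A(1) assms]
  note R = field_setD(1)[OF A(1)]
  show p: "prim_root g (\<tau> z)" by (rule prim_root_aut(2)[OF field_F z D(3,4)])
  show pw: "\<tau> (z ^ i) = \<tau> z ^ i" by (rule ring_embD(7)[OF D(3) R A(3)])
  show root: "\<tau> w ^ g = 1" if "w ^ g = 1" for w
    using ring_embD(1,7)[OF D(3) R] B_subset root_B[OF that] that by (metis subsetD)
  have pt: "\<tau> (poly (map_poly emb r) w) = poly (map_poly emb r) (\<tau> w)" if "w \<in> adj F z" for r w
  proof -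
    have "map_poly emb r \<in> poly_over (adj F z)"
      using emb_F A(2) by (auto simp: poly_over_def coeff_map_poly)
    moreover have "map_poly \<tau> (map_poly emb r) = map_poly emb r"
      by (intro poly_eqI) (simp add: ring_emb_map_poly(1)[OF D(3) R] coeff_map_poly D(4) emb_F)
    ultimately show ?thesis using ring_emb_map_poly(4)[OF D(3) R] that by metis
  qed
  then show "w ^ g = 1 \<Longrightarrow> \<tau> (poly (map_poly emb r) w) = poly (map_poly emb r) (\<tau> w)"
    using root_B B_subset by blast
  show "\<tau> y \<in> B" if "y \<in> B"
  proof -
    obtain r where "y = poly (map_poly emb r) z" using \<open>y \<in> B\<close> by (auto simp: B_def ev_def)
    then have "\<tau> y = poly (map_poly emb r) (\<tau> z)" using pt[OF A(3)] by simp
    moreover have "map_poly emb r \<in> poly_over B" using emb_B by (auto simp: poly_over_def coeff_map_poly)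
    ultimately show ?thesis
      using poly_in_ring_set[OF ring_set_B] root_B[OF prim_rootD(3)[OF p]] by simp
  qed
  show "inj_on \<tau> B" using inj_on_subset[OF ring_emb_inj[OF D(3) A(1)] B_subset] .
qed

lemma B_fixed:
  assumes "y \<in> B" "\<And>\<tau>. \<tau> \<in> Gal \<Longrightarrow> \<tau> y = y"
  shows "y \<in> range emb"
proof -
  have "y \<in> F" using prim_root_fixed[OF field_F z, of y] B_subset assms by blast
  then show ?thesis by (rule B_Int_F[OF assms(1)])
qed

definition stable :: "'l set \<Rightarrow> bool" where
  "stable S \<longleftrightarrow> S \<subseteq> {w. w ^ g = 1} \<and> (\<forall>\<tau>\<in>Gal. \<tau> ` S \<subseteq> S)"

lemma stableD:
  assumes "stable S"
  shows "finite S" "w \<in> S \<Longrightarrow> w ^ g = 1" "w \<in> S \<Longrightarrow> w \<in> B" "\<tau> \<in> Gal \<Longrightarrow> \<tau> ` S = S"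
    "\<tau> \<in> Gal \<Longrightarrow> inj_on \<tau> S"
proof -
  have S: "S \<subseteq> {w. w ^ g = 1}" "\<And>\<tau>. \<tau> \<in> Gal \<Longrightarrow> \<tau> ` S \<subseteq> S" using assms by (auto simp: stable_def)
  show fin: "finite S" using finite_subset[OF S(1) roots_of_unity_eq(2)[OF z]] .
  show "w \<in> S \<Longrightarrow> w ^ g = 1" and "w \<in> S \<Longrightarrow> w \<in> B" using S root_B by auto
  show inj: "inj_on \<tau> S" if "\<tau> \<in> Gal"
    by (rule inj_on_subset[OF Gal_root(5)[OF that]]) (use S root_B in auto)
  show "\<tau> ` S = S" if "\<tau> \<in> Gal" by (rule endo_inj_surj[OF fin S(2)[OF that] inj[OF that]])
qed

lemma stable_ops:
  assumes "stable S" "stable S'"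
  shows "stable (S \<inter> S')" "stable (S - S')"
proof -
  show "stable (S \<inter> S')" using assms unfolding stable_def by blast+
  show "stable (S - S')"
    unfolding stable_def
  proof (intro conjI ballI)
    show "S - S' \<subseteq> {w. w ^ g = 1}" using assms(1) by (auto simp: stable_def)
    fix \<tau> assume t: "\<tau> \<in> Gal"
    have U: "stable (S \<union> S')" using assms unfolding stable_def by blast
    show "\<tau> ` (S - S') \<subseteq> S - S'"
    proof
      fix y assume "y \<in> \<tau> ` (S - S')"
      then obtain x where x: "x \<in> S" "x \<notin> S'" "y = \<tau> x" by blast
      have "y \<notin> S'"
      proof
        assume "y \<in> S'"
        then obtain x' where x': "x' \<in> S'" "\<tau> x' = \<tau> x" using stableD(4)[OF assms(2) t] x(3) by (metis imageE)
        then have "x' = x" using inj_onD[OF stableD(5)[OF U t] x'(2)] x(1) by blast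
        then show False using x x' by simp
      qed
      then show "y \<in> S - S'" using stableD(4)[OF assms(1) t] x by blast
    qed
  qed
qed

text \<open>The coefficients of the product are fixed by the Galois group, so they lie in \<open>F\<close>, and they are
  integral over the base ring.\<close>

lemma prod_over_stable:
  assumes S: "stable S"
  obtains N where "map_poly emb N = (\<Prod>w\<in>S. [:- poly (map_poly emb r) w, 1:])"
proof -
  define P where "P = (\<Prod>w\<in>S. [:- poly (map_poly emb r) w, 1:])"
  have inB: "poly (map_poly emb r) w \<in> B" if "w \<in> S" for w
    by (rule poly_in_ring_set[OF ring_set_B _ stableD(3)[OF S that]])
       (use emb_B in \<open>auto simp: poly_over_def coeff_map_poly\<close>)
  have "ring_emb B (\<lambda>x. x)" by (simp add: ring_emb_def)
  from ring_emb_prod_linear(1)[OF this ring_set_B inB] have PB: "P \<in> poly_over B" by (simp add: P_def)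
  have range: "coeff P i \<in> range emb" for i
  proof (rule B_fixed[OF poly_overD[OF PB]])
    fix \<tau> assume t: "\<tau> \<in> Gal"
    note D = gal_groupD(3)[OF A(1) t] and R = field_setD(1)[OF A(1)]
    have "map_poly \<tau> P = (\<Prod>w\<in>S. [:- \<tau> (poly (map_poly emb r) w), 1:])"
      unfolding P_def by (rule ring_emb_prod_linear(2)[OF D R]) (use inB B_subset in blast)
    also have "\<dots> = (\<Prod>w\<in>S. [:- poly (map_poly emb r) (\<tau> w), 1:])"
      by (intro prod.cong refl) (use Gal_root(6)[OF t stableD(2)[OF S]] in auto)
    also have "\<dots> = (\<Prod>w\<in>\<tau> ` S. [:- poly (map_poly emb r) w, 1:])"
      using prod.reindex[OF stableD(5)[OF S t], of "\<lambda>w. [:- poly (map_poly emb r) w, 1:]"] by (simp add: o_def)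
    also have "\<dots> = P" unfolding stableD(4)[OF S t] P_def ..
    finally show "\<tau> (coeff P i) = coeff P i" using ring_emb_map_poly(1)[OF D R] by metis
  qed
  define c where "c = inv_into UNIV emb"
  have c: "emb (c (coeff P i)) = coeff P i" for i unfolding c_def by (rule f_inv_into_f[OF range])
  have "c 0 = 0" unfolding c_def using Hilbert_Choice.inv_f_f[OF inj_f, of 0] by simp
  then have "map_poly emb (map_poly c P) = P" by (intro poly_eqI) (simp add: coeff_map_poly c)
  then show ?thesis using that by (simp add: P_def)
qed

definition Bunit :: "'l \<Rightarrow> bool" where "Bunit y \<longleftrightarrow> y \<in> B \<and> (\<exists>b\<in>B. y * b = 1)"

lemma Bunit_mult:
  assumes "Bunit x" "Bunit y"
  shows "Bunit (x * y)"
proof -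
  obtain a b where "a \<in> B" "b \<in> B" "x * a = 1" "y * b = 1" using assms by (auto simp: Bunit_def)
  moreover from this have "x * y * (a * b) = 1" by (simp add: algebra_simps)
  ultimately show ?thesis
    using assms ring_setD(4)[OF ring_set_B] unfolding Bunit_def by blast
qed

lemma Bunit_minus:
  assumes "Bunit x"
  shows "Bunit (- x)"
proof -
  obtain a where a: "a \<in> B" "x * a = 1" using assms by (auto simp: Bunit_def)
  then have "- x * (- a) = 1" by simp
  then show ?thesis
    using assms a(1) ring_setD(5)[OF ring_set_B] unfolding Bunit_def by blast
qed

lemma Bunit_prod: "(\<And>x. x \<in> X' \<Longrightarrow> Bunit (f x)) \<Longrightarrow> Bunit (prod f X')"
proof (induction X' rule: infinite_finite_induct)
  case (insert x F)
  then show ?case by (simp add: Bunit_mult)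
qed (use ring_setD(1)[OF ring_set_B] in \<open>auto simp: Bunit_def\<close>)

lemma Bunit_factor:
  assumes "Bunit (x * y)" "x \<in> B" "y \<in> B"
  shows "Bunit x"
proof -
  obtain a where a: "a \<in> B" "x * y * a = 1" using assms by (auto simp: Bunit_def)
  then have "x * (y * a) = 1" by (simp add: mult.assoc)
  then show ?thesis
    using assms a(1) ring_setD(4)[OF ring_set_B] unfolding Bunit_def by blast
qed

text \<open>If \<open>emb u\<close> is invertible in \<open>B\<close>, then its inverse is integral over the base ring and lies in \<open>F\<close>.\<close>

lemma Bunit_emb: "Bunit (emb u) \<longleftrightarrow> u dvd 1"
proof
  assume "Bunit (emb u)"
  then obtain b where b: "b \<in> B" "emb u * b = 1" by (auto simp: Bunit_def)
  then have "b = inverse (emb u)" by (metis inverse_unique)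
  then have "b \<in> F" using field_setD(2)[OF field_F emb_F] by simp
  then obtain v where "b = emb v" using B_Int_F[OF b(1)] by blast
  then have "emb (u * v) = emb 1" using b(2) by (simp add: hom_distribs)
  then have "u * v = 1" by (simp only: eq_iff)
  then show "u dvd 1" by (metis dvd_triv_left)
next
  assume "u dvd 1"
  then obtain v where "1 = u * v" by (elim dvdE)
  then have "emb u * emb v = 1" using hom_mult[of u v] by simp
  then show "Bunit (emb u)" using emb_B by (auto simp: Bunit_def)
qed

text \<open>Let \<open>P\<close> be the monic polynomial with the roots \<open>S1\<close> and \<open>N\<close> the one with the roots \<open>P(b)\<close> for \<open>b\<close> in
  \<open>S2\<close>. Both have coefficients in the base ring by stability. Up to sign, \<open>N(0)\<close> is the product of all
  \<open>b - a\<close>, hence a unit of the base ring. So \<open>1 - N(P(X)) / N(0)\<close> is a polynomial over the base ring,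
  with value \<open>0\<close> on \<open>S1\<close>, where \<open>P\<close> vanishes, and value \<open>1\<close> on \<open>S2\<close>, where \<open>N(P(X))\<close> vanishes.\<close>

lemma separating_polynomial:
  assumes S1: "stable S1" and S2: "stable S2"
    and units: "\<And>a b. a \<in> S1 \<Longrightarrow> b \<in> S2 \<Longrightarrow> Bunit (b - a)"
  obtains e where "\<And>a. a \<in> S1 \<Longrightarrow> poly (map_poly emb e) a = 0" "\<And>b. b \<in> S2 \<Longrightarrow> poly (map_poly emb e) b = 1"
proof -
  obtain P where P: "map_poly emb P = (\<Prod>w\<in>S1. [:- poly (map_poly emb [:0, 1:]) w, 1:])"
    by (rule prod_over_stable[OF S1])
  then have P: "map_poly emb P = (\<Prod>w\<in>S1. [:- w, 1:])" by (simp add: hom_distribs)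
  obtain N where N: "map_poly emb N = (\<Prod>w\<in>S2. [:- poly (map_poly emb P) w, 1:])"
    by (rule prod_over_stable[OF S2])
  have "emb (poly N 0) = poly (map_poly emb N) (emb 0)" by (rule poly_map_poly[symmetric])
  also have "\<dots> = (\<Prod>b\<in>S2. - (\<Prod>a\<in>S1. b - a))" unfolding N P by (simp add: poly_prod)
  also have "Bunit \<dots>" by (intro Bunit_prod Bunit_minus units)
  finally obtain u where u: "poly N 0 * u = 1" unfolding Bunit_emb by (auto elim!: dvdE)
  define e where "e = 1 - [:u:] * pcompose N P"
  have e: "poly (map_poly emb e) w = 1 - emb u * poly (map_poly emb N) (poly (map_poly emb P) w)" for w
    unfolding e_def by (simp add: hom_distribs map_poly_pcompose poly_pcompose)
  show ?thesis
  proof (rule that[of e])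
    fix a assume a: "a \<in> S1"
    have "poly (map_poly emb P) a = 0" unfolding P using a stableD(1)[OF S1] by (auto simp: poly_prod)
    then have "poly (map_poly emb e) a = 1 - emb u * emb (poly N 0)"
      unfolding e using poly_map_poly[of N 0] by simp
    also have "emb u * emb (poly N 0) = emb 1" using u by (metis hom_mult mult.commute)
    finally show "poly (map_poly emb e) a = 0" by simp
  next
    fix b assume b: "b \<in> S2"
    have "poly (map_poly emb N) (poly (map_poly emb P) b) = 0"
      unfolding N using b stableD(1)[OF S2] by (auto simp: poly_prod intro!: bexI[of _ b])
    then show "poly (map_poly emb e) b = 1" unfolding e by simp
  qed
qed

end

section \<open>Frobenius congruences\<close>

lemma prime_dvd_power_add:
  fixes x y :: "'a::comm_ring_1"
  assumes q: "Factorial_Ring.prime (q::nat)"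
  shows "of_nat q dvd (x + y) ^ q - (x ^ q + y ^ q)"
proof -
  have q0: "q > 0" using q by (rule prime_gt_0_nat)
  have "(x + y) ^ q = (\<Sum>k\<in>{..q}. of_nat (q choose k) * x ^ k * y ^ (q - k))"
    by (rule binomial_ring)
  also have "{..q} = insert 0 (insert q {1..<q})" using q0 by auto
  also have "(\<Sum>k\<in>insert 0 (insert q {1..<q}). of_nat (q choose k) * x ^ k * y ^ (q - k)) =
      y ^ q + (x ^ q + (\<Sum>k\<in>{1..<q}. of_nat (q choose k) * x ^ k * y ^ (q - k)))"
    using q0 by simp
  finally have "(x + y) ^ q - (x ^ q + y ^ q) = (\<Sum>k\<in>{1..<q}. of_nat (q choose k) * x ^ k * y ^ (q - k))"
    by simp
  also have "of_nat q dvd \<dots>"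
  proof (rule dvd_sum)
    fix k assume "k \<in> {1..<q}"
    then have "q dvd (q choose k)" using q by (intro dvd_choose_prime) auto
    then have "(of_nat q :: 'a) dvd of_nat (q choose k)" by (auto elim!: dvdE)
    then show "of_nat q dvd of_nat (q choose k) * x ^ k * y ^ (q - k)" by (simp add: mult.assoc)
  qed
  finally show ?thesis .
qed

lemma prime_dvd_of_nat_power_diff:
  assumes q: "Factorial_Ring.prime (q::nat)"
  shows "(of_nat q :: 'a::comm_ring_1) dvd of_nat c ^ q - of_nat c"
proof (induction c)
  case 0
  then show ?case using prime_gt_0_nat[OF q] by (simp add: power_0_left)
next
  case (Suc c)
  have "(of_nat (Suc c) :: 'a) ^ q - of_nat (Suc c) =
      ((of_nat c + 1) ^ q - (of_nat c ^ q + 1 ^ q)) + (of_nat c ^ q - of_nat c)"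
    by (simp add: algebra_simps)
  then show ?case using prime_dvd_power_add[OF q, of "of_nat c" "1::'a"] Suc by (metis dvd_add)
qed

text \<open>Raising to the \<open>q\<close>-th power is additive modulo \<open>q\<close> and fixes the coefficients, so it acts on
  polynomials modulo \<open>q\<close> by substituting \<open>X^q\<close> for \<open>X\<close>.\<close>

lemma prime_dvd_pcompose_power:
  fixes r :: "'a::idom poly"
  assumes q: "Factorial_Ring.prime (q::nat)" and c: "\<And>c::'a. of_nat q dvd c ^ q - c"
  shows "of_nat q dvd pcompose r (monom 1 q) - r ^ q"
proof (induction r)
  case 0
  then show ?case using prime_gt_0_nat[OF q] by (simp add: power_0_left)
next
  case (pCons a r)
  define t :: "'a poly" where "t = [:0, 1:]"
  have tq: "t ^ q = monom 1 q" by (simp add: monom_altdef t_def)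
  have split: "pCons a r = [:a:] + t * r" by (simp add: t_def)
  have eq: "pcompose ([:a:] + t * r) (monom 1 q) - ([:a:] + t * r) ^ q =
      - (([:a:] + t * r) ^ q - ([:a:] ^ q + (t * r) ^ q)) - ([:a:] ^ q - [:a:])
      + monom 1 q * (pcompose r (monom 1 q) - r ^ q)"
  proof -
    have "(u + m * c) - s = - (s - (v + m * w)) - (v - u) + m * (c - w)" for u m c s v w :: "'a poly"
      by (simp add: algebra_simps)
    moreover have "pcompose ([:a:] + t * r) (monom 1 q) = [:a:] + monom 1 q * pcompose r (monom 1 q)"
      unfolding split[symmetric] by (rule pcompose_pCons)
    ultimately show ?thesis unfolding power_mult_distrib tq by presburger
  qed
  have d1: "of_nat q dvd [:a:] ^ q - [:a:]"
  proof -
    have "[:a:] ^ q - [:a:] = [:a ^ q - a:]" by (simp add: poly_const_pow)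
    then show ?thesis using c[of a] by (simp add: of_nat_poly)
  qed
  have "d dvd - x - y + m * w" if "d dvd x" "d dvd y" "d dvd w" for d x y m w :: "'a poly"
    using that by (intro dvd_add dvd_diff dvd_mult) (simp_all only: dvd_minus_iff)
  then show ?case
    unfolding split eq using prime_dvd_power_add[OF q, of "[:a:]" "t * r"] d1 pCons.IH by blast
qed

context cyclotomic_base
begin

lemma of_nat_B: "of_nat n \<in> B"
proof -
  have "emb (of_nat n) = of_nat n" by (induction n) (simp_all add: hom_distribs)
  then show ?thesis using emb_B[of "of_nat n"] by simp
qed

lemma poly_B: "w ^ g = 1 \<Longrightarrow> poly (map_poly emb r) w \<in> B"
  by (rule poly_in_ring_set[OF ring_set_B _ root_B]) (use emb_B in \<open>auto simp: poly_over_def coeff_map_poly\<close>)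

lemma frobenius_power:
  assumes q: "Factorial_Ring.prime (q::nat)" and c: "\<And>c::'a. of_nat q dvd c ^ q - c" and w: "w ^ g = 1"
  shows "\<exists>h\<in>B. poly (map_poly emb r) w ^ (q ^ j) = poly (map_poly emb r) (w ^ (q ^ j)) + of_nat q * h"
proof (induction j)
  case 0
  then show ?case using ring_setD(2)[OF ring_set_B] by (intro bexI[of _ 0]) auto
next
  case (Suc j)
  then obtain h where h: "h \<in> B"
    "poly (map_poly emb r) w ^ (q ^ j) = poly (map_poly emb r) (w ^ (q ^ j)) + of_nat q * h" by blast
  define v where "v = w ^ (q ^ j)"
  have v: "v ^ g = 1" using w by (simp add: v_def power_mult[symmetric] mult.commute[of _ g]) (simp add: power_mult)
  define a where "a = poly (map_poly emb r) v"
  have aB: "a \<in> B" unfolding a_def by (rule poly_B[OF v])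
  note R = ring_setD[OF ring_set_B]
  have hB: "of_nat q * h \<in> B" using R(4)[OF of_nat_B h(1)] .
  define t where "t = (\<Sum>i<q. a ^ (q - Suc i) * (a + of_nat q * h) ^ i)"
  have tB: "t \<in> B" unfolding t_def
    by (intro ring_set_sum[OF ring_set_B] R(4) R(7) R(3) aB hB)
  have 1: "(a + of_nat q * h) ^ q = a ^ q + of_nat q * (h * t)"
    using power_diff_sumr2[of "a + of_nat q * h" q a] by (simp add: t_def algebra_simps)
  obtain k where k: "pcompose r (monom 1 q) - r ^ q = of_nat q * k"
    using prime_dvd_pcompose_power[OF q c, of r] by (elim dvdE) auto
  have "poly (map_poly emb (pcompose r (monom 1 q) - r ^ q)) v = poly (map_poly emb (of_nat q * k)) v"
    unfolding k ..
  then have e: "poly (map_poly emb r) (v ^ q) - a ^ q = of_nat q * poly (map_poly emb k) v"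
    by (simp add: hom_distribs map_poly_pcompose poly_pcompose poly_monom a_def)
  have "a ^ q = poly (map_poly emb r) (v ^ q) - (poly (map_poly emb r) (v ^ q) - a ^ q)" by simp
  then have 2: "a ^ q = poly (map_poly emb r) (v ^ q) - of_nat q * poly (map_poly emb k) v"
    unfolding e .
  have "poly (map_poly emb r) w ^ (q ^ Suc j) = (a + of_nat q * h) ^ q"
  proof -
    have "x ^ (q ^ Suc j) = (x ^ (q ^ j)) ^ q" for x :: 'l
      by (simp add: power_mult[symmetric] mult.commute)
    then show ?thesis by (simp only: h(2) a_def v_def)
  qed
  also have "\<dots> = poly (map_poly emb r) (v ^ q) + of_nat q * (h * t - poly (map_poly emb k) v)"
    unfolding 1 2 by (simp add: algebra_simps)
  also have "v ^ q = w ^ (q ^ Suc j)" by (simp add: v_def power_mult[symmetric] mult.commute)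
  finally show ?case using R(6)[OF R(4)[OF h(1) tB] poly_B[OF v, of k]] by blast
qed

text \<open>Let \<open>c = a^k / b^k\<close>, a root of unity of order dividing \<open>m = g div k\<close>. As \<open>c \<noteq> 1\<close>, the sum of its powers
  \<open>c^i\<close> for \<open>i < m\<close> vanishes, so \<open>m\<close> is the sum of the \<open>1 - c^i\<close>, all divisible by \<open>1 - c\<close>. Finally
  \<open>b - a\<close> divides \<open>b^k - a^k = b^k (1 - c)\<close>.\<close>

lemma root_difference_dvd:
  assumes a: "a ^ g = 1" "b ^ g = 1" and k: "k dvd g" "a ^ k \<noteq> b ^ k"
  shows "\<exists>c\<in>B. (b - a) * c = of_nat (g div k)"
proof -
  note R = ring_setD[OF ring_set_B]
  have g: "g > 0" by (rule prim_rootD[OF z])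
  define m where "m = g div k"
  have gk: "g = k * m" using k(1) by (simp add: m_def)
  \<comment> \<open>the inverse of \<open>b ^ k\<close>\<close>
  define u where "u = b ^ ((g - 1) * k)"
  have bu: "b ^ k * u = 1"
  proof -
    have "b ^ k * u = b ^ (k + (g - 1) * k)" by (simp add: u_def power_add)
    also have "k + (g - 1) * k = g * k" using g by (cases g) auto
    also have "b ^ (g * k) = 1" using a(2) by (simp add: power_mult)
    finally show ?thesis .
  qed
  define c where "c = a ^ k * u"
  have cm: "c ^ m = 1"
  proof -
    have "c ^ m = (a ^ g) * (b ^ g) ^ ((g - 1))"
      by (simp add: c_def u_def gk power_mult_distrib power_mult[symmetric] algebra_simps)
    then show ?thesis using a by simp
  qed
  have c1: "c \<noteq> 1" using k(2) bu by (metis c_def mult.commute mult_cancel_left mult_zero_left zero_neq_one)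
  define t where "t = (\<Sum>i<m. \<Sum>j<i. c ^ j)"
  have "(\<Sum>i<m. c ^ i) = 0"
    using power_diff_1_eq[of c m] cm c1 by simp
  moreover have "(\<Sum>i<m. c ^ i - 1) = (\<Sum>i<m. (c - 1) * (\<Sum>j<i. c ^ j))"
    by (intro sum.cong refl power_diff_1_eq)
  then have "(\<Sum>i<m. c ^ i - 1) = (c - 1) * t"
    by (simp only: t_def sum_distrib_left[of "c - 1" "\<lambda>i. \<Sum>j<i. c ^ j" "{..<m}"])
  ultimately have ct: "(1 - c) * t = of_nat m" by (simp add: sum_subtractf algebra_simps)
  define s where "s = (\<Sum>i<k. a ^ (k - Suc i) * b ^ i)"
  have "(b - a) * s = b ^ k - a ^ k" unfolding s_def by (rule power_diff_sumr2[symmetric])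
  then have "(b - a) * (s * (u * t)) = (b ^ k * u - a ^ k * u) * t" by (metis (no_types) left_diff_distrib mult.assoc)
  also have "\<dots> = of_nat m" unfolding bu c_def[symmetric] by (rule ct)
  finally have "(b - a) * (s * (u * t)) = of_nat m" .
  moreover have "s * (u * t) \<in> B"
    unfolding s_def u_def t_def c_def
    by (intro R(4) ring_set_sum[OF ring_set_B] R(7) root_B a)
  ultimately show ?thesis by (auto simp: m_def)
qed

end

section \<open>All primitive roots of unity are conjugate over the rationals\<close>

lemma cyclotomic_base_int:
  fixes z :: "'l::{alg_closed_field, field_char_0}"
  assumes "prim_root g z"
  shows "cyclotomic_base (of_int :: int \<Rightarrow> 'l) \<rat> g z"
proof -
  interpret inj_idom_hom "of_int :: int \<Rightarrow> 'l"
    by unfold_locales auto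
  show ?thesis
  proof unfold_locales
    fix q :: "int poly" and y :: 'l
    assume "lead_coeff q = 1" "y \<in> \<rat>" "poly (map_poly of_int q) y = 0"
    then have "y \<in> \<int>" by (intro rational_algebraic_int_is_int) (auto simp: algebraic_int_altdef_ipoly)
    then show "y \<in> range of_int" by (auto elim: Ints_cases)
  qed (use assms field_set_Rats in auto)
qed

text \<open>Let \<open>P\<close> be the integral polynomial whose roots are the conjugates of \<open>z\<close>. Modulo \<open>q\<close>, the value
  \<open>P(z^q)\<close> is \<open>P(z)^q = 0\<close>. If \<open>z^q\<close> were not a conjugate of \<open>z\<close>, then \<open>P(z^q)\<close> would be a product of
  differences of distinct \<open>g\<close>-th roots of unity, hence a divisor of a power of \<open>g\<close>, and the prime \<open>q\<close>
  would divide \<open>g\<close>.\<close>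

lemma conjugate_prime_power:
  fixes z :: "'l::{alg_closed_field, field_char_0}"
  assumes z: "prim_root g z" and q: "Factorial_Ring.prime (q::nat)" "coprime q g"
  shows "\<exists>\<tau>\<in>carrier (gal_group (adj \<rat> z) \<rat>). \<tau> z = z ^ q"
proof -
  interpret cyclotomic_base "of_int :: int \<Rightarrow> 'l" \<rat> g z by (rule cyclotomic_base_int[OF z])
  note R = ring_setD[OF ring_set_B]
  have sub: "\<rat> \<subseteq> adj \<rat> z" by (rule A(2))
  interpret G: group "gal_group (adj \<rat> z) \<rat>" by (rule group_gal_group[OF A(1) sub])
  define S where "S = (\<lambda>\<tau>. \<tau> z) ` Gal"
  have S: "stable S"
    unfolding stable_def
  proof (intro conjI ballI)
    show "S \<subseteq> {w. w ^ g = 1}" using Gal_root(1) prim_rootD(3) by (auto simp: S_def)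
    fix \<tau> assume t: "\<tau> \<in> Gal"
    show "\<tau> ` S \<subseteq> S"
    proof
      fix y assume "y \<in> \<tau> ` S"
      then obtain \<rho> where r: "\<rho> \<in> Gal" "y = \<tau> (\<rho> z)" by (auto simp: S_def)
      then have "y = (\<tau> \<otimes>\<^bsub>gal_group (adj \<rat> z) \<rat>\<^esub> \<rho>) z"
        using gal_group_apply(1)[OF A(1) sub t A(3) r(1)] by simp
      then show "y \<in> S" using G.m_closed[OF t r(1)] by (auto simp: S_def)
    qed
  qed
  have zS: "z \<in> S"
    unfolding S_def using gal_group_apply(4)[OF A(1) sub G.one_closed A(3)]
    by (intro image_eqI[OF _ G.one_closed]) simp
  have "z ^ q \<in> S"
  proof (rule ccontr)
    assume n: "z ^ q \<notin> S"
    obtain P where "map_poly of_int P = (\<Prod>w\<in>S. [:- poly (map_poly of_int [:0, 1:]) w, 1:])"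
      by (rule prod_over_stable[OF S])
    then have P: "map_poly of_int P = (\<Prod>w\<in>S. [:- w, 1:])" by (simp add: hom_distribs)
    have c: "of_nat q dvd c ^ q - c" for c :: int
    proof -
      have "c = of_nat (nat (c mod int q)) + int q * (c div int q)" using q(1) prime_gt_0_nat by simp
      moreover have "int q dvd (a + int q * b) ^ q - (a + int q * b) \<longleftrightarrow> int q dvd a ^ q - a" for a b
      proof -
        have "[(a + int q * b) ^ q - (a + int q * b) = a ^ q - a] (mod int q)"
          by (intro cong_diff cong_pow) (auto simp: cong_def)
        then show ?thesis by (rule cong_dvd_iff)
      qed
      ultimately show ?thesis using prime_dvd_of_nat_power_diff[OF q(1), of "nat (c mod int q)", where 'a = int] by metis
    qed
    obtain k where k: "pcompose P (monom 1 q) - P ^ q = of_nat q * k"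
      using prime_dvd_pcompose_power[OF q(1) c, of P] by (elim dvdE) auto
    have "poly (map_poly of_int P) z = 0" unfolding P using zS stableD(1)[OF S] by (auto simp: poly_prod)
    moreover have "poly (map_poly of_int (pcompose P (monom 1 q) - P ^ q)) z = poly (map_poly of_int (of_nat q * k)) z"
      unfolding k ..
    ultimately have "poly (map_poly of_int P) (z ^ q) = of_nat q * poly (map_poly of_int k) z"
      using q(1) prime_gt_0_nat[of q]
      by (simp add: hom_distribs of_int_hom.map_poly_pcompose poly_pcompose poly_monom power_0_left)
    then have 1: "(\<Prod>w\<in>S. z ^ q - w) = of_nat q * poly (map_poly of_int k) z"
      unfolding P by (simp add: poly_prod)
    have "\<exists>c\<in>B. (z ^ q - w) * c = of_nat g" if "w \<in> S" for w
      using root_difference_dvd[of w "z ^ q" 1] stableD(2)[OF S that] that n prim_rootD(3)[OF z]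
      by (auto simp: power_mult[symmetric] mult.commute[of q] power_mult)
    then obtain c where c: "\<And>w. w \<in> S \<Longrightarrow> c w \<in> B" "\<And>w. w \<in> S \<Longrightarrow> (z ^ q - w) * c w = of_nat g" by metis
    define y where "y = poly (map_poly of_int k) z * (\<Prod>w\<in>S. c w)"
    have yB: "y \<in> B"
      unfolding y_def by (intro R(4) poly_B prim_rootD(3)[OF z] ring_set_prod[OF ring_set_B] c(1))
    have "of_nat q * y = (\<Prod>w\<in>S. (z ^ q - w) * c w)"
      using 1 by (simp add: y_def prod.distrib mult.assoc)
    also have "\<dots> = of_nat (g ^ card S)" using c(2) by simp
    finally have y: "of_nat q * y = of_nat (g ^ card S)" .
    then have "y = of_nat (g ^ card S) / of_nat q" using prime_gt_0_nat[OF q(1)] by (simp add: field_simps)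
    then have "y \<in> \<rat>" by simp
    then obtain m where "y = of_int m" using B_Int_F[OF yB] by blast
    then have "(of_int (int q * m) :: 'l) = of_int (int (g ^ card S))" using y by simp
    then have "int q * m = int (g ^ card S)" by (simp only: of_int_eq_iff)
    then have "int q dvd int (g ^ card S)" by (metis dvd_triv_left)
    then have "q dvd g ^ card S" by (simp only: int_dvd_int_iff)
    then have "q dvd g" using q(1) by (rule prime_dvd_power_nat[rotated])
    then show False using q by (metis coprime_absorb_left not_prime_unit)
  qed
  then show ?thesis by (auto simp: S_def)
qed

text \<open>Decomposing \<open>a\<close> into primes reduces this to prime powers of \<open>z\<close>, one prime factor at a time.\<close>

theorem cyclotomic_conjugate:
  fixes z :: "'l::{alg_closed_field, field_char_0}"
  assumes "prim_root g z" "coprime a g"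
  shows "\<exists>\<tau>\<in>carrier (gal_group (adj \<rat> z) \<rat>). \<tau> z = z ^ a"
  using assms
proof (induction a arbitrary: z rule: less_induct)
  case (less a z)
  note A = adj[OF field_set_Rats prim_root_algebraic[OF field_set_Rats less.prems(1)]]
  interpret G: group "gal_group (adj \<rat> z) \<rat>" by (rule group_gal_group[OF A(1,2)])
  have id: "\<exists>\<tau>\<in>carrier (gal_group (adj \<rat> z) \<rat>). \<tau> z = z"
    using gal_group_apply(4)[OF A(1,2) G.one_closed A(3)] G.one_closed by blast
  consider "a = 0" | "a = 1" | "a > 1" by linarith
  then show ?case
  proof cases
    case 1
    then have "g = 1" using less.prems(2) by simp
    then have "z = 1" using prim_rootD(3)[OF less.prems(1)] by simp
    then show ?thesis using id by simp
  next
    case 2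
    then show ?thesis using id by simp
  next
    case 3
    then obtain q where q: "Factorial_Ring.prime q" "q dvd a" using prime_factor_nat[of a] by auto
    then obtain m where m: "a = q * m" by (auto elim: dvdE)
    have cop: "coprime q g" "coprime m g" using less.prems(2) m by simp_all
    have "m > 0" using m 3 by (cases m) auto
    then have ma: "m < a" unfolding m using prime_gt_1_nat[OF q(1)] by (intro n_less_m_mult_n) simp_all
    obtain \<tau> where t: "\<tau> \<in> carrier (gal_group (adj \<rat> z) \<rat>)" "\<tau> z = z ^ q"
      using conjugate_prime_power[OF less.prems(1) q(1) cop(1)] by blast
    have z': "prim_root g (z ^ q)" using prim_root_power_coprime[OF less.prems(1)] cop(1) by simp
    note A' = adj[OF field_set_Rats prim_root_algebraic[OF field_set_Rats z']]
    obtain i where i: "z = (z ^ q) ^ i"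
      using root_of_unity_power[OF z' prim_rootD(3)[OF less.prems(1)]] by blast
    have "z \<in> adj \<rat> (z ^ q)" using i ring_setD(7)[OF field_setD(1)[OF A'(1)] A'(3)] by metis
    then have 1: "adj \<rat> z \<subseteq> adj \<rat> (z ^ q)" using A' by (intro generate_field_subset) auto
    have "z ^ q \<in> adj \<rat> z" by (rule ring_setD(7)[OF field_setD(1)[OF A(1)] A(3)])
    then have "adj \<rat> (z ^ q) \<subseteq> adj \<rat> z" using A by (intro generate_field_subset) auto
    with 1 have eq: "adj \<rat> (z ^ q) = adj \<rat> z" by blast
    obtain \<rho> where r: "\<rho> \<in> carrier (gal_group (adj \<rat> z) \<rat>)" "\<rho> (z ^ q) = (z ^ q) ^ m"
      using less.IH[OF ma z' cop(2)] eq by auto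
    have "(\<rho> \<otimes>\<^bsub>gal_group (adj \<rat> z) \<rat>\<^esub> \<tau>) z = z ^ a"
      using gal_group_apply(1)[OF A(1,2) r(1) A(3) t(1)] t(2) r(2) by (simp add: m power_mult)
    then show ?thesis using G.m_closed[OF r(1) t(1)] by blast
  qed
qed

section \<open>Arithmetic of the p-adic integers\<close>

lemma Rep_padic_int_mod:
  fixes x :: "'p::prime_card padic_int"
  shows "n \<le> m \<Longrightarrow> Rep_padic_int x m mod int CARD('p) ^ n = Rep_padic_int x n"
    "0 \<le> Rep_padic_int x n" "Rep_padic_int x n < int CARD('p) ^ n"
  using padic_seqs_mod[OF Rep_padic_int, of n m x] Rep_padic_int[of x]
  by (auto simp: padic_seqs_def)

lemma padic_int_eqI:
  fixes x y :: "'p::prime_card padic_int"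
  assumes "\<And>n. Rep_padic_int x n = Rep_padic_int y n"
  shows "x = y"
  using assms by (metis Rep_padic_int_inject ext)

lemma Rep_Abs_padic_int:
  assumes "\<And>n. f (Suc n) mod int CARD('p::prime_card) ^ n = f n mod int CARD('p) ^ n"
  shows "Rep_padic_int (Abs_padic_int (\<lambda>n. f n mod int CARD('p) ^ n) :: 'p padic_int) n = f n mod int CARD('p) ^ n"
  by (subst Abs_padic_int_inverse[OF padic_seqsI[OF assms]]) simp

abbreviation pp :: "'p::prime_card padic_int" where "pp \<equiv> of_nat CARD('p)"

lemma prime_CARD: "Factorial_Ring.prime (CARD('p::prime_card))"
  by (rule prime_card)

text \<open>The inverses of \<open>x\<close> modulo the powers \<open>p^n\<close> are unique, hence compatible, and define a \<open>p\<close>-adic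
  integer.\<close>

lemma padic_unit:
  fixes x :: "'p::prime_card padic_int"
  assumes "Rep_padic_int x 1 \<noteq> 0"
  shows "x dvd 1"
proof -
  define p where "p = int CARD('p)"
  have p: "Factorial_Ring.prime p" unfolding p_def by (rule prime_card_int)
  have cop: "coprime (Rep_padic_int x n) (p ^ n)" for n
  proof (cases n)
    case (Suc m)
    have "\<not> p dvd Rep_padic_int x n"
      using Rep_padic_int_mod(1)[of 1 n x] assms Suc by (auto simp: p_def dvd_eq_mod_eq_0)
    then have "coprime p (Rep_padic_int x n)" by (rule prime_imp_coprime[OF p])
    then have "coprime (Rep_padic_int x n) p" by (simp only: coprime_commute)
    then show ?thesis by simp
  qed simp
  define f where "f n = (SOME y. [Rep_padic_int x n * y = 1] (mod p ^ n))" for n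
  have f: "[Rep_padic_int x n * f n = 1] (mod p ^ n)" for n
    unfolding f_def by (rule someI_ex) (use cong_solve_coprime_int[OF cop] in blast)
  have "[f (Suc n) = f n] (mod p ^ n)" for n
  proof -
    have "[Rep_padic_int x (Suc n) * f (Suc n) = 1] (mod p ^ n)"
      by (rule cong_dvd_modulus[OF f]) (simp add: le_imp_power_dvd)
    moreover have "[Rep_padic_int x (Suc n) = Rep_padic_int x n] (mod p ^ n)"
      using Rep_padic_int_mod(1)[of n "Suc n" x] Rep_padic_int_mod(1)[of n n x] by (simp add: cong_def p_def)
    ultimately have "[Rep_padic_int x n * f (Suc n) = Rep_padic_int x n * f n] (mod p ^ n)"
      using f[of n] by (meson cong_scalar_right cong_sym cong_trans)
    then show ?thesis using cop by (simp add: cong_mult_lcancel)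
  qed
  then have f': "f (Suc n) mod int CARD('p) ^ n = f n mod int CARD('p) ^ n" for n
    by (simp add: cong_def p_def)
  define y where "y = (Abs_padic_int (\<lambda>n. f n mod int CARD('p) ^ n) :: 'p padic_int)"
  have "x * y = 1"
  proof (rule padic_int_eqI)
    fix n
    show "Rep_padic_int (x * y) n = Rep_padic_int (1 :: 'p padic_int) n"
      using f[of n] unfolding times_padic_int.rep_eq one_padic_int.rep_eq y_def Rep_Abs_padic_int[OF f']
      by (simp add: cong_def p_def mod_simps)
  qed
  then show ?thesis by (metis dvd_triv_left)
qed

text \<open>The quotient by \<open>p\<close> is determined modulo \<open>p^n\<close> by \<open>x\<close> modulo \<open>p^(n+1)\<close>.\<close>

lemma pp_dvd_iff:
  fixes x :: "'p::prime_card padic_int"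
  shows "pp dvd x \<longleftrightarrow> Rep_padic_int x 1 = 0"
proof
  assume "pp dvd x"
  then obtain y where "x = pp * y" by (elim dvdE)
  then show "Rep_padic_int x 1 = 0" by (simp add: times_padic_int.rep_eq of_nat_padic_int)
next
  assume x1: "Rep_padic_int x 1 = 0"
  define p where "p = int CARD('p)"
  have p0: "p > 0" unfolding p_def using prime_card_int_pos[where 'p = 'p, of 1] by simp
  define f where "f n = Rep_padic_int x (Suc n) div p" for n
  have fp: "p * f n = Rep_padic_int x (Suc n)" for n
    using Rep_padic_int_mod(1)[of 1 "Suc n" x] x1 by (simp add: f_def p_def dvd_eq_mod_eq_0[symmetric])
  have f': "f (Suc n) mod int CARD('p) ^ n = f n mod int CARD('p) ^ n" for n
  proof -
    have "p * (f (Suc n) mod p ^ n) = p * f (Suc n) mod (p ^ Suc n)" by (simp only: mult_mod_right power_Suc)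
    also have "\<dots> = p * f n mod p ^ Suc n"
      unfolding fp using Rep_padic_int_mod(1)[of "Suc n" "Suc (Suc n)" x] Rep_padic_int_mod(1)[of "Suc n" "Suc n" x]
      by (simp add: p_def)
    also have "\<dots> = p * (f n mod p ^ n)" by (simp only: mult_mod_right power_Suc)
    finally show ?thesis using p0 by (simp add: p_def)
  qed
  define y where "y = (Abs_padic_int (\<lambda>n. f n mod int CARD('p) ^ n) :: 'p padic_int)"
  have "x = pp * y"
  proof (rule padic_int_eqI)
    fix n
    have "Rep_padic_int (pp * y) n = (p * f n) mod p ^ n"
      unfolding times_padic_int.rep_eq y_def Rep_Abs_padic_int[OF f'] of_nat_padic_int
      by (simp add: p_def mod_simps)
    also have "\<dots> = Rep_padic_int x n"
      unfolding fp using Rep_padic_int_mod(1)[of n "Suc n" x] by (simp add: p_def)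
    finally show "Rep_padic_int x n = Rep_padic_int (pp * y) n" by simp
  qed
  then show "pp dvd x" by simp
qed

lemma padic_unit_or_dvd:
  fixes x :: "'p::prime_card padic_int"
  shows "x dvd 1 \<or> pp dvd x"
  using padic_unit[of x] pp_dvd_iff[of x] by blast

lemma pp_not_unit: "\<not> (pp :: 'p::prime_card padic_int) dvd 1"
proof
  assume "(pp :: 'p padic_int) dvd 1"
  then obtain y :: "'p padic_int" where "1 = pp * y" by (elim dvdE)
  then have "Rep_padic_int (pp * y) 1 = Rep_padic_int (1 :: 'p padic_int) 1" by simp
  then show False using prime_gt_1_nat[OF prime_CARD[where 'p = 'p]]
    by (simp add: times_padic_int.rep_eq of_nat_padic_int one_padic_int.rep_eq)
qed

lemma pp_prime:
  fixes x y :: "'p::prime_card padic_int"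
  assumes "pp dvd x * y"
  shows "pp dvd x \<or> pp dvd y"
proof (rule ccontr)
  assume "\<not> ?thesis"
  then have "x * y dvd 1 * 1" using padic_unit_or_dvd by (blast intro: mult_dvd_mono)
  then show False using assms pp_not_unit dvd_trans by (metis mult_1)
qed

lemma pp_prime_power:
  fixes x :: "'p::prime_card padic_int"
  assumes "pp dvd x ^ n"
  shows "pp dvd x"
  using assms by (induction n) (use pp_not_unit pp_prime in auto)

text \<open>Every \<open>p\<close>-adic integer is congruent to a natural number modulo \<open>p\<close>.\<close>

lemma padic_fermat:
  fixes c :: "'p::prime_card padic_int"
  shows "pp dvd c ^ CARD('p) - c"
proof -
  define a where "a = nat (Rep_padic_int c 1)"
  have a: "int a = Rep_padic_int c 1" unfolding a_def using Rep_padic_int_mod(2) by simp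
  have "pp dvd c - of_nat a"
    unfolding pp_dvd_iff minus_padic_int.rep_eq of_nat_padic_int a
    using Rep_padic_int_mod(1)[of 1 1 c] by simp
  then obtain d where d: "c - of_nat a = pp * d" by (elim dvdE)
  have "c - of_nat a dvd c ^ CARD('p) - of_nat a ^ CARD('p)"
    unfolding power_diff_sumr2 by simp
  then have "pp dvd c ^ CARD('p) - of_nat a ^ CARD('p)" using d by (metis dvd_mult_left)
  moreover have "pp dvd of_nat a ^ CARD('p) - (of_nat a :: 'p padic_int)"
    by (rule prime_dvd_of_nat_power_diff[OF prime_CARD])
  ultimately have "pp dvd (c ^ CARD('p) - of_nat a ^ CARD('p)) + (of_nat a ^ CARD('p) - of_nat a) - (c - of_nat a)"
    using \<open>pp dvd c - of_nat a\<close> by (rule dvd_diff[OF dvd_add])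
  then show ?thesis by simp
qed

text \<open>Induction on an \<open>n\<close> such that \<open>x\<close> does not vanish modulo \<open>p^n\<close>.\<close>

lemma padic_decompose:
  fixes x :: "'p::prime_card padic_int"
  assumes "x \<noteq> 0"
  obtains v u where "x = pp ^ v * u" "u dvd 1"
proof -
  have *: "\<exists>v u. x = pp ^ v * u \<and> u dvd 1" if "Rep_padic_int x n \<noteq> 0" for x :: "'p padic_int" and n
    using that
  proof (induction n arbitrary: x)
    case 0
    then show ?case using Rep_padic_int_mod(2,3)[of x 0] by simp
  next
    case (Suc n)
    show ?case
    proof (cases "x dvd 1")
      case True
      then show ?thesis by (intro exI[of _ 0] exI[of _ x]) simp
    next
      case False
      then obtain y where y: "x = pp * y" using padic_unit_or_dvd by (auto elim: dvdE)
      have "Rep_padic_int y n \<noteq> 0"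
      proof
        assume "Rep_padic_int y n = 0"
        then have "int CARD('p) ^ n dvd Rep_padic_int y (Suc n)"
          using Rep_padic_int_mod(1)[of n "Suc n" y] by (simp add: dvd_eq_mod_eq_0)
        then have "int CARD('p) ^ Suc n dvd int CARD('p) * Rep_padic_int y (Suc n)" by simp
        then have "Rep_padic_int x (Suc n) = 0"
          unfolding y times_padic_int.rep_eq of_nat_padic_int by (simp add: mod_simps dvd_eq_mod_eq_0)
        then show False using Suc.prems by simp
      qed
      then obtain v u where "y = pp ^ v * u" "u dvd 1" using Suc.IH by blast
      then show ?thesis using y by (intro exI[of _ "Suc v"] exI[of _ u]) (simp add: mult.assoc)
    qed
  qed
  have "\<exists>n. Rep_padic_int x n \<noteq> 0"
  proof (rule ccontr)
    assume "\<not> ?thesis"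
    then have "x = 0" by (intro padic_int_eqI) (simp add: zero_padic_int.rep_eq)
    then show False using assms by simp
  qed
  then show ?thesis using * that by blast
qed

lemma padic_int_emb_hom:
  "inj_idom_hom (padic_int_emb :: 'p::prime_card padic_int \<Rightarrow> 'p padic_closure)"
  by unfold_locales
     (simp_all add: padic_int_emb_def Zero_fract_def[symmetric] One_fract_def[symmetric]
        to_ac_add[symmetric] to_ac_mult[symmetric] del: to_ac_add to_ac_mult, simp add: eq_fract Zero_fract_def)

lemma field_set_Qp: "field_set (Qp :: 'p::prime_card padic_closure set)"
  unfolding field_set_def ring_set_def Qp_def
  using to_ac_1 to_ac_add to_ac_mult to_ac_minus to_ac_inverse
  by (auto simp flip: to_ac_1 to_ac_add to_ac_mult to_ac_minus to_ac_inverse)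

lemma Qp_eq_quotient:
  assumes "(y :: 'p::prime_card padic_closure) \<in> Qp"
  obtains a m where "padic_int_emb (pp ^ m) * y = padic_int_emb a"
proof -
  interpret e: inj_idom_hom "padic_int_emb :: 'p padic_int \<Rightarrow> 'p padic_closure" by (rule padic_int_emb_hom)
  obtain f :: "'p padic_int fract" where f: "y = to_ac f" using assms by (auto simp: Qp_def)
  obtain a b where ab: "f = Fract a b" "b \<noteq> 0" by (cases f) auto
  obtain v u where vu: "b = pp ^ v * u" "u dvd 1" using padic_decompose[OF ab(2)] by blast
  obtain w where w: "1 = u * w" using vu(2) by (elim dvdE)
  have "Fract (pp ^ v) 1 * Fract a b = Fract (a * w) 1"
    using ab(2) w by (simp add: eq_fract vu(1)) (metis mult.assoc mult.commute mult_1)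
  then have "padic_int_emb (pp ^ v) * y = padic_int_emb (a * w)"
    unfolding f ab(1) padic_int_emb_def by (metis to_ac_mult)
  then show ?thesis using that by blast
qed

text \<open>Choose \<open>m\<close> minimal such that \<open>a = p^m y\<close> is a \<open>p\<close>-adic integer. If \<open>m > 0\<close>, then the monic equation
  for \<open>y\<close>, multiplied by \<open>p^(m n)\<close> where \<open>n\<close> is its degree, shows that \<open>p\<close> divides \<open>a^n\<close>, hence \<open>a\<close>,
  contrary to the choice of \<open>m\<close>.\<close>

lemma padic_integrally_closed:
  fixes y :: "'p::prime_card padic_closure"
  assumes q: "lead_coeff q = 1" and y: "y \<in> Qp" and root: "poly (map_poly padic_int_emb q) y = 0"
  shows "y \<in> range padic_int_emb"
proof -
  interpret e: inj_idom_hom "padic_int_emb :: 'p padic_int \<Rightarrow> 'p padic_closure" by (rule padic_int_emb_hom)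
  define Q where "Q m \<longleftrightarrow> (\<exists>a. padic_int_emb (pp ^ m) * y = padic_int_emb a)" for m
  have "\<exists>m. Q m" using Qp_eq_quotient[OF y] unfolding Q_def by metis
  then obtain m where m: "Q m" and min: "\<And>k. k < m \<Longrightarrow> \<not> Q k" by (metis exists_least_iff)
  obtain a where a: "padic_int_emb (pp ^ m) * y = padic_int_emb a" using m by (auto simp: Q_def)
  show ?thesis
  proof (cases m)
    case 0
    then show ?thesis using a by simp
  next
    case (Suc k)
    define n where "n = degree q"
    define P :: "'p padic_closure" where "P = padic_int_emb (pp ^ m)"
    have "n > 0"
    proof (rule ccontr)
      assume "\<not> n > 0"
      then have "q = 1" using q unfolding n_def by (metis degree_0_id gr0I one_pCons)
      then show False using root by simp
    qed
    have "0 = P ^ n * (\<Sum>i\<le>n. padic_int_emb (coeff q i) * y ^ i)"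
      using root by (simp add: poly_altdef n_def)
    also have "\<dots> = (\<Sum>i\<le>n. padic_int_emb (coeff q i) * (P ^ (n - i) * (P * y) ^ i))"
      unfolding sum_distrib_left
    proof (rule sum.cong[OF refl])
      fix i assume "i \<in> {..n}"
      then have "P ^ n = P ^ (n - i) * P ^ i" by (simp add: power_add[symmetric])
      then show "P ^ n * (padic_int_emb (coeff q i) * y ^ i) = padic_int_emb (coeff q i) * (P ^ (n - i) * (P * y) ^ i)"
        by (simp add: power_mult_distrib)
    qed
    also have "\<dots> = padic_int_emb (\<Sum>i\<le>n. coeff q i * ((pp ^ m) ^ (n - i) * a ^ i))"
      unfolding P_def a by (simp add: hom_distribs)
    finally have "(\<Sum>i\<le>n. coeff q i * ((pp ^ m) ^ (n - i) * a ^ i)) = 0" using e.hom_0_iff by metis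
    then have "a ^ n + (\<Sum>i<n. coeff q i * ((pp ^ m) ^ (n - i) * a ^ i)) = 0"
      using q by (simp add: lessThan_Suc_atMost[symmetric] n_def add.commute)
    then have "a ^ n = - (\<Sum>i<n. coeff q i * ((pp ^ m) ^ (n - i) * a ^ i))"
      by (simp add: eq_neg_iff_add_eq_0)
    moreover have "pp dvd (\<Sum>i<n. coeff q i * ((pp ^ m) ^ (n - i) * a ^ i))"
    proof (rule dvd_sum)
      fix i assume "i \<in> {..<n}"
      then have "(pp :: 'p padic_int) dvd (pp ^ m) ^ (n - i)"
        using Suc by (cases "n - i") (auto simp: mult.assoc)
      then show "pp dvd coeff q i * ((pp ^ m) ^ (n - i) * a ^ i)" by simp
    qed
    ultimately have "pp dvd a ^ n" by simp
    then have "pp dvd a" by (rule pp_prime_power)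
    then obtain b where "a = pp * b" by (elim dvdE)
    then have "padic_int_emb pp * (padic_int_emb (pp ^ k) * y) = padic_int_emb pp * padic_int_emb b"
      using a unfolding Suc by (simp add: hom_distribs mult.assoc)
    moreover have "padic_int_emb pp \<noteq> (0 :: 'p padic_closure)"
      using prime_gt_0_nat[OF prime_CARD[where 'p = 'p]] by simp
    ultimately have "Q k" unfolding Q_def using mult_left_cancel by blast
    then show ?thesis using min[of k] Suc by simp
  qed
qed

lemma cyclotomic_base_padic:
  fixes z :: "'p::prime_card padic_closure"
  assumes "prim_root g z"
  shows "cyclotomic_base padic_int_emb Qp g z"
proof -
  interpret inj_idom_hom "padic_int_emb :: 'p padic_int \<Rightarrow> 'p padic_closure" by (rule padic_int_emb_hom)
  show ?thesis
    by unfold_locales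
       (use assms field_set_Qp padic_integrally_closed in \<open>auto simp: padic_int_emb_def Qp_def\<close>)
qed

section \<open>Conjugacy of roots of unity over the p-adic numbers\<close>

lemma ring_emb_prod:
  assumes "ring_emb S f" "ring_set S" "\<And>i. i \<in> A \<Longrightarrow> u i \<in> S"
  shows "f (prod u A) = (\<Prod>i\<in>A. f (u i))"
  using assms(3)
  by (induction A rule: infinite_finite_induct)
     (auto simp: ring_embD[OF assms(1,2)] ring_set_prod[OF assms(2)])

lemma orbit_permuted:
  assumes L: "field_set L" and F: "F \<subseteq> L" and x: "x \<in> L" and t: "\<tau> \<in> carrier (gal_group L F)"
  shows "\<tau> ` (\<lambda>\<rho>. \<rho> x) ` carrier (gal_group L F) \<subseteq> (\<lambda>\<rho>. \<rho> x) ` carrier (gal_group L F)"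
    "x \<in> (\<lambda>\<rho>. \<rho> x) ` carrier (gal_group L F)"
proof -
  interpret G: group "gal_group L F" by (rule group_gal_group[OF L F])
  show "x \<in> (\<lambda>\<rho>. \<rho> x) ` carrier (gal_group L F)"
    using gal_group_apply(4)[OF L F G.one_closed x] by (intro image_eqI[OF _ G.one_closed]) simp
  show "\<tau> ` (\<lambda>\<rho>. \<rho> x) ` carrier (gal_group L F) \<subseteq> (\<lambda>\<rho>. \<rho> x) ` carrier (gal_group L F)"
  proof
    fix y assume "y \<in> \<tau> ` (\<lambda>\<rho>. \<rho> x) ` carrier (gal_group L F)"
    then obtain \<rho> where r: "\<rho> \<in> carrier (gal_group L F)" "y = \<tau> (\<rho> x)" by blast
    then have "y = (\<tau> \<otimes>\<^bsub>gal_group L F\<^esub> \<rho>) x"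
      using gal_group_apply(1)[OF L F t x r(1)] by simp
    then show "y \<in> (\<lambda>\<rho>. \<rho> x) ` carrier (gal_group L F)" using G.m_closed[OF t r(1)] by blast
  qed
qed

text \<open>The root of unity \<open>z\<close> is split into a \<open>p\<close>-free part \<open>w0\<close> of order \<open>g0\<close> and a part of order \<open>p^n\<close>.
  Correspondingly the extension generated by \<open>z\<close> is unramified up to the field generated by \<open>w0\<close> and
  totally ramified from there on. The rings \<open>C.B\<close> and \<open>W.B\<close> are generated over the \<open>p\<close>-adic integers
  by \<open>z\<close> and \<open>w0\<close>.\<close>

locale padic_roots =
  fixes z :: "'p::prime_card padic_closure" and g g0 n :: nat
  assumes z: "prim_root g z" and g: "g = g0 * CARD('p) ^ n" and g0: "\<not> CARD('p) dvd g0"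
begin

abbreviation emb :: "'p padic_int \<Rightarrow> 'p padic_closure" where "emb \<equiv> padic_int_emb"
abbreviation P :: "'p padic_closure" where "P \<equiv> of_nat CARD('p)"

definition w0 :: "'p padic_closure" where "w0 = z ^ (CARD('p) ^ n)"

sublocale C: cyclotomic_base padic_int_emb Qp g z by (rule cyclotomic_base_padic[OF z])

lemma g_pos: "g > 0" "g0 > 0" using prim_rootD(1)[OF z] by (auto simp: g)

lemma p_prime: "Factorial_Ring.prime CARD('p)" by (rule prime_CARD)

lemma coprime_g0: "coprime g0 (CARD('p) ^ k)"
  using prime_imp_coprime[OF p_prime g0] by (simp add: coprime_commute)

lemma w0: "prim_root g0 w0"
  unfolding w0_def using prim_root_power[OF z, of "CARD('p) ^ n"] prime_gt_0_nat[OF p_prime] by (simp add: g)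

sublocale W: cyclotomic_base padic_int_emb Qp g0 w0 by (rule cyclotomic_base_padic[OF w0])

lemma w0_g: "w0 ^ g = 1" using prim_rootD(3)[OF w0] by (simp add: g power_mult)

lemma emb_pp: "emb pp = P"
proof -
  have "emb (of_nat k) = of_nat k" for k by (induction k) (simp_all add: hom_distribs)
  then show ?thesis .
qed

lemma P_B: "P \<in> C.B" "P \<in> W.B" by (rule C.of_nat_B, rule W.of_nat_B)

lemma WB_subset: "W.B \<subseteq> C.B"
proof
  fix y assume "y \<in> W.B"
  then obtain r where "y = poly (map_poly emb r) w0" by (auto simp: W.B_def W.ev_def)
  then show "y \<in> C.B" using C.poly_B[OF w0_g] by simp
qed

lemma P_nonzero: "P \<noteq> 0" using prime_gt_0_nat[OF p_prime] by simp

text \<open>The difference divides \<open>g0\<close>, which is a \<open>p\<close>-adic unit.\<close>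

lemma different_p_free_parts_unit:
  assumes a: "a ^ g = 1" "b ^ g = 1" "a ^ (CARD('p) ^ n) \<noteq> b ^ (CARD('p) ^ n)"
  shows "C.Bunit (b - a)"
proof -
  obtain c where c: "c \<in> C.B" "(b - a) * c = of_nat (g div CARD('p) ^ n)"
    using C.root_difference_dvd[OF a(1,2) _ a(3)] by (auto simp: g)
  have "g div CARD('p) ^ n = g0" using prime_gt_0_nat[OF p_prime] by (simp add: g)
  moreover have "(of_nat g0 :: 'p padic_int) dvd 1"
  proof (rule padic_unit)
    have "\<not> int CARD('p) dvd int g0" using g0 by simp
    then have "int g0 mod int CARD('p) \<noteq> 0" by (simp add: dvd_eq_mod_eq_0)
    then show "Rep_padic_int (of_nat g0 :: 'p padic_int) 1 \<noteq> 0" by (simp add: of_nat_padic_int)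
  qed
  then have "C.Bunit (emb (of_nat g0))" by (simp add: C.Bunit_emb)
  moreover have "emb (of_nat g0) = of_nat g0" by (induction g0) (simp_all add: hom_distribs)
  ultimately have "C.Bunit ((b - a) * c)" using c(2) by simp
  moreover have "b - a \<in> C.B" by (intro ring_setD(6)[OF C.ring_set_B] C.root_B a)
  ultimately show ?thesis using c(1) C.Bunit_factor by blast
qed

text \<open>The ring generated by \<open>w0\<close> is reduced modulo \<open>p\<close>, because a power of Frobenius acts as the identity
  on its quotient by \<open>p\<close>.\<close>

lemma reduced_mod_p:
  assumes x: "x \<in> W.B" and k: "x ^ k = P * y" "y \<in> W.B"
  shows "\<exists>y\<in>W.B. x = P * y"
proof -
  note R = ring_setD[OF W.ring_set_B]
  obtain r where r: "x = poly (map_poly emb r) w0" using x by (auto simp: W.B_def W.ev_def)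
  \<comment> \<open>by Euler, \<open>p ^ f\<close> is 1 modulo \<open>g0\<close>; the factor \<open>Suc k\<close> makes \<open>p ^ f\<close> exceed \<open>k\<close>\<close>
  define f where "f = totient g0 * Suc k"
  have "[CARD('p) ^ totient g0 = 1] (mod g0)"
    using coprime_g0[of 1] by (intro euler_theorem) (simp add: coprime_commute)
  then have "[(CARD('p) ^ totient g0) ^ Suc k = 1 ^ Suc k] (mod g0)" by (rule cong_pow)
  then have "[CARD('p) ^ f = 1] (mod g0)" by (simp add: f_def power_mult[symmetric] power_add)
  then have wf: "w0 ^ (CARD('p) ^ f) = w0"
    using prim_root_mod[OF w0, of "CARD('p) ^ f"] prim_root_mod[OF w0, of 1] by (simp add: cong_def)
  have "totient g0 > 0" using g_pos by simp
  then have "1 * Suc k \<le> f" unfolding f_def by (intro mult_le_mono1) linarith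
  then have "k \<le> f" by simp
  moreover have "f < CARD('p) ^ f" by (rule power_gt_expt) (use prime_gt_1_nat[OF p_prime] in simp)
  ultimately have kf: "k \<le> CARD('p) ^ f" by linarith
  obtain h where h: "h \<in> W.B" "x ^ (CARD('p) ^ f) = x + P * h"
    using W.frobenius_power[OF p_prime padic_fermat prim_rootD(3)[OF w0], of r f] wf unfolding r by auto
  have "x ^ (CARD('p) ^ f) = x ^ k * x ^ (CARD('p) ^ f - k)" using kf by (simp add: power_add[symmetric])
  then have "x = P * (y * x ^ (CARD('p) ^ f - k) - h)" using h(2) k(1) by (simp add: algebra_simps)
  moreover have "y * x ^ (CARD('p) ^ f - k) - h \<in> W.B" by (intro R(6) R(4) R(7) k(2) x h(1))
  ultimately show ?thesis by blast
qed

text \<open>If \<open>b\<close> satisfies a monic equation of degree \<open>d\<close>, then its multiple by \<open>p^d\<close> shows that \<open>p\<close> divides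
  \<open>x^d\<close> in \<open>W.B\<close>, which is reduced modulo \<open>p\<close>.\<close>

lemma divisible_in_subring:
  assumes x: "x \<in> W.B" "x = P * b" "b \<in> C.B"
  shows "\<exists>y\<in>W.B. x = P * y"
proof -
  note R = ring_setD[OF W.ring_set_B]
  obtain q where q: "lead_coeff q = 1" "poly (map_poly emb q) b = 0"
    using C.B_integral[OF x(3)] by blast
  define d where "d = degree q"
  have "0 = P ^ d * (\<Sum>i\<le>d. emb (coeff q i) * b ^ i)"
    using q(2) by (simp add: poly_altdef d_def)
  also have "\<dots> = (\<Sum>i\<le>d. emb (coeff q i) * (P ^ (d - i) * (P * b) ^ i))"
    unfolding sum_distrib_left
  proof (rule sum.cong[OF refl])
    fix i assume "i \<in> {..d}"
    then have "P ^ d = P ^ (d - i) * P ^ i" by (simp add: power_add[symmetric])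
    then show "P ^ d * (emb (coeff q i) * b ^ i) = emb (coeff q i) * (P ^ (d - i) * (P * b) ^ i)"
      by (simp add: power_mult_distrib)
  qed
  also have "\<dots> = x ^ d + (\<Sum>i<d. emb (coeff q i) * (P ^ (d - i) * x ^ i))"
    using q(1) unfolding x(2)[symmetric] by (simp add: lessThan_Suc_atMost[symmetric] d_def add.commute)
  also have "(\<Sum>i<d. emb (coeff q i) * (P ^ (d - i) * x ^ i)) = P * (\<Sum>i<d. emb (coeff q i) * (P ^ (d - Suc i) * x ^ i))"
    unfolding sum_distrib_left
  proof (rule sum.cong[OF refl])
    fix i assume "i \<in> {..<d}"
    then have "P ^ (d - i) = P * P ^ (d - Suc i)" by (simp add: Suc_diff_Suc flip: power_Suc)
    then show "emb (coeff q i) * (P ^ (d - i) * x ^ i) = P * (emb (coeff q i) * (P ^ (d - Suc i) * x ^ i))"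
      by (simp only: mult_ac)
  qed
  finally have "x ^ d = P * (- (\<Sum>i<d. emb (coeff q i) * (P ^ (d - Suc i) * x ^ i)))"
    by (simp add: eq_neg_iff_add_eq_0)
  then show ?thesis
  proof (rule reduced_mod_p[OF x(1)])
    show "- (\<Sum>i<d. emb (coeff q i) * (P ^ (d - Suc i) * x ^ i)) \<in> W.B"
      by (intro R(5) ring_set_sum[OF W.ring_set_B] R(4) R(7) W.emb_B P_B x(1))
  qed
qed

text \<open>The denominator \<open>P ^ m\<close> can be cancelled one factor at a time, which puts \<open>y\<close> into \<open>W.B\<close>, where
  reducedness modulo \<open>p\<close> applies.\<close>

lemma radical_of_p:
  assumes "y \<in> C.B" "P ^ m * y \<in> W.B" "y ^ k = P * b" "b \<in> C.B"
  shows "\<exists>c\<in>C.B. y = P * c"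
  using assms(2)
proof (induction m)
  case 0
  then have y: "y \<in> W.B" by simp
  then have "y ^ k \<in> W.B" by (rule ring_setD(7)[OF W.ring_set_B])
  then obtain c where "c \<in> W.B" "y ^ k = P * c" using divisible_in_subring[OF _ assms(3,4)] by blast
  then show ?case using reduced_mod_p[OF y] WB_subset by blast
next
  case (Suc m)
  have "P ^ m * y \<in> C.B" by (intro ring_setD(4)[OF C.ring_set_B] ring_setD(7)[OF C.ring_set_B] P_B assms(1))
  then obtain c where c: "c \<in> W.B" "P ^ Suc m * y = P * c"
    using divisible_in_subring[OF Suc.prems, of "P ^ m * y"] by (auto simp: mult.assoc)
  then have "P ^ m * y = c" using P_nonzero by simp
  then show ?case using Suc.IH c(1) by blast
qed

lemma clear_denominator:
  assumes "y \<in> adj Qp w0"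
  obtains m where "P ^ m * y \<in> W.B"
proof -
  note R = ring_setD[OF W.ring_set_B]
  obtain q where q: "q \<in> poly_over Qp" "y = poly q w0" using assms unfolding W.A(5) by blast
  have "\<exists>m. P ^ m * poly q w0 \<in> W.B" using q(1)
  proof (induction q)
    case 0
    then show ?case using R(2) by simp
  next
    case (pCons a q)
    have "q \<in> poly_over Qp"
    proof (rule poly_overI)
      fix i show "coeff q i \<in> Qp" using poly_overD[OF pCons.prems, of "Suc i"] by simp
    qed
    then obtain m where m: "P ^ m * poly q w0 \<in> W.B" using pCons.IH by blast
    have "a \<in> Qp" using poly_overD[OF pCons.prems, of 0] by simp
    then obtain b k where "emb (pp ^ k) * a = emb b" using Qp_eq_quotient by blast
    then have k: "P ^ k * a \<in> W.B" using W.emb_B[of b] by (simp add: hom_distribs emb_pp)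
    have "P ^ (m + k) * poly (pCons a q) w0 = P ^ m * (P ^ k * a) + P ^ k * (w0 ^ 1 * (P ^ m * poly q w0))"
      by (simp add: power_add algebra_simps)
    also have "\<dots> \<in> W.B" by (intro R(3) R(4) R(7) P_B m k) (rule W.z_B[of 1, simplified])
    finally show ?case by blast
  qed
  then show ?thesis using that q(2) by blast
qed

text \<open>Total ramification. Let \<open>x = z ^ g0\<close>, a primitive root of unity of order \<open>p^n\<close>, let \<open>T\<close> be the set of
  its conjugates over \<open>E = adj Qp w0\<close>, and \<open>S\<close> the set of all primitive roots of this order. All \<open>1 - s\<close>
  for \<open>s\<close> in \<open>S\<close> are unit multiples of \<open>pi = 1 - x\<close>, and their product is \<open>p\<close>. So the product \<open>y\<close> of the
  \<open>1 - s\<close> for \<open>s\<close> in \<open>T\<close>, an element of \<open>E\<close>, is a unit times the power of \<open>pi\<close> with exponent \<open>card T\<close>,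
  and some power of \<open>y\<close> is divisible by \<open>p\<close>. As \<open>p\<close> is unramified in \<open>E\<close>, already \<open>y\<close> is divisible by
  \<open>p\<close>. If \<open>T\<close> were smaller than \<open>S\<close>, then \<open>pi\<close> and with it \<open>p\<close> would be units.\<close>

lemma p_power_roots_conjugate:
  assumes n: "n > 0" and t: "t ^ (CARD('p) ^ n) = 1" "t ^ (CARD('p) ^ (n - 1)) \<noteq> 1"
  shows "\<exists>\<tau>\<in>carrier (gal_group (adj (adj Qp w0) (z ^ g0)) (adj Qp w0)). \<tau> (z ^ g0) = t"
proof -
  define E where "E = adj Qp w0"
  define x where "x = z ^ g0"
  define L where "L = adj E x"
  have E: "field_set E" unfolding E_def by (rule W.A(1))
  have p0: "CARD('p) > 0" using prime_gt_0_nat[OF p_prime] .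
  have x: "prim_root (CARD('p) ^ n) x"
    unfolding x_def using prim_root_power[OF z, of g0] g_pos by (simp add: g)
  note A = adj[OF E prim_root_algebraic[OF E x], folded L_def]
  note R = ring_setD[OF C.ring_set_B]
  define T where "T = (\<lambda>\<rho>. \<rho> x) ` carrier (gal_group L E)"
  define S where "S = {t::'p padic_closure. t ^ (CARD('p) ^ n) = 1 \<and> t ^ (CARD('p) ^ n div CARD('p)) \<noteq> 1}"
  have pn: "CARD('p) ^ n div CARD('p) = CARD('p) ^ (n - 1)" using n p0 by (cases n) simp_all
  have finS: "finite S" using finite_subset[OF _ roots_of_unity_eq(2)[OF x]] by (auto simp: S_def)
  have sub: "s ^ g = 1" if "s ^ (CARD('p) ^ n) = 1" for s :: "'p padic_closure"
    using that by (simp add: g mult.commute[of g0] power_mult)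
  have S_prim: "prim_root (CARD('p) ^ n) s" if s: "s \<in> S" for s
  proof -
    obtain i where i: "s = x ^ i" using root_of_unity_power[OF x, of s] s by (auto simp: S_def)
    have "\<not> CARD('p) dvd i"
    proof
      assume "CARD('p) dvd i"
      then obtain j where "i = CARD('p) * j" by (elim dvdE)
      then have "s ^ (CARD('p) ^ n div CARD('p)) = (x ^ (CARD('p) * CARD('p) ^ (n - 1))) ^ j" unfolding i pn by (simp add: power_mult[symmetric] mult_ac)
      also have "CARD('p) * CARD('p) ^ (n - 1) = CARD('p) ^ n" using n by (cases n) simp_all
      finally show False using s prim_rootD(3)[OF x] by (simp add: S_def)
    qed
    then have "coprime i (CARD('p) ^ n)" using prime_imp_coprime[OF p_prime] by (simp add: coprime_commute)
    then show ?thesis using prim_root_power_coprime[OF x] i by simp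
  qed
  have TS: "T \<subseteq> S"
  proof
    fix s assume "s \<in> T"
    then obtain \<rho> where r: "\<rho> \<in> carrier (gal_group L E)" "s = \<rho> x" by (auto simp: T_def)
    have "prim_root (CARD('p) ^ n) s"
      unfolding r(2) using prim_root_aut(2)[OF E x] gal_groupD(3,4)[OF A(1) r(1)] by (simp add: L_def)
    moreover have "CARD('p) ^ (n - 1) < CARD('p) ^ n" using n prime_gt_1_nat[OF p_prime] by (intro power_strict_increasing) auto
    then have "\<not> CARD('p) ^ n dvd CARD('p) ^ (n - 1)" using p0 by (auto dest: dvd_imp_le)
    ultimately show "s \<in> S" using prim_rootD(2,3)[of "CARD('p) ^ n" s] by (simp add: S_def pn)
  qed
  have finT: "finite T" using finite_subset[OF TS finS] .
  have xT: "x \<in> T" using orbit_permuted(2)[OF A(1,2,3)] group.is_monoid[OF group_gal_group[OF A(1,2)]] monoid.one_closed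
    unfolding T_def by metis
  have "T = S"
  proof (rule ccontr)
    assume "T \<noteq> S"
    then have card: "card T < card S" using TS finS by (intro psubset_card_mono) auto
    have cT: "card T > 0" using xT finT by (auto simp: card_gt_0_iff)
    define pi where "pi = 1 - x"
    have x1: "x \<noteq> 1"
    proof
      assume "x = 1"
      then have "CARD('p) ^ n dvd 1" using prim_rootD(2)[OF x, of 1] by simp
      then show False using n prime_gt_1_nat[OF p_prime] by simp
    qed
    have xB: "x \<in> C.B" using C.root_B sub prim_rootD(3)[OF x] by blast
    have piB: "pi \<in> C.B" unfolding pi_def by (intro R(6) R(1) xB)
    have pow1: "\<exists>c\<in>C.B. 1 - s ^ i = (1 - s) * c" if "s \<in> C.B" for s i
    proof
      show "1 - s ^ i = (1 - s) * (\<Sum>j<i. s ^ j)"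
        using power_diff_1_eq[of s i] by (simp add: algebra_simps)
      show "(\<Sum>j<i. s ^ j) \<in> C.B" by (intro ring_set_sum[OF C.ring_set_B] R(7) that)
    qed
    \<comment> \<open>\<open>x\<close> and \<open>s\<close> are powers of each other, so \<open>1 - x\<close> and \<open>1 - s\<close> divide each other\<close>
    have "\<exists>u. C.Bunit u \<and> 1 - s = pi * u" if s: "s \<in> S" for s
    proof -
      have sB: "s \<in> C.B" using C.root_B sub s by (auto simp: S_def)
      obtain i where i: "s = x ^ i" using root_of_unity_power[OF x, of s] s by (auto simp: S_def)
      obtain j where j: "x = s ^ j" using root_of_unity_power[OF S_prim[OF s] prim_rootD(3)[OF x]] by blast
      obtain c where c: "c \<in> C.B" "1 - s = pi * c" using pow1[OF xB, of i] i by (auto simp: pi_def)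
      obtain d where d: "d \<in> C.B" "pi = (1 - s) * d" using pow1[OF sB, of j] j by (auto simp: pi_def)
      have "pi * (c * d) = pi" using c(2) d(2) by (metis mult.assoc)
      then have "c * d = 1" using x1 by (simp add: pi_def)
      then show ?thesis using c d by (auto simp: C.Bunit_def)
    qed
    then obtain u where u: "\<And>s. s \<in> S \<Longrightarrow> C.Bunit (u s)" "\<And>s. s \<in> S \<Longrightarrow> 1 - s = pi * u s" by metis
    define v where "v = (\<lambda>A. \<Prod>s\<in>A. u s)"
    have v: "C.Bunit (v A)" if "A \<subseteq> S" for A unfolding v_def using that u(1) by (intro C.Bunit_prod) auto
    have prodA: "(\<Prod>s\<in>A. 1 - s) = pi ^ card A * v A" if "A \<subseteq> S" for A
      unfolding v_def using that u(2) by (simp add: prod.distrib[symmetric] subset_iff flip: prod_constant)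
    \<comment> \<open>the value at 1 of the cyclotomic polynomial of order \<open>p ^ n\<close>\<close>
    have "P = (\<Prod>s\<in>S. 1 - s)"
    proof -
      have "CARD('p) dvd CARD('p) ^ n" using n by simp
      from prod_roots_of_unity_quotient[OF x this]
      have "poly (\<Prod>s\<in>S. [:- s, 1:]) 1 = poly (\<Sum>i<CARD('p). monom 1 (i * (CARD('p) ^ n div CARD('p)))) 1" by (simp add: S_def)
      then show ?thesis by (simp add: poly_prod poly_sum poly_monom)
    qed
    then have P: "P = pi ^ card S * v S" using prodA[of S] by simp
    define y where "y = (\<Prod>s\<in>T. 1 - s)"
    have y: "y = pi ^ card T * v T" unfolding y_def by (rule prodA[OF TS])
    have yB: "y \<in> C.B" using v[OF TS] unfolding y C.Bunit_def by (intro R(4) R(7) piB) simp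
    have TL: "T \<subseteq> L" using gal_groupD(5)[OF A(1) _ A(3)] by (auto simp: T_def)
    note RL = field_setD(1)[OF A(1)]
    have "y \<in> E"
    proof (rule prim_root_fixed[OF E x, folded L_def])
      show "y \<in> L" unfolding y_def using TL by (intro ring_set_prod[OF RL] ring_setD(1,6)[OF RL]) auto
      fix \<tau> assume t: "\<tau> \<in> carrier (gal_group L E)"
      note D = gal_groupD[OF A(1) t]
      have im: "\<tau> ` T \<subseteq> T" unfolding T_def by (rule orbit_permuted(1)[OF A(1,2,3) t])
      have inj: "inj_on \<tau> T" by (rule inj_on_subset[OF ring_emb_inj[OF D(3) A(1)] TL])
      have "\<tau> y = (\<Prod>s\<in>T. \<tau> (1 - s))"
        unfolding y_def using TL by (intro ring_emb_prod[OF D(3) RL] ring_setD(1,6)[OF RL]) auto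
      also have "\<dots> = (\<Prod>s\<in>T. 1 - \<tau> s)"
        using TL by (intro prod.cong refl) (auto simp: ring_embD(1,6)[OF D(3) RL] ring_setD(1)[OF RL] subset_iff)
      also have "\<dots> = (\<Prod>s\<in>\<tau> ` T. 1 - s)" by (simp add: prod.reindex[OF inj])
      also have "\<tau> ` T = T" by (rule endo_inj_surj[OF finT im inj])
      finally show "\<tau> y = y" by (simp add: y_def)
    qed
    then obtain m where m: "P ^ m * y \<in> W.B" using clear_denominator unfolding E_def by blast
    obtain vs where vs: "vs \<in> C.B" "v S * vs = 1" using v[of S] by (auto simp: C.Bunit_def)
    have vTB: "v T \<in> C.B" using v[OF TS] by (simp add: C.Bunit_def)
    have "pi ^ card S = P * vs" using P vs(2) by (simp add: mult.assoc)
    then have "y ^ card S = (P * vs) ^ card T * v T ^ card S"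
      unfolding y by (simp add: power_mult_distrib power_mult[symmetric] mult.commute[of "card T"]) (simp add: power_mult power_mult_distrib)
    also have "\<dots> = P * (P ^ (card T - 1) * vs ^ card T * v T ^ card S)"
      using cT by (cases "card T") (simp_all add: power_mult_distrib algebra_simps)
    finally have "\<exists>c\<in>C.B. y = P * c"
      by (rule radical_of_p[OF yB m]) (intro R(4) R(7) P_B vs vTB)
    then obtain c where c: "c \<in> C.B" "y = P * c" by blast
    have "pi ^ card T * v T = pi ^ card T * (pi ^ (card S - card T) * v S * c)"
      using c(2) card unfolding y P by (simp add: power_add[symmetric] mult.assoc[symmetric])
    moreover have "pi ^ card T \<noteq> 0" using x1 by (simp add: pi_def)
    ultimately have "v T = pi ^ (card S - card T) * v S * c" using mult_left_cancel by blast
    also have "\<dots> = pi * (pi ^ (card S - card T - 1) * v S * c)"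
      using card by (cases "card S - card T") (simp_all add: mult.assoc)
    finally have "C.Bunit (pi * (pi ^ (card S - card T - 1) * v S * c))" using v[OF TS] by simp
    then have "C.Bunit pi"
      by (rule C.Bunit_factor) (intro piB R(4) R(7) c(1), use v[of S] in \<open>simp add: C.Bunit_def\<close>)+
    then have "C.Bunit (\<Prod>i<card S. pi)" by (intro C.Bunit_prod) simp
    then have "C.Bunit P" unfolding P by (intro C.Bunit_mult v) simp_all
    then show False using pp_not_unit[where 'p = 'p] by (simp add: C.Bunit_emb flip: emb_pp)
  qed
  then have "t \<in> T" using t by (simp add: S_def pn)
  then show ?thesis unfolding T_def L_def E_def x_def by blast
qed

text \<open>Write \<open>w = z ^ a\<close>. An automorphism over the field of \<open>w0\<close> raises the part of \<open>z\<close> of \<open>p\<close>-power order to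
  the power \<open>a\<close>. It fixes the \<open>p\<close>-free part of \<open>z\<close>, and so does raising it to the power \<open>a\<close>, since \<open>w\<close> and
  \<open>z\<close> have the same \<open>p\<close>-free part.\<close>

theorem padic_conjugate:
  assumes w: "prim_root g w" "w ^ (CARD('p) ^ n) = z ^ (CARD('p) ^ n)"
  shows "\<exists>\<tau>\<in>C.Gal. \<tau> z = w"
proof -
  note A = C.A
  interpret G: group "gal_group (adj Qp z) Qp" by (rule group_gal_group[OF A(1,2)])
  show ?thesis
  proof (cases "n = 0")
    case True
    then show ?thesis using w(2) gal_group_apply(4)[OF A(1,2) G.one_closed A(3)] G.one_closed by auto
  next
    case False
    obtain a where a: "w = z ^ a" using root_of_unity_power[OF z prim_rootD(3)[OF w(1)]] by blast
    define x where "x = z ^ g0"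
    define E where "E = adj Qp w0"
    have E: "field_set E" unfolding E_def by (rule W.A(1))
    have x: "prim_root (CARD('p) ^ n) x"
      unfolding x_def using prim_root_power[OF z, of g0] g_pos by (simp add: g)
    note L = adj[OF E prim_root_algebraic[OF E x]]
    have "prim_root (CARD('p) ^ n) (w ^ g0)" using prim_root_power[OF w(1), of g0] g_pos by (simp add: g)
    moreover have "w ^ g0 = x ^ a" by (simp add: a x_def power_mult[symmetric] mult.commute)
    ultimately have xa: "prim_root (CARD('p) ^ n) (x ^ a)" by simp
    have "CARD('p) ^ (n - 1) < CARD('p) ^ n" using False prime_gt_1_nat[OF p_prime] by (intro power_strict_increasing) auto
    then have "\<not> CARD('p) ^ n dvd CARD('p) ^ (n - 1)" using prime_gt_0_nat[OF p_prime] by (auto dest: dvd_imp_le)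
    then obtain \<tau> where t: "\<tau> \<in> carrier (gal_group (adj E x) E)" "\<tau> x = x ^ a"
      using p_power_roots_conjugate[of "x ^ a"] False prim_rootD(2,3)[OF xa] unfolding E_def x_def by blast
    note D = gal_groupD[OF L(1) t(1)]
    obtain u where u: "[CARD('p) ^ n * u = 1] (mod g0)"
      using cong_solve_coprime_nat[of "CARD('p) ^ n" g0] coprime_g0 by (auto simp: coprime_commute)
    obtain v where v: "[g0 * v = 1] (mod CARD('p) ^ n)"
      using cong_solve_coprime_nat[of g0 "CARD('p) ^ n"] coprime_g0 by auto
    \<comment> \<open>\<open>e\<close> is 1 modulo \<open>g\<close>, so \<open>z\<close> is the product of a power of \<open>w0\<close> and a power of \<open>x\<close>\<close>
    define e where "e = CARD('p) ^ n * u + g0 * v"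
    have "[e = 1 + 0] (mod g0)" unfolding e_def by (rule cong_add[OF u]) (simp add: cong_def)
    moreover have "[e = 0 + 1] (mod CARD('p) ^ n)" unfolding e_def by (rule cong_add[OF _ v]) (simp add: cong_def)
    ultimately have "[e = 1] (mod g)" unfolding g using coprime_g0 by (simp add: coprime_cong_mult_nat)
    then have "z ^ e = z" using prim_root_mod[OF z, of e] prim_root_mod[OF z, of 1] by (simp add: cong_def)
    then have zuv: "z = w0 ^ u * x ^ v" by (simp add: e_def w0_def x_def power_add power_mult)
    have w0E: "w0 \<in> E" unfolding E_def by (rule W.A(3))
    note RL = ring_setD[OF field_setD(1)[OF L(1)]]
    have zL: "z \<in> adj E x"
    proof -
      have "w0 ^ u * x ^ v \<in> adj E x" by (intro RL(4) RL(7) L(3) subsetD[OF L(2) w0E])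
      then show ?thesis by (simp only: zuv[symmetric])
    qed
    have QE: "Qp \<subseteq> E" unfolding E_def by (rule W.A(2))
    have sub: "adj Qp z \<subseteq> adj E x" using zL QE L(2) by (intro generate_field_subset[OF L(1)]) auto
    have emb': "ring_emb (adj Qp z) \<tau>" by (rule ring_emb_subset[OF D(3) sub])
    have fixQ: "\<tau> y = y" if "y \<in> Qp" for y using D(4) QE that by blast
    have w0a: "w0 ^ a = w0" using w(2) unfolding a w0_def by (simp add: power_mult[symmetric] mult.commute)
    note RE = ring_embD[OF D(3) field_setD(1)[OF L(1)]]
    have "\<tau> (w0 ^ u * x ^ v) = w0 ^ u * (x ^ a) ^ v"
      using RE(3,7) L(3) subsetD[OF L(2) w0E] RL(7) D(4)[OF w0E] t(2) by simp
    then have "\<tau> z = w0 ^ u * (x ^ a) ^ v" by (simp only: zuv[symmetric])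
    also have "w0 ^ u = (w0 ^ u) ^ a" using w0a by (metis power_mult mult.commute)
    finally have "\<tau> z = (w0 ^ u * x ^ v) ^ a" by (simp add: power_mult_distrib power_mult[symmetric] mult.commute)
    then have "\<tau> z = w" by (simp only: zuv[symmetric] a)
    then show ?thesis
      using prim_root_aut(1)[OF field_set_Qp z emb' fixQ] A(3) by (intro bexI[of _ "restrict \<tau> (adj Qp z)"]) simp_all
  qed
qed

end

section \<open>Polynomials acting on modules over a group ring\<close>

lemma group_ring_simps [simp]:
  "carrier (group_ring G) = {f. finite {\<sigma>. f \<sigma> \<noteq> 0} \<and> {\<sigma>. f \<sigma> \<noteq> 0} \<subseteq> carrier G}"
  "\<one>\<^bsub>group_ring G\<^esub> = gr_single 1 \<one>\<^bsub>G\<^esub>" "\<zero>\<^bsub>group_ring G\<^esub> = (\<lambda>\<tau>. 0)"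
  "f \<oplus>\<^bsub>group_ring G\<^esub> h = (\<lambda>\<tau>. f \<tau> + h \<tau>)"
  by (simp_all add: group_ring_def gr_single_def)

lemma gr_single_closed: "\<sigma> \<in> carrier G \<Longrightarrow> gr_single c \<sigma> \<in> carrier (group_ring G)"
  by (auto simp: gr_single_def)

lemma gr_single_mult:
  assumes "\<sigma> \<in> carrier G" "\<tau> \<in> carrier G"
  shows "gr_single c \<sigma> \<otimes>\<^bsub>group_ring G\<^esub> gr_single d \<tau> = gr_single (c * d) (\<sigma> \<otimes>\<^bsub>G\<^esub> \<tau>)"
proof
  fix \<rho>
  let ?S = "{(\<alpha>, \<beta>). gr_single c \<sigma> \<alpha> \<noteq> 0 \<and> gr_single d \<tau> \<beta> \<noteq> 0 \<and> \<alpha> \<otimes>\<^bsub>G\<^esub> \<beta> = \<rho>}"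
  have "(gr_single c \<sigma> \<otimes>\<^bsub>group_ring G\<^esub> gr_single d \<tau>) \<rho> = (\<Sum>(\<alpha>, \<beta>)\<in>?S. gr_single c \<sigma> \<alpha> * gr_single d \<tau> \<beta>)"
    by (simp add: group_ring_def)
  also have "\<dots> = (\<Sum>(\<alpha>, \<beta>)\<in>(if \<sigma> \<otimes>\<^bsub>G\<^esub> \<tau> = \<rho> then {(\<sigma>, \<tau>)} else {}). gr_single c \<sigma> \<alpha> * gr_single d \<tau> \<beta>)"
    by (rule sum.mono_neutral_left) (auto simp: gr_single_def split: if_splits)
  also have "\<dots> = gr_single (c * d) (\<sigma> \<otimes>\<^bsub>G\<^esub> \<tau>) \<rho>" by (auto simp: gr_single_def)
  finally show "(gr_single c \<sigma> \<otimes>\<^bsub>group_ring G\<^esub> gr_single d \<tau>) \<rho> = gr_single (c * d) (\<sigma> \<otimes>\<^bsub>G\<^esub> \<tau>) \<rho>" .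
qed

text \<open>Through a fixed group element \<open>s\<close>, a module over the group ring becomes a module over polynomials in
  one variable; \<open>act\<close> is this scalar multiplication.\<close>

locale group_ring_module = G: group G + module "group_ring G" V
  for G :: "('g, 'y) monoid_scheme" and V :: "('g \<Rightarrow> 'r::comm_ring_1, 'a, 'b) module_scheme" +
  fixes s :: 'g
  assumes s: "s \<in> carrier G"
begin

abbreviation RG :: "('g \<Rightarrow> 'r) ring" where "RG \<equiv> group_ring G"

definition act :: "'r poly \<Rightarrow> 'a \<Rightarrow> 'a" where "act r x = gr_poly G r s \<odot>\<^bsub>V\<^esub> x"

abbreviation t :: "'g \<Rightarrow> 'r" where "t \<equiv> gr_single 1 s"

lemma spow: "s [^]\<^bsub>G\<^esub> (i::nat) \<in> carrier G" using s by simp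

lemma single_closed: "h \<in> carrier G \<Longrightarrow> gr_single c h \<in> carrier RG" by (rule gr_single_closed)

lemma gr_poly_eq:
  assumes "Polynomial.degree r \<le> n"
  shows "gr_poly G r s = finsum RG (\<lambda>i. gr_single (poly.coeff r i) (s [^]\<^bsub>G\<^esub> i)) {..n}"
  unfolding gr_poly_def
proof (rule R.add.finprod_mono_neutral_cong_left)
  show "\<And>i. i \<in> {..n} - {..degree r} \<Longrightarrow> gr_single (poly.coeff r i) (s [^]\<^bsub>G\<^esub> i) = \<zero>\<^bsub>RG\<^esub>"
    by (auto simp: gr_single_def coeff_eq_0)
qed (use assms spow single_closed in \<open>auto simp del: group_ring_simps(1)\<close>)

lemma gr_poly_closed: "gr_poly G r s \<in> carrier RG"
  unfolding gr_poly_def by (rule R.finsum_closed) (use spow single_closed in blast)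

lemma gr_poly_0: "gr_poly G 0 s = \<zero>\<^bsub>RG\<^esub>"
  by (simp add: gr_poly_def gr_single_def)

lemma gr_poly_pCons:
  "gr_poly G (pCons a r) s = gr_single a \<one>\<^bsub>G\<^esub> \<oplus>\<^bsub>RG\<^esub> (t \<otimes>\<^bsub>RG\<^esub> gr_poly G r s)"
proof -
  define n where "n = Polynomial.degree r"
  have cl: "(\<lambda>i. gr_single (poly.coeff r i) (s [^]\<^bsub>G\<^esub> i)) \<in> {..n} \<rightarrow> carrier RG"
    using spow single_closed by blast
  have "gr_poly G (pCons a r) s =
      finsum RG (\<lambda>i. gr_single (poly.coeff (pCons a r) i) (s [^]\<^bsub>G\<^esub> i)) {..Suc n}"
    by (rule gr_poly_eq) (simp add: n_def degree_pCons_le)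
  also have "\<dots> = finsum RG (\<lambda>i. gr_single (poly.coeff (pCons a r) (Suc i)) (s [^]\<^bsub>G\<^esub> Suc i)) {..n}
      \<oplus>\<^bsub>RG\<^esub> gr_single (poly.coeff (pCons a r) 0) (s [^]\<^bsub>G\<^esub> (0::nat))"
    by (rule R.finsum_Suc2) (use spow single_closed in blast)
  also have "finsum RG (\<lambda>i. gr_single (poly.coeff (pCons a r) (Suc i)) (s [^]\<^bsub>G\<^esub> Suc i)) {..n} =
      finsum RG (\<lambda>i. t \<otimes>\<^bsub>RG\<^esub> gr_single (poly.coeff r i) (s [^]\<^bsub>G\<^esub> i)) {..n}"
  proof (rule R.finsum_cong')
    fix i
    show "gr_single (poly.coeff (pCons a r) (Suc i)) (s [^]\<^bsub>G\<^esub> Suc i) = t \<otimes>\<^bsub>RG\<^esub> gr_single (poly.coeff r i) (s [^]\<^bsub>G\<^esub> i)"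
      unfolding gr_single_mult[OF s spow] using s by (simp add: G.nat_pow_Suc2[OF s, symmetric] del: G.nat_pow_Suc)
  qed (use single_closed[OF s] single_closed[OF spow] R.m_closed in \<open>blast intro: refl\<close>)+
  also have "\<dots> = t \<otimes>\<^bsub>RG\<^esub> finsum RG (\<lambda>i. gr_single (poly.coeff r i) (s [^]\<^bsub>G\<^esub> i)) {..n}"
    by (rule R.finsum_rdistr[symmetric]) (use single_closed[OF s] cl in blast)+
  also have "finsum RG (\<lambda>i. gr_single (poly.coeff r i) (s [^]\<^bsub>G\<^esub> i)) {..n} = gr_poly G r s"
    by (rule gr_poly_eq[symmetric]) (simp add: n_def)
  finally show ?thesis
    using R.a_comm[OF R.m_closed[OF single_closed[OF s] gr_poly_closed] single_closed[OF G.one_closed]] by simp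
qed

lemma act_closed: "x \<in> carrier V \<Longrightarrow> act r x \<in> carrier V"
  unfolding act_def by (rule smult_closed[OF gr_poly_closed])

lemma act_0: "x \<in> carrier V \<Longrightarrow> act 0 x = \<zero>\<^bsub>V\<^esub>"
  unfolding act_def gr_poly_0 by (rule smult_l_null)

lemma act_pCons:
  assumes x: "x \<in> carrier V"
  shows "act (pCons a r) x = gr_single a \<one>\<^bsub>G\<^esub> \<odot>\<^bsub>V\<^esub> x \<oplus>\<^bsub>V\<^esub> t \<odot>\<^bsub>V\<^esub> act r x"
  unfolding act_def gr_poly_pCons
  by (subst smult_l_distr[OF single_closed[OF G.one_closed] R.m_closed[OF single_closed[OF s] gr_poly_closed] x],
      subst smult_assoc1[OF single_closed[OF s] gr_poly_closed x]) (rule refl)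

lemma act_add_right:
  assumes "x \<in> carrier V" "y \<in> carrier V"
  shows "act r (x \<oplus>\<^bsub>V\<^esub> y) = act r x \<oplus>\<^bsub>V\<^esub> act r y"
  unfolding act_def using assms by (rule smult_r_distr[OF gr_poly_closed])

lemma act_smult:
  assumes a: "a \<in> carrier RG" and x: "x \<in> carrier V"
  shows "act r (a \<odot>\<^bsub>V\<^esub> x) = a \<odot>\<^bsub>V\<^esub> act r x"
  unfolding act_def
  by (simp only: smult_assoc1[OF gr_poly_closed a x, symmetric] smult_assoc1[OF a gr_poly_closed x, symmetric]
      R.m_comm[OF gr_poly_closed a])

lemma act_add:
  assumes x: "x \<in> carrier V"
  shows "act (q + r) x = act q x \<oplus>\<^bsub>V\<^esub> act r x"
proof (induction q r rule: poly_induct2)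
  case 0
  then show ?case using x by (simp add: act_0)
next
  case (pCons a q b r)
  have ab: "gr_single (a + b) \<one>\<^bsub>G\<^esub> = gr_single a \<one>\<^bsub>G\<^esub> \<oplus>\<^bsub>RG\<^esub> gr_single b \<one>\<^bsub>G\<^esub>"
    by (auto simp: gr_single_def)
  note c1 = single_closed[OF G.one_closed] and cs = single_closed[OF s]
  have "act (pCons a q + pCons b r) x = gr_single (a + b) \<one>\<^bsub>G\<^esub> \<odot>\<^bsub>V\<^esub> x \<oplus>\<^bsub>V\<^esub> t \<odot>\<^bsub>V\<^esub> act (q + r) x"
    by (simp only: add_pCons act_pCons[OF x])
  also have "\<dots> = (gr_single a \<one>\<^bsub>G\<^esub> \<odot>\<^bsub>V\<^esub> x \<oplus>\<^bsub>V\<^esub> gr_single b \<one>\<^bsub>G\<^esub> \<odot>\<^bsub>V\<^esub> x) \<oplus>\<^bsub>V\<^esub> (t \<odot>\<^bsub>V\<^esub> act q x \<oplus>\<^bsub>V\<^esub> t \<odot>\<^bsub>V\<^esub> act r x)"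
    unfolding ab pCons.IH smult_l_distr[OF c1 c1 x] smult_r_distr[OF cs act_closed[OF x] act_closed[OF x]] ..
  also have "\<dots> = (gr_single a \<one>\<^bsub>G\<^esub> \<odot>\<^bsub>V\<^esub> x \<oplus>\<^bsub>V\<^esub> t \<odot>\<^bsub>V\<^esub> act q x) \<oplus>\<^bsub>V\<^esub> (gr_single b \<one>\<^bsub>G\<^esub> \<odot>\<^bsub>V\<^esub> x \<oplus>\<^bsub>V\<^esub> t \<odot>\<^bsub>V\<^esub> act r x)"
    by (simp only: M.add.m_assoc M.add.m_lcomm M.add.m_comm smult_closed[OF c1 x] smult_closed[OF cs act_closed[OF x]] M.a_closed)
  finally show ?case by (simp only: act_pCons[OF x])
qed

lemma act_const: "x \<in> carrier V \<Longrightarrow> act [:a:] x = gr_single a \<one>\<^bsub>G\<^esub> \<odot>\<^bsub>V\<^esub> x"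
  using act_pCons[of x a 0] smult_closed[OF single_closed[OF G.one_closed]] single_closed[OF s]
  by (simp add: act_0 del: group_ring_simps(1))

lemma act_const_mult:
  assumes x: "x \<in> carrier V"
  shows "act [:a * b:] x = act [:a:] (act [:b:] x)"
proof -
  note c1 = single_closed[OF G.one_closed]
  have "gr_single (a * b) \<one>\<^bsub>G\<^esub> = gr_single a \<one>\<^bsub>G\<^esub> \<otimes>\<^bsub>RG\<^esub> gr_single b \<one>\<^bsub>G\<^esub>"
    by (simp only: gr_single_mult[OF G.one_closed G.one_closed] G.l_one[OF G.one_closed])
  then show ?thesis
    by (simp only: act_const[OF x] act_const[OF smult_closed[OF c1 x]] smult_assoc1[OF c1 c1 x])
qed

lemma act_pCons': "x \<in> carrier V \<Longrightarrow> act (pCons a r) x = act [:a:] x \<oplus>\<^bsub>V\<^esub> t \<odot>\<^bsub>V\<^esub> act r x"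
  by (simp only: act_pCons[of x a r] act_const[of x a])

lemma act_mult:
  assumes x: "x \<in> carrier V"
  shows "act (q * r) x = act q (act r x)"
proof -
  note cs = single_closed[OF s]
  have sm: "act (Polynomial.smult a r) x = act [:a:] (act r x)" for a r
  proof (induction r)
    case 0
    then show ?case using x act_const[OF M.zero_closed, of a] smult_r_null[OF single_closed[OF G.one_closed]]
      by (simp add: act_0)
  next
    case (pCons b r)
    have "act (Polynomial.smult a (pCons b r)) x = act [:a * b:] x \<oplus>\<^bsub>V\<^esub> t \<odot>\<^bsub>V\<^esub> act (Polynomial.smult a r) x"
      by (simp only: smult_pCons act_pCons'[OF x, of "a * b" "Polynomial.smult a r"])
    also have "\<dots> = act [:a:] (act [:b:] x) \<oplus>\<^bsub>V\<^esub> t \<odot>\<^bsub>V\<^esub> act [:a:] (act r x)"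
      unfolding act_const_mult[OF x] pCons.IH ..
    also have "\<dots> = act [:a:] (act [:b:] x \<oplus>\<^bsub>V\<^esub> t \<odot>\<^bsub>V\<^esub> act r x)"
      by (simp only: act_add_right[OF act_closed[OF x] smult_closed[OF cs act_closed[OF x]]]
          act_smult[OF cs act_closed[OF x]])
    finally show ?case by (simp only: act_pCons'[OF x, of b r])
  qed
  show ?thesis
  proof (induction q)
    case 0
    then show ?case using x by (simp add: act_0 act_closed)
  next
    case (pCons a q)
    have "act (pCons a q * r) x = act (Polynomial.smult a r) x \<oplus>\<^bsub>V\<^esub> act (pCons 0 (q * r)) x"
      by (simp only: mult_pCons_left act_add[OF x])
    also have "act (pCons 0 (q * r)) x = t \<odot>\<^bsub>V\<^esub> act (q * r) x"
    proof -
      have "act [:0:] x = \<zero>\<^bsub>V\<^esub>" using act_0[OF x] by simp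
      then show ?thesis unfolding act_pCons'[OF x, of 0 "q * r"] by (simp only: M.l_zero[OF smult_closed[OF cs act_closed[OF x]]])
    qed
    finally show ?case by (simp only: sm pCons.IH act_pCons'[OF act_closed[OF x], of a q])
  qed
qed

lemma act_1: "x \<in> carrier V \<Longrightarrow> act 1 x = x"
  using act_const[of x 1] smult_one[of x] by (simp add: one_pCons)

lemma act_zero_right: "act r \<zero>\<^bsub>V\<^esub> = \<zero>\<^bsub>V\<^esub>"
  unfolding act_def by (rule smult_r_null[OF gr_poly_closed])

lemma act_diff_eq:
  assumes x: "x \<in> carrier V" and "act (q - r) x = \<zero>\<^bsub>V\<^esub>"
  shows "act q x = act r x"
proof -
  have "act q x = act ((q - r) + r) x" by simp
  also have "\<dots> = act r x" unfolding act_add[OF x] assms(2) by (rule M.l_zero[OF act_closed[OF x]])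
  finally show ?thesis .
qed

lemma act_monom:
  assumes x: "x \<in> carrier V"
  shows "act (Polynomial.monom 1 i) x = gr_single 1 (s [^]\<^bsub>G\<^esub> i) \<odot>\<^bsub>V\<^esub> x"
proof (induction i)
  case 0
  then show ?case using act_const[OF x, of 1] by (simp add: monom_0)
next
  case (Suc i)
  have "gr_single 1 (s [^]\<^bsub>G\<^esub> Suc i) = t \<otimes>\<^bsub>RG\<^esub> gr_single 1 (s [^]\<^bsub>G\<^esub> i)"
    unfolding gr_single_mult[OF s spow] by (simp only: G.nat_pow_Suc2[OF s] mult_1)
  moreover have "act (Polynomial.monom 1 (Suc i)) x = t \<odot>\<^bsub>V\<^esub> act (Polynomial.monom 1 i) x"
  proof -
    have "act [:0:] x = \<zero>\<^bsub>V\<^esub>" using act_0[OF x] by simp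
    then show ?thesis
      unfolding monom_Suc act_pCons'[OF x, of 0 "Polynomial.monom 1 i"] by (simp only: M.l_zero[OF smult_closed[OF single_closed[OF s] act_closed[OF x]]])
  qed
  ultimately show ?case unfolding Suc.IH by (simp only: smult_assoc1[OF single_closed[OF s] single_closed[OF spow] x])
qed

lemma act_sum:
  assumes x: "x \<in> carrier V" and A: "finite A"
  shows "act (\<Sum>i\<in>A. f i) x = finsum V (\<lambda>i. act (f i) x) A"
  using A
proof (induction A rule: finite_induct)
  case (insert i A)
  have "(\<lambda>i. act (f i) x) \<in> A \<rightarrow> carrier V" using act_closed[OF x] by blast
  then show ?case using insert act_closed[OF x] by (simp add: act_add[OF x])
qed (use x act_0 in simp)

lemma act_finsum:
  assumes A: "finite A" "f \<in> A \<rightarrow> carrier V"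
  shows "act r (finsum V f A) = finsum V (\<lambda>i. act r (f i)) A"
  using A
proof (induction A rule: finite_induct)
  case (insert i A)
  have c: "(\<lambda>i. act r (f i)) \<in> A \<rightarrow> carrier V" "act r (f i) \<in> carrier V" using act_closed insert.prems by auto
  then show ?case using insert by (simp add: act_add_right[OF _ M.finsum_closed])
qed (simp add: act_zero_right)

end

lemma module_hom_zero:
  assumes "module RR A" "module RR B" "f \<in> module_hom RR A B"
  shows "f \<zero>\<^bsub>A\<^esub> = \<zero>\<^bsub>B\<^esub>" "x \<in> carrier A \<Longrightarrow> f (\<ominus>\<^bsub>A\<^esub> x) = \<ominus>\<^bsub>B\<^esub> f x"
proof -
  interpret A: module RR A by fact
  interpret B: module RR B by fact
  have f: "x \<in> carrier A \<Longrightarrow> f x \<in> carrier B"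
    "x \<in> carrier A \<Longrightarrow> y \<in> carrier A \<Longrightarrow> f (x \<oplus>\<^bsub>A\<^esub> y) = f x \<oplus>\<^bsub>B\<^esub> f y" for x y
    using assms(3) by (auto simp: module_hom_def)
  have "f \<zero>\<^bsub>A\<^esub> \<oplus>\<^bsub>B\<^esub> f \<zero>\<^bsub>A\<^esub> = f \<zero>\<^bsub>A\<^esub>"
    using f(2)[OF A.M.zero_closed A.M.zero_closed] by simp
  then show z: "f \<zero>\<^bsub>A\<^esub> = \<zero>\<^bsub>B\<^esub>" using f(1)[OF A.M.zero_closed] by simp
  show "f (\<ominus>\<^bsub>A\<^esub> x) = \<ominus>\<^bsub>B\<^esub> f x" if x: "x \<in> carrier A"
  proof (rule B.M.minus_equality[symmetric])
    show "f (\<ominus>\<^bsub>A\<^esub> x) \<oplus>\<^bsub>B\<^esub> f x = \<zero>\<^bsub>B\<^esub>"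
      using f(2)[OF A.M.a_inv_closed[OF x] x] z x by (simp add: A.M.l_neg)
  qed (use f x in simp_all)
qed

section \<open>Conjugate characters\<close>

abbreviation value_field where
  "value_field F \<psi> \<equiv> generate_field type_ring (F \<union> \<psi> ` carrier \<G>)"

text \<open>An automorphism of the field of values is multiplicative and injective, so conjugate characters are
  multiplicative and have the same kernel.\<close>

lemma conjugatesD:
  assumes F: "field_set F" and psi: "\<psi> \<in> characters" and c: "\<psi>' \<in> conjugates F \<psi>"
  shows "\<psi>' \<in> extensional (carrier \<G>)"
    "\<sigma> \<in> carrier \<G> \<Longrightarrow> \<tau> \<in> carrier \<G> \<Longrightarrow> \<psi>' (\<sigma> \<otimes>\<^bsub>\<G>\<^esub> \<tau>) = \<psi>' \<sigma> * \<psi>' \<tau>"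
    "\<sigma> \<in> carrier \<G> \<Longrightarrow> \<psi>' \<sigma> = 1 \<longleftrightarrow> \<psi> \<sigma> = 1"
proof -
  interpret group \<G> by (rule group_GalQab)
  have L: "field_set (value_field F \<psi>)" by (rule field_set_generate)
  obtain \<rho> where r: "\<rho> \<in> carrier (gal_group (value_field F \<psi>) F)" "\<psi>' = restrict (\<rho> \<circ> \<psi>) (carrier \<G>)"
    using c unfolding conjugates_def by (rule imageE)
  note D = gal_groupD[OF L r(1)] and R = field_setD(1)[OF L]
  have val: "\<psi> \<sigma> \<in> value_field F \<psi>" if "\<sigma> \<in> carrier \<G>" for \<sigma>
    using that by (intro generate_field.incl UnI2 imageI)
  show "\<psi>' \<in> extensional (carrier \<G>)" by (simp add: r(2))
  show "\<psi>' (\<sigma> \<otimes>\<^bsub>\<G>\<^esub> \<tau>) = \<psi>' \<sigma> * \<psi>' \<tau>" if "\<sigma> \<in> carrier \<G>" "\<tau> \<in> carrier \<G>" for \<sigma> \<tau>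
  proof -
    have "\<psi>' (\<sigma> \<otimes>\<^bsub>\<G>\<^esub> \<tau>) = \<rho> (\<psi> \<sigma> * \<psi> \<tau>)"
      unfolding r(2) using that by (simp add: characterD(1)[OF psi that])
    then show ?thesis using that by (simp add: ring_embD(3)[OF D(3) R val[OF that(1)] val[OF that(2)]] r(2))
  qed
  show "\<psi>' \<sigma> = 1 \<longleftrightarrow> \<psi> \<sigma> = 1" if "\<sigma> \<in> carrier \<G>"
  proof -
    have "\<rho> (\<psi> \<sigma>) = \<rho> 1 \<longleftrightarrow> \<psi> \<sigma> = 1"
      by (rule inj_on_eq_iff[OF ring_emb_inj[OF D(3) L] val[OF that] ring_setD(1)[OF R]])
    then show ?thesis using that by (simp add: ring_embD(1)[OF D(3) R] r(2))
  qed
qed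

lemma conjugates_refl:
  assumes F: "field_set F" and psi: "\<psi> \<in> characters"
  shows "\<psi> \<in> conjugates F \<psi>"
proof -
  have L: "field_set (value_field F \<psi>)" by (rule field_set_generate)
  have sub: "F \<subseteq> value_field F \<psi>" by (intro subsetI generate_field.incl UnI1)
  interpret G: group "gal_group (value_field F \<psi>) F" by (rule group_gal_group[OF L sub])
  let ?e = "\<one>\<^bsub>gal_group (value_field F \<psi>) F\<^esub>"
  have "restrict (?e \<circ> \<psi>) (carrier \<G>) = \<psi>"
  proof (rule extensionalityI[of _ "carrier \<G>"])
    fix \<sigma> assume "\<sigma> \<in> carrier \<G>"
    then show "restrict (?e \<circ> \<psi>) (carrier \<G>) \<sigma> = \<psi> \<sigma>"
      using gal_group_apply(4)[OF L sub G.one_closed generate_field.incl[OF UnI2[OF imageI]], of \<sigma>] by simp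
  qed (use characterD(2)[OF psi] in simp_all)
  then show ?thesis unfolding conjugates_def by (intro image_eqI[OF _ G.one_closed]) (rule sym)
qed

lemma finite_conjugates:
  fixes \<psi> :: "qab_aut \<Rightarrow> 'p::prime_card padic_closure"
  assumes F: "field_set F" and psi: "\<psi> \<in> characters"
  shows "finite (conjugates F \<psi>)"
proof -
  obtain n where n: "n > 0" "\<And>\<sigma>. \<sigma> \<in> carrier \<G> \<Longrightarrow> \<psi> \<sigma> ^ n = 1"
    using psi unfolding characters_def by blast
  define U where "U = {w. poly (monom 1 n - 1) w = (0 :: 'p padic_closure)}"
  have "coeff (monom 1 n - 1 :: 'p padic_closure poly) n = 1" using n(1) by simp
  then have "monom 1 n - 1 \<noteq> (0 :: 'p padic_closure poly)" by (metis coeff_0 zero_neq_one)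
  then have finU: "finite U" unfolding U_def by (rule poly_roots_finite)
  have L: "field_set (value_field F \<psi>)" by (rule field_set_generate)
  note R = field_setD(1)[OF L]
  have im: "\<psi> ` carrier \<G> \<subseteq> U" using n(2) by (auto simp: U_def poly_monom)
  have finI: "finite (\<psi> ` carrier \<G>)" by (rule finite_subset[OF im finU])
  have "conjugates F \<psi> \<subseteq> (\<lambda>f. restrict (f \<circ> \<psi>) (carrier \<G>)) ` (\<psi> ` carrier \<G> \<rightarrow>\<^sub>E U)"
  proof
    fix \<psi>' assume "\<psi>' \<in> conjugates F \<psi>"
    then obtain \<rho> where r: "\<rho> \<in> carrier (gal_group (value_field F \<psi>) F)" "\<psi>' = restrict (\<rho> \<circ> \<psi>) (carrier \<G>)"
      unfolding conjugates_def by (rule imageE)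
    note D = gal_groupD[OF L r(1)]
    have "\<rho> (\<psi> \<sigma>) ^ n = 1" if "\<sigma> \<in> carrier \<G>" for \<sigma>
    proof -
      have "\<psi> \<sigma> \<in> value_field F \<psi>" using that by (intro generate_field.incl UnI2 imageI)
      then have "\<rho> (\<psi> \<sigma>) ^ n = \<rho> (\<psi> \<sigma> ^ n)" using ring_embD(7)[OF D(3) R] by simp
      then show ?thesis using n(2)[OF that] ring_embD(1)[OF D(3) R] by simp
    qed
    then have "restrict \<rho> (\<psi> ` carrier \<G>) \<in> \<psi> ` carrier \<G> \<rightarrow>\<^sub>E U" by (auto simp: U_def poly_monom)
    moreover have "\<psi>' = restrict (restrict \<rho> (\<psi> ` carrier \<G>) \<circ> \<psi>) (carrier \<G>)"
      unfolding r(2) by (auto simp: restrict_def fun_eq_iff)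
    ultimately show "\<psi>' \<in> (\<lambda>f. restrict (f \<circ> \<psi>) (carrier \<G>)) ` (\<psi> ` carrier \<G> \<rightarrow>\<^sub>E U)"
      by (intro image_eqI)
  qed
  then show ?thesis by (rule finite_subset) (intro finite_imageI finite_PiE finI finU)
qed

text \<open>Conjugates of a character are multiplicative functions, so they can be recovered from their sum.\<close>

lemma terms_of_conjugate_sum:
  assumes F: "field_set F" and psi: "\<psi> \<in> characters"
  shows "terms_of F (conjugate_sum F \<psi>) = conjugates F \<psi>"
proof -
  interpret group \<G> by (rule group_GalQab)
  have same: "conjugates F \<psi>' = conjugates F \<psi>"
    if psi': "\<psi>' \<in> characters" and eq: "conjugate_sum F \<psi> = conjugate_sum F \<psi>'" for \<psi>'
  proof (rule multiplicative_sums_eq[where D = "carrier \<G>" and mlt = "monoid.mult \<G>"])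
    show "finite (conjugates F \<psi>')" "finite (conjugates F \<psi>)"
      by (rule finite_conjugates[OF F psi'], rule finite_conjugates[OF F psi])
    show "conjugates F \<psi>' \<subseteq> extensional (carrier \<G>)" "conjugates F \<psi> \<subseteq> extensional (carrier \<G>)"
      by (rule subsetI, erule conjugatesD(1)[OF F psi'], rule subsetI, erule conjugatesD(1)[OF F psi])
    show "\<sigma> \<otimes>\<^bsub>\<G>\<^esub> \<tau> \<in> carrier \<G>" if "\<sigma> \<in> carrier \<G>" "\<tau> \<in> carrier \<G>" for \<sigma> \<tau>
      using that by (rule m_closed)
    show "(\<Sum>f\<in>conjugates F \<psi>'. f \<sigma>) = (\<Sum>f\<in>conjugates F \<psi>. f \<sigma>)" if "\<sigma> \<in> carrier \<G>" for \<sigma>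
      using fun_cong[OF eq, of \<sigma>] that by (simp add: conjugate_sum_def)
  next
    fix f \<sigma> \<tau>
    assume f: "f \<in> conjugates F \<psi>' \<union> conjugates F \<psi>" and st: "\<sigma> \<in> carrier \<G>" "\<tau> \<in> carrier \<G>"
    show "f (\<sigma> \<otimes>\<^bsub>\<G>\<^esub> \<tau>) = f \<sigma> * f \<tau>"
      using f by (rule UnE) (erule conjugatesD(2)[OF F psi' _ st], erule conjugatesD(2)[OF F psi _ st])
  next
    fix f assume f: "f \<in> conjugates F \<psi>' \<union> conjugates F \<psi>"
    have "f \<one>\<^bsub>\<G>\<^esub> = 1"
      using f by (rule UnE) (simp_all add: conjugatesD(3)[OF F psi' _ one_closed] conjugatesD(3)[OF F psi _ one_closed]
        characterD(4)[OF psi] characterD(4)[OF psi'])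
    then show "\<exists>x\<in>carrier \<G>. f x \<noteq> 0" by (intro bexI[OF _ one_closed]) simp
  qed
  show ?thesis
  proof (intro equalityI subsetI)
    fix f assume "f \<in> terms_of F (conjugate_sum F \<psi>)"
    then obtain \<psi>' where "\<psi>' \<in> characters" "conjugate_sum F \<psi> = conjugate_sum F \<psi>'" "f \<in> conjugates F \<psi>'"
      unfolding terms_of_def by blast
    then show "f \<in> conjugates F \<psi>" using same[of \<psi>'] by simp
  next
    fix f assume "f \<in> conjugates F \<psi>"
    then show "f \<in> terms_of F (conjugate_sum F \<psi>)" unfolding terms_of_def using psi by blast
  qed
qed

section \<open>The characters of a cyclic Galois group\<close>

text \<open>Let \<open>K\<close> be the field of \<open>\<psi>\<close>. The characters of its cyclic Galois group correspond to the \<open>g\<close>-th roots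
  of unity \<open>w\<close> through their value at the generator \<open>\<sigma>\<close>, and \<open>\<psi>\<close> itself to \<open>z\<close>, which is primitive as \<open>\<psi>\<close>
  is faithful on this group. Galois conjugation of characters becomes that of roots of unity.\<close>

locale cyclic_character =
  fixes \<psi> :: "qab_aut \<Rightarrow> 'p::prime_card padic_closure" and \<sigma> :: "complex \<Rightarrow> complex"
  assumes psi: "\<psi> \<in> characters"
    and sigma: "\<sigma> \<in> carrier (gal_group (kernel_field \<psi>) \<rat>)"
    and generator: "generate (gal_group (kernel_field \<psi>) \<rat>) {\<sigma>} = carrier (gal_group (kernel_field \<psi>) \<rat>)"
begin

definition K :: "complex set" where "K = kernel_field \<psi>"

abbreviation GK :: "(complex \<Rightarrow> complex) monoid" where "GK \<equiv> gal_group K \<rat>"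

definition s :: qab_aut where "s = lift_aut K \<sigma>"

definition g :: nat where "g = group.ord GK \<sigma>"

definition z :: "'p padic_closure" where "z = \<psi> s"

lemma K: "field_set K" "K \<subseteq> Qab" "\<rat> \<subseteq> K" "K \<in> \<K>"
  using field_set_kernel_field kernel_field_subset Rats_subset_field_set[OF field_set_kernel_field]
    kernel_field_in_KK[OF psi] by (simp_all add: K_def)

sublocale G: group \<G> by (rule group_GalQab)
sublocale GK: group GK by (rule group_gal_group[OF K(1,3)])

lemma sigma_K: "\<sigma> \<in> carrier GK" "generate GK {\<sigma>} = carrier GK"
  using sigma generator by (simp_all add: K_def)

lemma finite_GK: "finite (carrier GK)"
proof -
  have "carrier GK \<subseteq> {h. h \<in> extensional K \<and> ring_emb K h}" using gal_groupD(1,3)[OF K(1)] by blast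
  then show ?thesis using finite_embeddings[OF K(4)] finite_subset by blast
qed

lemma g_pos: "g > 0"
  unfolding g_def using GK.ord_ge_1[OF finite_GK sigma_K(1)] by simp

lemma sigma_pow_eq_one: "\<sigma> [^]\<^bsub>GK\<^esub> i = \<one>\<^bsub>GK\<^esub> \<longleftrightarrow> g dvd i" for i :: nat
  unfolding g_def by (rule GK.pow_eq_id[OF sigma_K(1)])

lemma GK_elem:
  assumes "\<rho> \<in> carrier GK"
  obtains i :: nat where "i < g" "\<rho> = \<sigma> [^]\<^bsub>GK\<^esub> i"
proof -
  obtain k :: int where k: "\<rho> = \<sigma> [^]\<^bsub>GK\<^esub> k"
    using assms GK.generate_pow[OF sigma_K(1)] sigma_K(2) by auto
  define i where "i = nat (k mod int g)"
  have "\<sigma> [^]\<^bsub>GK\<^esub> (int g * (k div int g) + int i) =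
      (\<sigma> [^]\<^bsub>GK\<^esub> int g) [^]\<^bsub>GK\<^esub> (k div int g) \<otimes>\<^bsub>GK\<^esub> \<sigma> [^]\<^bsub>GK\<^esub> int i"
    by (simp only: GK.int_pow_mult[OF sigma_K(1)] GK.int_pow_pow[OF sigma_K(1)])
  moreover have "int g * (k div int g) + int i = k" using g_pos by (simp add: i_def)
  moreover have "\<sigma> [^]\<^bsub>GK\<^esub> int g = \<one>\<^bsub>GK\<^esub>" using sigma_pow_eq_one[of g] by (simp add: int_pow_int)
  ultimately have "\<rho> = \<sigma> [^]\<^bsub>GK\<^esub> i" using k sigma_K(1) by (simp add: int_pow_int)
  moreover have "i < g" using g_pos by (simp add: i_def nat_less_iff)
  ultimately show ?thesis using that by blast
qed

lemma s: "s \<in> carrier \<G>" "restrict s K = \<sigma>"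
  unfolding s_def using lift_aut[OF psi sigma] by (simp_all add: K_def)

lemma s_pow: "s [^]\<^bsub>\<G>\<^esub> i \<in> carrier \<G>" for i :: nat using s(1) by simp

lemma s_pow_apply: "x \<in> K \<Longrightarrow> (s [^]\<^bsub>\<G>\<^esub> i) x = (\<sigma> [^]\<^bsub>GK\<^esub> i) x" for i :: nat
proof (induction i arbitrary: x)
  case 0
  then show ?case using GalQabD(7)[OF s(1)] K(2) gal_group_apply(4)[OF K(1,3) sigma_K(1)] by auto
next
  case (Suc i)
  have xQ: "x \<in> Qab" using Suc.prems K(2) by blast
  have sx: "s x = \<sigma> x" using fun_cong[OF s(2), of x] Suc.prems by simp
  have "(s [^]\<^bsub>\<G>\<^esub> Suc i) x = (s [^]\<^bsub>\<G>\<^esub> i) (s x)"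
    using GalQab_mult_closed(2)[OF s_pow s(1) xQ] by simp
  also have "\<dots> = (\<sigma> [^]\<^bsub>GK\<^esub> i) (\<sigma> x)"
    unfolding sx by (rule Suc.IH[OF gal_groupD(5)[OF K(1) sigma_K(1) Suc.prems]])
  also have "\<dots> = (\<sigma> [^]\<^bsub>GK\<^esub> Suc i) x"
    using gal_group_apply(1)[OF K(1,3) GK.nat_pow_closed[OF sigma_K(1)] Suc.prems sigma_K(1)] by simp
  finally show ?case .
qed

lemma restrict_GK: "\<rho> \<in> carrier \<G> \<Longrightarrow> restrict \<rho> K \<in> carrier GK"
  unfolding K_def by (rule restrict_kernel_field[OF psi])

lemma GK_eqI: "\<rho> \<in> carrier GK \<Longrightarrow> \<rho>' \<in> carrier GK \<Longrightarrow> (\<And>x. x \<in> K \<Longrightarrow> \<rho> x = \<rho>' x) \<Longrightarrow> \<rho> = \<rho>'"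
  using gal_groupD(1)[OF K(1)] by (intro extensionalityI[of _ K]) auto

lemma power_on_K:
  assumes "\<rho> \<in> carrier \<G>"
  shows "\<exists>i::nat. \<forall>x\<in>K. \<rho> x = (s [^]\<^bsub>\<G>\<^esub> i) x"
proof -
  obtain i where i: "i < g" "restrict \<rho> K = \<sigma> [^]\<^bsub>GK\<^esub> i" using GK_elem[OF restrict_GK[OF assms]] by blast
  have "\<rho> x = (s [^]\<^bsub>\<G>\<^esub> i) x" if "x \<in> K" for x
    using s_pow_apply[OF that, of i] fun_cong[OF i(2), of x] that by simp
  then show ?thesis by blast
qed

text \<open>The two automorphisms differ by an element of Gal(Qab/K).\<close>

lemma agree_on_K:
  assumes r: "\<rho> \<in> carrier \<G>" "\<rho>' \<in> carrier \<G>" "\<And>x. x \<in> K \<Longrightarrow> \<rho> x = \<rho>' x"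
  obtains \<tau> where "\<tau> \<in> carrier (gal_group Qab K)" "\<tau> \<in> carrier \<G>" "\<rho> = \<rho>' \<otimes>\<^bsub>\<G>\<^esub> \<tau>"
proof -
  define \<tau> where "\<tau> = inv\<^bsub>\<G>\<^esub> \<rho>' \<otimes>\<^bsub>\<G>\<^esub> \<rho>"
  have t: "\<tau> \<in> carrier \<G>" using r by (simp add: \<tau>_def)
  have "\<tau> x = x" if x: "x \<in> K" for x
  proof -
    have xQ: "x \<in> Qab" using x K(2) by blast
    have "\<tau> x = (inv\<^bsub>\<G>\<^esub> \<rho>') (\<rho>' x)"
      unfolding \<tau>_def using GalQab_mult_closed(2)[OF G.inv_closed[OF r(2)] r(1) xQ] r(3)[OF x] by simp
    then show ?thesis using GalQabD(5)[OF r(2) xQ] by simp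
  qed
  then have "\<tau> \<in> carrier (gal_group Qab K)"
    using t by (auto simp: GalQab_def gal_group_iff[OF field_set_Qab])
  moreover have "\<rho> = \<rho>' \<otimes>\<^bsub>\<G>\<^esub> \<tau>" using r by (simp add: \<tau>_def G.m_assoc[symmetric])
  ultimately show ?thesis using that t by blast
qed

lemma psi_agree:
  assumes r: "\<rho> \<in> carrier \<G>" "\<rho>' \<in> carrier \<G>" "\<And>x. x \<in> K \<Longrightarrow> \<rho> x = \<rho>' x"
  shows "\<psi> \<rho> = \<psi> \<rho>'"
proof -
  obtain \<tau> where t: "\<tau> \<in> carrier (gal_group Qab K)" "\<tau> \<in> carrier \<G>" "\<rho> = \<rho>' \<otimes>\<^bsub>\<G>\<^esub> \<tau>"
    using agree_on_K[OF r] by blast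
  have "\<psi> \<tau> = 1"
    using kernel_of_character[OF psi t(2)] gal_groupD(4)[OF field_set_Qab t(1)] by (simp add: K_def)
  then show ?thesis using t characterD(1)[OF psi r(2) t(2)] by simp
qed

lemma prim_root_z: "prim_root g z"
  unfolding prim_root_def
proof (intro conjI allI g_pos)
  fix i
  have "z ^ i = \<psi> (s [^]\<^bsub>\<G>\<^esub> i)" unfolding z_def by (rule characterD(6)[OF psi s(1), symmetric])
  then have "z ^ i = 1 \<longleftrightarrow> (\<forall>x\<in>K. (s [^]\<^bsub>\<G>\<^esub> i) x = x)"
    using kernel_of_character[OF psi s_pow] by (simp add: K_def)
  also have "\<dots> \<longleftrightarrow> \<sigma> [^]\<^bsub>GK\<^esub> i = \<one>\<^bsub>GK\<^esub>"
  proof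
    assume *: "\<forall>x\<in>K. (s [^]\<^bsub>\<G>\<^esub> i) x = x"
    show "\<sigma> [^]\<^bsub>GK\<^esub> i = \<one>\<^bsub>GK\<^esub>"
    proof (rule GK_eqI)
      fix x assume x: "x \<in> K"
      show "(\<sigma> [^]\<^bsub>GK\<^esub> i) x = \<one>\<^bsub>GK\<^esub> x"
        using bspec[OF * x] unfolding s_pow_apply[OF x] gal_group_apply(4)[OF K(1,3) sigma_K(1) x] .
    qed (use sigma_K(1) in simp_all)
  next
    assume *: "\<sigma> [^]\<^bsub>GK\<^esub> i = \<one>\<^bsub>GK\<^esub>"
    show "\<forall>x\<in>K. (s [^]\<^bsub>\<G>\<^esub> i) x = x"
      by (intro ballI) (simp only: s_pow_apply * gal_group_apply(4)[OF K(1,3) sigma_K(1)])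
  qed
  finally show "z ^ i = 1 \<longleftrightarrow> g dvd i" by (simp only: sigma_pow_eq_one)
qed

text \<open>An exponent is determined only modulo \<open>g\<close>, so it is chosen.\<close>

definition exponent_of :: "qab_aut \<Rightarrow> nat" where
  "exponent_of \<rho> = (SOME i. \<forall>x\<in>K. \<rho> x = (s [^]\<^bsub>\<G>\<^esub> i) x)"

text \<open>The character of \<open>\<G>\<close> that factors through the Galois group of \<open>K\<close> and has the value \<open>w\<close> at \<open>\<sigma>\<close>.\<close>

definition char_of :: "'p padic_closure \<Rightarrow> qab_aut \<Rightarrow> 'p padic_closure" where
  "char_of w = (\<lambda>\<rho>\<in>carrier \<G>. w ^ exponent_of \<rho>)"

lemma char_of:
  assumes w: "w ^ g = 1" and r: "\<rho> \<in> carrier \<G>" "\<And>x. x \<in> K \<Longrightarrow> \<rho> x = (s [^]\<^bsub>\<G>\<^esub> i) x"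
  shows "char_of w \<rho> = w ^ i"
proof -
  define j where "j = exponent_of \<rho>"
  have j: "\<forall>x\<in>K. \<rho> x = (s [^]\<^bsub>\<G>\<^esub> j) x"
    unfolding j_def exponent_of_def by (rule someI) (use r in blast)
  have "\<psi> \<rho> = z ^ i" "\<psi> \<rho> = z ^ j"
    using psi_agree[OF r(1) s_pow r(2)] psi_agree[OF r(1) s_pow, of j] j characterD(6)[OF psi s(1)] by (simp_all add: z_def)
  then have "z ^ i = z ^ j" by simp
  moreover obtain a where "w = z ^ a" using root_of_unity_power[OF prim_root_z w] by blast
  ultimately have "w ^ i = w ^ j" by (metis power_mult mult.commute)
  then show ?thesis using r(1) by (simp add: char_of_def j_def)
qed

lemma char_of_s: "w ^ g = 1 \<Longrightarrow> char_of w s = w"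
  using char_of[of w s 1] s(1) by simp

lemma psi_eq: "\<psi> = char_of z"
proof (rule extensionalityI[of _ "carrier \<G>"])
  fix \<rho> assume r: "\<rho> \<in> carrier \<G>"
  obtain i :: nat where "\<forall>x\<in>K. \<rho> x = (s [^]\<^bsub>\<G>\<^esub> i) x" using power_on_K[OF r] by blast
    then have i: "\<And>x. x \<in> K \<Longrightarrow> \<rho> x = (s [^]\<^bsub>\<G>\<^esub> i) x" by (rule bspec)
  have "\<psi> \<rho> = z ^ i"
    using psi_agree[OF r s_pow i] characterD(6)[OF psi s(1)] by (simp add: z_def)
  then show "\<psi> \<rho> = char_of z \<rho>" using char_of[OF prim_rootD(3)[OF prim_root_z] r i] by simp
qed (use characterD(2)[OF psi] in \<open>auto simp: char_of_def\<close>)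

lemma char_of_character:
  assumes "w ^ g = 1"
  shows "char_of w \<in> characters"
proof -
  have "char_of w (\<rho> \<otimes>\<^bsub>\<G>\<^esub> \<rho>') = char_of w \<rho> * char_of w \<rho>'"
    if r: "\<rho> \<in> carrier \<G>" "\<rho>' \<in> carrier \<G>" for \<rho> \<rho>'
  proof -
    obtain i :: nat where "\<forall>x\<in>K. \<rho> x = (s [^]\<^bsub>\<G>\<^esub> i) x" using power_on_K[OF r(1)] by blast
    then have i: "\<And>x. x \<in> K \<Longrightarrow> \<rho> x = (s [^]\<^bsub>\<G>\<^esub> i) x" by (rule bspec)
    obtain j :: nat where "\<forall>x\<in>K. \<rho>' x = (s [^]\<^bsub>\<G>\<^esub> j) x" using power_on_K[OF r(2)] by blast
    then have j: "\<And>x. x \<in> K \<Longrightarrow> \<rho>' x = (s [^]\<^bsub>\<G>\<^esub> j) x" by (rule bspec)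
    have "(\<rho> \<otimes>\<^bsub>\<G>\<^esub> \<rho>') x = (s [^]\<^bsub>\<G>\<^esub> (i + j)) x" if x: "x \<in> K" for x
    proof -
      have xQ: "x \<in> Qab" using x K(2) by blast
      have "(\<rho> \<otimes>\<^bsub>\<G>\<^esub> \<rho>') x = \<rho> (\<rho>' x)" by (rule GalQab_mult_closed(2)[OF r xQ])
      also have "\<dots> = (s [^]\<^bsub>\<G>\<^esub> i) (\<rho>' x)"
        by (rule i) (use kernel_field_stable[OF psi r(2)] x in \<open>simp add: K_def\<close>)
      also have "\<dots> = (s [^]\<^bsub>\<G>\<^esub> i \<otimes>\<^bsub>\<G>\<^esub> s [^]\<^bsub>\<G>\<^esub> j) x"
        unfolding j[OF x] by (rule GalQab_mult_closed(2)[OF s_pow s_pow xQ, symmetric])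
      finally show ?thesis using G.nat_pow_mult[OF s(1)] by simp
    qed
    then have "char_of w (\<rho> \<otimes>\<^bsub>\<G>\<^esub> \<rho>') = w ^ (i + j)" by (intro char_of[OF assms]) (use r in simp_all)
    then show ?thesis using char_of[OF assms r(1) i] char_of[OF assms r(2) j] by (simp add: power_add)
  qed
  note mult = this
  have pow: "char_of w \<rho> ^ g = 1" if "\<rho> \<in> carrier \<G>" for \<rho>
  proof -
    have "(w ^ exponent_of \<rho>) ^ g = (w ^ g) ^ exponent_of \<rho>" by (simp only: power_mult[symmetric] mult.commute)
    then show ?thesis using that by (simp add: char_of_def assms)
  qed
  have unit: "char_of w \<rho> \<in> Units type_ring" if "\<rho> \<in> carrier \<G>" for \<rho>
  proof -
    have "char_of w \<rho> \<noteq> 0" using pow[OF that] g_pos by (metis power_0_left zero_neq_one less_numeral_extra(3))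
    then have "inverse (char_of w \<rho>) * char_of w \<rho> = 1 \<and> char_of w \<rho> * inverse (char_of w \<rho>) = 1" by simp
    then show ?thesis by (auto simp: Units_def)
  qed
  have triv: "char_of w \<rho> = 1" if r: "\<rho> \<in> carrier (gal_group Qab K)" for \<rho>
  proof -
    have "\<rho> x = (s [^]\<^bsub>\<G>\<^esub> (0::nat)) x" if "x \<in> K" for x
      using gal_groupD(4)[OF field_set_Qab r that] GalQabD(7)[OF s(1)] subsetD[OF K(2) that] by simp
    from char_of[OF assms subsetD[OF gal_group_Qab_subset[OF K(1)] r] this] show ?thesis by simp
  qed
  show ?thesis
    unfolding characters_def
  proof (intro CollectI conjI)
    show "char_of w \<in> extensional (carrier \<G>)" by (simp add: char_of_def)
    show "char_of w \<in> hom \<G> (units_of type_ring)"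
      unfolding hom_def units_of_def using unit mult by simp
    show "\<exists>n>0. \<forall>\<rho>\<in>carrier \<G>. char_of w \<rho> ^ n = 1" using g_pos pow by blast
    show "\<exists>K\<in>\<K>. \<forall>\<rho>\<in>carrier (gal_group Qab K). char_of w \<rho> = 1" using triv K(4) by blast
  qed
qed

lemma adj_prim_root:
  assumes F: "field_set F" and w: "prim_root g w"
  shows "adj F w = adj F z"
proof -
  have sub: "adj F a \<subseteq> adj F b" if ab: "prim_root g a" "prim_root g b" for a b :: "'p padic_closure"
  proof -
    note A = adj[OF F prim_root_algebraic[OF F ab(2)]]
    obtain i where "a = b ^ i" using root_of_unity_power[OF ab(2) prim_rootD(3)[OF ab(1)]] by blast
    then have "a \<in> adj F b" using ring_setD(7)[OF field_setD(1)[OF A(1)] A(3)] by simp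
    then show ?thesis using A by (intro generate_field_subset) auto
  qed
  show ?thesis by (rule equalityI[OF sub[OF w prim_root_z] sub[OF prim_root_z w]])
qed

definition orbit :: "'p padic_closure set \<Rightarrow> 'p padic_closure \<Rightarrow> 'p padic_closure set" where
  "orbit F w = (\<lambda>\<tau>. \<tau> w) ` carrier (gal_group (adj F z) F)"

lemma orbit_prim_root:
  assumes F: "field_set F" and w: "prim_root g w" and y: "y \<in> orbit F w"
  shows "prim_root g y"
proof -
  obtain \<tau> where t: "\<tau> \<in> carrier (gal_group (adj F w) F)" "y = \<tau> w"
    using y adj_prim_root[OF F w] by (auto simp: orbit_def)
  note D = gal_groupD[OF adj(1)[OF F prim_root_algebraic[OF F w]] t(1)]
  show ?thesis unfolding t(2) by (rule prim_root_aut(2)[OF F w D(3,4)])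
qed

text \<open>The values of \<open>char_of w\<close> are the powers of \<open>w\<close>, so they generate \<open>adj F w\<close>.\<close>

lemma conjugates_char_of:
  assumes F: "field_set F" and w: "prim_root g w"
  shows "conjugates F (char_of w) = char_of ` orbit F w"
proof -
  note A = adj[OF F prim_root_algebraic[OF F w]]
  note R = field_setD(1)[OF A(1)]
  have wg: "w ^ g = 1" by (rule prim_rootD(3)[OF w])
  have eq: "value_field F (char_of w) = adj F w"
  proof
    have "char_of w ` carrier \<G> \<subseteq> adj F w" using ring_setD(7)[OF R A(3)] by (auto simp: char_of_def)
    then show "value_field F (char_of w) \<subseteq> adj F w" using A by (intro generate_field_subset) auto
    have "w \<in> char_of w ` carrier \<G>" by (rule image_eqI[where x = s]) (simp_all only: char_of_s[OF wg] s(1))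
    then show "adj F w \<subseteq> value_field F (char_of w)"
      by (intro generate_field_subset field_set_generate subsetI generate_field.incl) auto
  qed
  have conj: "restrict (\<tau> \<circ> char_of w) (carrier \<G>) = char_of (\<tau> w)"
    if t: "\<tau> \<in> carrier (gal_group (adj F w) F)" for \<tau>
    using ring_embD(7)[OF gal_groupD(3)[OF A(1) t] R A(3)] by (auto simp: char_of_def fun_eq_iff)
  have "conjugates F (char_of w) = (\<lambda>\<tau>. char_of (\<tau> w)) ` carrier (gal_group (adj F w) F)"
    unfolding conjugates_def eq by (rule image_cong[OF refl conj])
  then show ?thesis by (simp only: orbit_def image_image adj_prim_root[OF F w])
qed

text \<open>This is the irreducibility of the cyclotomic polynomials over the rationals.\<close>

lemma orbit_Rats: "orbit \<rat> z = {w. prim_root g w}"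
proof
  show "orbit \<rat> z \<subseteq> {w. prim_root g w}" by (intro subsetI CollectI) (rule orbit_prim_root[OF field_set_Rats prim_root_z])
  show "{w. prim_root g w} \<subseteq> orbit \<rat> z"
  proof
    fix w :: "'p padic_closure" assume "w \<in> {w. prim_root g w}"
    then have w: "prim_root g w" by simp
    obtain a where a: "w = z ^ a" using root_of_unity_power[OF prim_root_z prim_rootD(3)[OF w]] by blast
    then have "coprime a g" using prim_root_power_coprime[OF prim_root_z] w by simp
    then obtain \<tau> where "\<tau> \<in> carrier (gal_group (adj \<rat> z) \<rat>)" "\<tau> z = w"
      using cyclotomic_conjugate[OF prim_root_z, of a] unfolding a by blast
    then show "w \<in> orbit \<rat> z" unfolding orbit_def by (intro image_eqI[of _ _ \<tau>]) simp_all
  qed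
qed

lemma terms_of_rational: "terms_of \<rat> (conjugate_sum \<rat> \<psi>) = char_of ` {w. prim_root g w}"
proof -
  have "terms_of \<rat> (conjugate_sum \<rat> \<psi>) = conjugates \<rat> \<psi>" by (rule terms_of_conjugate_sum[OF field_set_Rats psi])
  also have "\<dots> = conjugates \<rat> (char_of z)" by (rule arg_cong[OF psi_eq])
  also have "\<dots> = char_of ` orbit \<rat> z" by (rule conjugates_char_of[OF field_set_Rats prim_root_z])
  finally show ?thesis by (simp only: orbit_Rats)
qed

lemma terms_of_padic:
  assumes "prim_root g w"
  shows "terms_of Qp (conjugate_sum Qp (char_of w)) = char_of ` orbit Qp w"
  unfolding terms_of_conjugate_sum[OF field_set_Qp char_of_character[OF prim_rootD(3)[OF assms]]]
  by (rule conjugates_char_of[OF field_set_Qp assms])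

lemma padic_components_eq:
  "padic_components (conjugate_sum \<rat> \<psi>) = (\<lambda>w. conjugate_sum Qp (char_of w)) ` {w. prim_root g w}"
proof (intro equalityI subsetI)
  fix \<phi> assume "\<phi> \<in> padic_components (conjugate_sum \<rat> \<psi>)"
  then obtain \<psi>' where p: "\<psi>' \<in> characters" "\<phi> = conjugate_sum Qp \<psi>'" "terms_of Qp \<phi> \<subseteq> char_of ` {w. prim_root g w}"
    unfolding terms_of_rational[symmetric] padic_components_def irreducible_character_def by (elim CollectE conjE bexE)
  have t: "\<psi>' \<in> terms_of Qp \<phi>"
    unfolding p(2) terms_of_conjugate_sum[OF field_set_Qp p(1)] by (rule conjugates_refl[OF field_set_Qp p(1)])
  obtain w where "\<psi>' = char_of w" "w \<in> {w. prim_root g w}" using subsetD[OF p(3) t] by (rule imageE)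
  then show "\<phi> \<in> (\<lambda>w. conjugate_sum Qp (char_of w)) ` {w. prim_root g w}" unfolding p(2) by (intro image_eqI) simp_all
next
  fix \<phi> assume "\<phi> \<in> (\<lambda>w. conjugate_sum Qp (char_of w)) ` {w. prim_root g w}"
  then obtain w where w: "prim_root g w" "\<phi> = conjugate_sum Qp (char_of w)" by blast
  have sub: "terms_of Qp \<phi> \<subseteq> char_of ` {w. prim_root g w}"
    unfolding w(2) terms_of_padic[OF w(1)] by (intro image_mono subsetI CollectI) (rule orbit_prim_root[OF field_set_Qp w(1)])
  have "irreducible_character Qp \<phi>"
    unfolding irreducible_character_def w(2) by (rule bexI[OF refl char_of_character[OF prim_rootD(3)[OF w(1)]]])
  then show "\<phi> \<in> padic_components (conjugate_sum \<rat> \<psi>)"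
    unfolding padic_components_def terms_of_rational using sub by simp
qed

sublocale C: cyclotomic_base padic_int_emb Qp g z by (rule cyclotomic_base_padic[OF prim_root_z])

lemma finite_prim_roots: "finite {w::'p padic_closure. prim_root g w}"
  by (rule finite_subset[OF _ roots_of_unity_eq(2)[OF prim_root_z]]) (auto dest: prim_rootD(3))

lemma orbit_refl: "prim_root g w \<Longrightarrow> w \<in> orbit Qp w"
  and orbit_stable: "prim_root g w \<Longrightarrow> C.stable (orbit Qp w)"
proof -
  assume w: "prim_root g w"
  have wA: "w \<in> adj Qp z" using C.B_subset C.root_B[OF prim_rootD(3)[OF w]] by blast
  interpret H: group "gal_group (adj Qp z) Qp" by (rule group_gal_group[OF C.A(1,2)])
  show "w \<in> orbit Qp w"
    unfolding orbit_def by (rule orbit_permuted(2)[OF C.A(1,2) wA H.one_closed])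
  show "C.stable (orbit Qp w)"
    unfolding C.stable_def
  proof (intro conjI ballI)
    show "orbit Qp w \<subseteq> {w. w ^ g = 1}"
      using orbit_prim_root[OF field_set_Qp w] prim_rootD(3) by blast
    show "\<tau> ` orbit Qp w \<subseteq> orbit Qp w" if "\<tau> \<in> C.Gal" for \<tau>
      unfolding orbit_def by (rule orbit_permuted(1)[OF C.A(1,2) wA that])
  qed
qed

lemma orbit_eq:
  assumes w: "prim_root g w" and y: "y \<in> orbit Qp w"
  shows "orbit Qp y = orbit Qp w"
proof -
  interpret H: group "gal_group (adj Qp z) Qp" by (rule group_gal_group[OF C.A(1,2)])
  have wA: "w \<in> adj Qp z" using C.B_subset C.root_B[OF prim_rootD(3)[OF w]] by blast
  obtain \<tau> where t: "\<tau> \<in> C.Gal" "y = \<tau> w" using y by (auto simp: orbit_def)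
  have yA: "y \<in> adj Qp z" unfolding t(2) by (rule gal_groupD(5)[OF C.A(1) t(1) wA])
  have "w = (inv\<^bsub>gal_group (adj Qp z) Qp\<^esub> \<tau>) y"
    unfolding t(2) by (rule gal_group_apply(3)[OF C.A(1,2) t(1) wA, symmetric])
  then have wy: "w \<in> orbit Qp y" using H.inv_closed[OF t(1)] by (auto simp: orbit_def)
  have sub: "orbit Qp b \<subseteq> orbit Qp a" if "b \<in> orbit Qp a" "a \<in> adj Qp z" for a b
  proof
    fix x assume "x \<in> orbit Qp b"
    then obtain \<rho> where r: "\<rho> \<in> C.Gal" "x = \<rho> b" by (auto simp: orbit_def)
    show "x \<in> orbit Qp a"
      unfolding r(2) orbit_def using orbit_permuted(1)[OF C.A(1,2) that(2) r(1)] that(1) by (auto simp: orbit_def)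
  qed
  show ?thesis using sub[OF y wA] sub[OF wy yA] by blast
qed

lemma conjugate_sum_eq:
  assumes w: "prim_root g w" and y: "y \<in> orbit Qp w"
  shows "conjugate_sum Qp (char_of y) = conjugate_sum Qp (char_of w)"
  unfolding conjugate_sum_def conjugates_char_of[OF field_set_Qp w]
    conjugates_char_of[OF field_set_Qp orbit_prim_root[OF field_set_Qp w y]] orbit_eq[OF w y] ..

lemma P_phi_eq:
  assumes w: "prim_root g w"
  shows "map_poly padic_int_emb (P_phi K \<sigma> (conjugate_sum Qp (char_of w))) = (\<Prod>a\<in>orbit Qp w. [:- a, 1:])"
proof -
  have inj: "inj_on char_of (orbit Qp w)"
  proof (rule inj_onI)
    fix x y assume xy: "x \<in> orbit Qp w" "y \<in> orbit Qp w" "char_of x = char_of y"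
    have "x = char_of x s"
      by (rule char_of_s[OF prim_rootD(3)[OF orbit_prim_root[OF field_set_Qp w xy(1)]], symmetric])
    also have "\<dots> = char_of y s" by (rule fun_cong[OF xy(3)])
    also have "\<dots> = y" by (rule char_of_s[OF prim_rootD(3)[OF orbit_prim_root[OF field_set_Qp w xy(2)]]])
    finally show "x = y" .
  qed
  have "(\<Prod>\<psi>\<in>terms_of Qp (conjugate_sum Qp (char_of w)). [:- \<psi> (lift_aut K \<sigma>), 1:]) =
      (\<Prod>a\<in>orbit Qp w. [:- char_of a s, 1:])"
    unfolding terms_of_padic[OF w] s_def[symmetric] by (simp add: prod.reindex[OF inj])
  also have "\<dots> = (\<Prod>a\<in>orbit Qp w. [:- a, 1:])"
    by (intro prod.cong refl) (simp add: char_of_s prim_rootD(3)[OF orbit_prim_root[OF field_set_Qp w]])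
  finally have eq: "(\<Prod>\<psi>\<in>terms_of Qp (conjugate_sum Qp (char_of w)). [:- \<psi> (lift_aut K \<sigma>), 1:]) =
      (\<Prod>a\<in>orbit Qp w. [:- a, 1:])" .
  obtain N where "map_poly padic_int_emb N = (\<Prod>a\<in>orbit Qp w. [:- poly (map_poly padic_int_emb [:0, 1:]) a, 1:])"
    by (rule C.prod_over_stable[OF orbit_stable[OF w]])
  then have N: "map_poly padic_int_emb N = (\<Prod>a\<in>orbit Qp w. [:- a, 1:])" by (simp add: Polynomial.map_poly_pCons)
  have "P_phi K \<sigma> (conjugate_sum Qp (char_of w)) = N"
    unfolding P_phi_def eq
  proof (rule the_equality)
    fix N' assume "map_poly padic_int_emb N' = (\<Prod>a\<in>orbit Qp w. [:- a, 1:])"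
    then have "map_poly padic_int_emb N' = map_poly padic_int_emb N" by (simp only: N)
    then show "N' = N" by (simp only: C.pm.eq_iff)
  qed (rule N)
  then show ?thesis by (simp only: N)
qed

end

section \<open>Norms down to the maximal proper subfields\<close>

context cyclic_character
begin

text \<open>The Galois group of \<open>K\<close> over the field fixed by \<open>\<sigma>^d\<close> consists of the powers of \<open>\<sigma>^d\<close>, by Artin's
  theorem.\<close>

lemma fixed_field_of_power:
  assumes q: "Factorial_Ring.prime q" "q dvd g" and d: "d = g div q"
    and k: "k = {y \<in> K. (\<sigma> [^]\<^bsub>GK\<^esub> d) y = y}"
  shows "field_set k" "k \<subset> K" "bij_betw (\<lambda>i. \<sigma> [^]\<^bsub>GK\<^esub> (i * d)) {..<q} (carrier (gal_group K k))"
proof -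
  define r where "r = \<sigma> [^]\<^bsub>GK\<^esub> d"
  have gd: "g = q * d" using q(2) d by simp
  have q1: "q > 1" by (rule prime_gt_1_nat[OF q(1)])
  have d0: "d > 0" using gd g_pos by (cases d) simp_all
  have r: "r \<in> carrier GK" unfolding r_def by (rule GK.nat_pow_closed[OF sigma_K(1)])
  have rp: "r [^]\<^bsub>GK\<^esub> i = \<sigma> [^]\<^bsub>GK\<^esub> (i * d)" for i :: nat
    unfolding r_def by (simp only: GK.nat_pow_pow[OF sigma_K(1)] mult.commute)
  have k': "k = {y \<in> K. \<forall>f\<in>{r}. f y = y}" by (simp add: k r_def)
  show kf: "field_set k"
    unfolding k' by (rule field_set_fixed[OF K(1)]) (use gal_groupD(3)[OF K(1) r] in simp)
  have kK: "k \<subseteq> K" by (auto simp: k)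
  show "k \<subset> K"
  proof (rule psubsetI[OF kK], rule notI)
    assume "k = K"
    have "r x = \<one>\<^bsub>GK\<^esub> x" if x: "x \<in> K" for x
    proof -
      have "x \<in> {y \<in> K. \<forall>f\<in>{r}. f y = y}" using x \<open>k = K\<close> unfolding k'[symmetric] by simp
      then show ?thesis using gal_group_apply(4)[OF K(1,3) r x] by simp
    qed
    then have "r = \<one>\<^bsub>GK\<^esub>" by (rule GK_eqI[OF r GK.one_closed])
    then have "g dvd d" unfolding r_def by (simp only: sigma_pow_eq_one)
    then show False using d0 q1 gd by (auto dest: dvd_imp_le)
  qed
  have fixk: "r [^]\<^bsub>GK\<^esub> i \<in> carrier (gal_group K k)" for i :: nat
  proof -
    have c: "r [^]\<^bsub>GK\<^esub> i \<in> carrier GK" by (rule GK.nat_pow_closed[OF r])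
    have "(r [^]\<^bsub>GK\<^esub> i) y = y" if "y \<in> k" for y
    proof -
      have y: "y \<in> K" "r y = y" using that by (auto simp: k')
      have "(r ^^ i) y = y" by (induction i) (simp_all add: y(2))
      then show ?thesis by (simp only: gal_group_apply(2)[OF K(1,3) r y(1)])
    qed
    then show ?thesis using c by (simp add: gal_group_iff[OF K(1)])
  qed
  show "bij_betw (\<lambda>i. \<sigma> [^]\<^bsub>GK\<^esub> (i * d)) {..<q} (carrier (gal_group K k))"
    unfolding bij_betw_def
  proof (intro conjI equalityI subsetI)
    show "inj_on (\<lambda>i. \<sigma> [^]\<^bsub>GK\<^esub> (i * d)) {..<q}"
    proof (rule linorder_inj_onI')
      fix i j assume ij: "i \<in> {..<q}" "j \<in> {..<q}" "i < j"
      show "\<sigma> [^]\<^bsub>GK\<^esub> (i * d) \<noteq> \<sigma> [^]\<^bsub>GK\<^esub> (j * d)"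
      proof
        assume eq: "\<sigma> [^]\<^bsub>GK\<^esub> (i * d) = \<sigma> [^]\<^bsub>GK\<^esub> (j * d)"
        have split: "j * d = i * d + (j - i) * d" using ij(3) by (simp add: add_mult_distrib[symmetric])
        have "\<sigma> [^]\<^bsub>GK\<^esub> (i * d) \<otimes>\<^bsub>GK\<^esub> \<sigma> [^]\<^bsub>GK\<^esub> ((j - i) * d) = \<sigma> [^]\<^bsub>GK\<^esub> (i * d)"
          unfolding GK.nat_pow_mult[OF sigma_K(1)] split[symmetric] by (rule eq[symmetric])
        then have "\<sigma> [^]\<^bsub>GK\<^esub> ((j - i) * d) = \<one>\<^bsub>GK\<^esub>"
          using GK.r_cancel_one'[of "\<sigma> [^]\<^bsub>GK\<^esub> (i * d)" "\<sigma> [^]\<^bsub>GK\<^esub> ((j - i) * d)"] GK.nat_pow_closed[OF sigma_K(1)]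
          by simp
        then have "g dvd (j - i) * d" by (simp only: sigma_pow_eq_one)
        then have "q dvd j - i" using d0 by (simp add: gd)
        then show False using ij by (auto dest: dvd_imp_le)
      qed
    qed
  next
    fix \<tau> assume "\<tau> \<in> (\<lambda>i. \<sigma> [^]\<^bsub>GK\<^esub> (i * d)) ` {..<q}"
    then show "\<tau> \<in> carrier (gal_group K k)" using fixk by (auto simp: rp)
  next
    fix \<tau> assume t: "\<tau> \<in> carrier (gal_group K k)"
    define H where "H = generate GK {r}"
    have H: "H = {r [^]\<^bsub>GK\<^esub> i | i. i \<in> (UNIV :: nat set)}"
      unfolding H_def by (rule GK.generate_pow_on_finite_carrier[OF finite_GK r])
    have sH: "subgroup H GK" unfolding H_def by (rule GK.generate_is_subgroup) (use r in simp)
    have "r [^]\<^bsub>GK\<^esub> (1::nat) \<in> H" unfolding H by blast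
    then have rH: "r \<in> H" using r by simp
    have "\<tau> \<in> H"
    proof (rule artin_gal_group[OF K(1,3) sH finite_subset[OF subgroup.subset[OF sH] finite_GK] t])
      fix y assume y: "y \<in> K" "\<And>h. h \<in> H \<Longrightarrow> h y = y"
      have "y \<in> k" using y(1) y(2)[OF rH] by (simp add: k')
      then show "\<tau> y = y" by (rule gal_groupD(4)[OF K(1) t])
    qed
    then obtain i :: nat where i: "\<tau> = r [^]\<^bsub>GK\<^esub> i" unfolding H by blast
    have "\<sigma> [^]\<^bsub>GK\<^esub> (q * d * (i div q)) = (\<sigma> [^]\<^bsub>GK\<^esub> g) [^]\<^bsub>GK\<^esub> (i div q)"
      by (simp only: GK.nat_pow_pow[OF sigma_K(1)] gd)
    then have one: "\<sigma> [^]\<^bsub>GK\<^esub> (q * d * (i div q)) = \<one>\<^bsub>GK\<^esub>" using sigma_pow_eq_one[of g] by simp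
    have "i * d = (i mod q + q * (i div q)) * d" by simp
    also have "\<dots> = i mod q * d + q * d * (i div q)" by (simp only: algebra_simps)
    finally have "\<tau> = \<sigma> [^]\<^bsub>GK\<^esub> (i mod q * d) \<otimes>\<^bsub>GK\<^esub> \<sigma> [^]\<^bsub>GK\<^esub> (q * d * (i div q))"
      unfolding i rp by (simp only: GK.nat_pow_mult[OF sigma_K(1)])
    then have "\<tau> = \<sigma> [^]\<^bsub>GK\<^esub> (i mod q * d)" using one GK.nat_pow_closed[OF sigma_K(1)] by simp
    then show "\<tau> \<in> (\<lambda>i. \<sigma> [^]\<^bsub>GK\<^esub> (i * d)) ` {..<q}" using q1 by (intro image_eqI[of _ _ "i mod q"]) simp_all
  qed
qed

end

section \<open>The support of the arithmetic submodule\<close>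

locale cyclic_character_module = cyclic_character \<psi> \<sigma>
  for \<psi> :: "qab_aut \<Rightarrow> 'p::prime_card padic_closure" and \<sigma> :: "complex \<Rightarrow> complex" +
  fixes M :: "complex set \<Rightarrow> ('p, 'a) gal_module" and N J :: "complex set \<Rightarrow> complex set \<Rightarrow> 'a \<Rightarrow> 'a"
  assumes family: "arithmetic_family M N J"
begin

abbreviation V :: "('p, 'a) gal_module" where "V \<equiv> M K"

sublocale V: group_ring_module \<G> V s
  by (intro group_ring_module.intro group_ring_module_axioms.intro group_GalQab s(1)
      arithmetic_family.modules[OF family K(4)])

definition ar :: "'a set" where
  "ar = {x \<in> carrier V. \<forall>k. field_set k \<and> k \<subset> K \<longrightarrow> N K k x = \<zero>\<^bsub>M k\<^esub>}"

text \<open>The group Gal(Qab/K) acts trivially on \<open>V\<close>.\<close>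

lemma single_agree:
  assumes r: "\<rho> \<in> carrier \<G>" "\<rho>' \<in> carrier \<G>" "\<And>y. y \<in> K \<Longrightarrow> \<rho> y = \<rho>' y" and x: "x \<in> carrier V"
  shows "gr_single 1 \<rho> \<odot>\<^bsub>V\<^esub> x = gr_single 1 \<rho>' \<odot>\<^bsub>V\<^esub> x"
proof -
  obtain \<tau> where t: "\<tau> \<in> carrier (gal_group Qab K)" "\<tau> \<in> carrier \<G>" "\<rho> = \<rho>' \<otimes>\<^bsub>\<G>\<^esub> \<tau>"
    using agree_on_K[OF r(1,2,3)] by blast
  have "gr_single 1 \<rho> = gr_single 1 \<rho>' \<otimes>\<^bsub>V.RG\<^esub> gr_single 1 \<tau>"
    unfolding t(3) by (simp only: gr_single_mult[OF r(2) t(2)] mult_1)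
  then have "gr_single 1 \<rho> \<odot>\<^bsub>V\<^esub> x = gr_single 1 \<rho>' \<odot>\<^bsub>V\<^esub> (gr_single 1 \<tau> \<odot>\<^bsub>V\<^esub> x)"
    by (simp only: V.smult_assoc1[OF V.single_closed[OF r(2)] V.single_closed[OF t(2)] x])
  then show ?thesis by (simp only: arithmetic_family.trivial_action[OF family K(4) t(1) x])
qed

lemma act_monom_apply:
  assumes t: "\<tau> = \<sigma> [^]\<^bsub>GK\<^esub> i" and x: "x \<in> carrier V"
  shows "gr_single 1 (lift_aut K \<tau>) \<odot>\<^bsub>V\<^esub> x = V.act (Polynomial.monom 1 i) x"
proof -
  have tK: "\<tau> \<in> carrier GK" unfolding t by (rule GK.nat_pow_closed[OF sigma_K(1)])
  note l = lift_aut[OF psi tK[unfolded K_def], folded K_def]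
  have "gr_single 1 (lift_aut K \<tau>) \<odot>\<^bsub>V\<^esub> x = gr_single 1 (s [^]\<^bsub>\<G>\<^esub> i) \<odot>\<^bsub>V\<^esub> x"
  proof (rule single_agree[OF l(1) s_pow _ x])
    fix y assume y: "y \<in> K"
    then show "lift_aut K \<tau> y = (s [^]\<^bsub>\<G>\<^esub> i) y"
      using fun_cong[OF l(2), of y] by (simp only: s_pow_apply[OF y] t restrict_apply if_True)
  qed
  then show ?thesis by (simp only: V.act_monom[OF x])
qed

lemma act_order:
  assumes x: "x \<in> carrier V"
  shows "V.act (Polynomial.monom 1 g - 1) x = \<zero>\<^bsub>V\<^esub>"
proof -
  have "V.act (Polynomial.monom 1 g) x = gr_single 1 (s [^]\<^bsub>\<G>\<^esub> g) \<odot>\<^bsub>V\<^esub> x" by (rule V.act_monom[OF x])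
  also have "\<dots> = gr_single 1 (s [^]\<^bsub>\<G>\<^esub> (0::nat)) \<odot>\<^bsub>V\<^esub> x"
  proof (rule single_agree[OF s_pow s_pow _ x])
    fix y assume y: "y \<in> K"
    have "\<sigma> [^]\<^bsub>GK\<^esub> g = \<sigma> [^]\<^bsub>GK\<^esub> (0::nat)" using sigma_pow_eq_one[of g] by simp
    then show "(s [^]\<^bsub>\<G>\<^esub> g) y = (s [^]\<^bsub>\<G>\<^esub> (0::nat)) y" by (simp only: s_pow_apply[OF y])
  qed
  also have "\<dots> = V.act (Polynomial.monom 1 0) x" by (rule V.act_monom[OF x, symmetric])
  finally have eq: "V.act (Polynomial.monom 1 g) x = V.act 1 x" by (simp add: monom_0 one_pCons)
  have "V.act ((Polynomial.monom 1 g - 1) + 1) x = V.act 1 x" using eq by simp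
  then have "V.act (Polynomial.monom 1 g - 1) x \<oplus>\<^bsub>V\<^esub> x = x" by (simp only: V.act_add[OF x] V.act_1[OF x])
  then show ?thesis using V.M.add.r_cancel_one[OF x V.act_closed[OF x]] by simp
qed

text \<open>For the field \<open>k\<close> fixed by \<open>\<sigma> ^ (g div q)\<close>, the polynomial represents the norm element of the Galois
  group of \<open>K\<close> over \<open>k\<close>, which acts as \<open>J K k \<circ> N K k\<close>.\<close>

lemma norm_polynomial_kills:
  assumes x: "x \<in> ar" and q: "Factorial_Ring.prime q" "q dvd g"
  shows "V.act (\<Sum>i<q. Polynomial.monom 1 (i * (g div q))) x = \<zero>\<^bsub>V\<^esub>"
proof -
  define d where "d = g div q"
  define k where "k = {y \<in> K. (\<sigma> [^]\<^bsub>GK\<^esub> d) y = y}"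
  note F = fixed_field_of_power[OF q d_def k_def]
  have xV: "x \<in> carrier V" and Nx: "N K k x = \<zero>\<^bsub>M k\<^esub>" using x F(1,2) by (simp_all add: ar_def)
  have kK: "k \<in> \<K>" "k \<subseteq> K" using KK_subfield[OF K(4) F(1)] F(2) by blast+
  have "\<zero>\<^bsub>V\<^esub> = J K k (N K k x)"
    unfolding Nx using module_hom_zero(1)[OF arithmetic_family.modules[OF family kK(1)]
      arithmetic_family.modules[OF family K(4)] arithmetic_family.J_hom[OF family kK(1) K(4) kK(2)]] by simp
  also have "\<dots> = norm_elem M K k x" by (rule arithmetic_family.J_N[OF family kK(1) K(4) kK(2) xV])
  also have "\<dots> = finsum V (\<lambda>\<tau>. gr_single 1 (lift_aut K \<tau>) \<odot>\<^bsub>V\<^esub> x)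
      ((\<lambda>i. \<sigma> [^]\<^bsub>GK\<^esub> (i * d)) ` {..<q})"
    unfolding norm_elem_def using F(3) by (simp only: bij_betw_def)
  also have "\<dots> = finsum V (\<lambda>i. gr_single 1 (lift_aut K (\<sigma> [^]\<^bsub>GK\<^esub> (i * d))) \<odot>\<^bsub>V\<^esub> x) {..<q}"
  proof (rule V.M.finsum_reindex)
    show "inj_on (\<lambda>i. \<sigma> [^]\<^bsub>GK\<^esub> (i * d)) {..<q}" using F(3) by (simp only: bij_betw_def)
    show "(\<lambda>\<tau>. gr_single 1 (lift_aut K \<tau>) \<odot>\<^bsub>V\<^esub> x) \<in> (\<lambda>i. \<sigma> [^]\<^bsub>GK\<^esub> (i * d)) ` {..<q} \<rightarrow> carrier V"
      using V.act_closed[OF xV] act_monom_apply[OF refl xV] by (auto simp: Pi_iff)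
  qed
  also have "\<dots> = finsum V (\<lambda>i. V.act (Polynomial.monom 1 (i * d)) x) {..<q}"
    by (simp only: act_monom_apply[OF refl xV])
  also have "\<dots> = V.act (\<Sum>i<q. Polynomial.monom 1 (i * d)) x"
    by (rule V.act_sum[OF xV, symmetric]) simp
  finally show ?thesis by (simp only: d_def)
qed

abbreviation ev :: "'p padic_int poly \<Rightarrow> 'p padic_closure \<Rightarrow> 'p padic_closure" where
  "ev r a \<equiv> poly (map_poly padic_int_emb r) a"

text \<open>Seen as a module over polynomials in \<open>s\<close>, the submodule generated by \<open>x\<close> lives on the zeros of the
  polynomials that kill \<open>x\<close>; the definition expresses that it lives on \<open>S\<close>.\<close>

definition supported :: "'p padic_closure set \<Rightarrow> 'a \<Rightarrow> bool" where
  "supported S x \<longleftrightarrow> x \<in> carrier V \<and> (\<forall>r. (\<forall>a\<in>S. ev r a = 0) \<longrightarrow> V.act r x = \<zero>\<^bsub>V\<^esub>)"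

lemma supportedD:
  "supported S x \<Longrightarrow> x \<in> carrier V"
  "supported S x \<Longrightarrow> (\<And>a. a \<in> S \<Longrightarrow> ev r a = 0) \<Longrightarrow> V.act r x = \<zero>\<^bsub>V\<^esub>"
  by (simp_all add: supported_def)

lemma ev_simps:
  "ev (r + r') a = ev r a + ev r' a" "ev (r - r') a = ev r a - ev r' a" "ev (r * r') a = ev r a * ev r' a"
  "ev 1 a = 1" "ev 0 a = 0"
  by (simp_all add: C.pm.hom_add C.pm.hom_minus C.pm.hom_mult)

lemma ev_sum: "finite A \<Longrightarrow> ev (\<Sum>i\<in>A. f i) a = (\<Sum>i\<in>A. ev (f i) a)"
  by (induction A rule: finite_induct) (simp_all add: ev_simps)

text \<open>Division by the monic polynomial \<open>A\<close> is possible over the \<open>p\<close>-adic integers. The remainder of an \<open>r\<close>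
  vanishing on \<open>S\<close> has more zeros than its degree allows, so \<open>A\<close> divides \<open>r\<close>.\<close>

lemma supported_if_product_kills:
  assumes S: "finite S" and A: "map_poly padic_int_emb A = (\<Prod>a\<in>S. [:- a, 1:])"
    and x: "x \<in> carrier V" "V.act A x = \<zero>\<^bsub>V\<^esub>"
  shows "supported S x"
  unfolding supported_def
proof (intro conjI allI impI x(1))
  fix r assume r: "\<forall>a\<in>S. ev r a = 0"
  have "lead_coeff (map_poly padic_int_emb A) = 1" unfolding A by (simp add: lead_coeff_prod)
  then have "padic_int_emb (lead_coeff A) = padic_int_emb 1" by (simp add: C.hom_one)
  then have lc: "lead_coeff A = 1" by (simp only: C.eq_iff)
  have deg: "Polynomial.degree A = card S"
  proof -
    have "Polynomial.degree A = Polynomial.degree (map_poly padic_int_emb A)" by simp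
    also have "\<dots> = card S" unfolding A using S by (subst degree_prod_eq_sum_degree) auto
    finally show ?thesis .
  qed
  have A0: "A \<noteq> 0" using lc by auto
  obtain q m where qm: "pseudo_divmod r A = (q, m)" by fastforce
  from pseudo_divmod[OF A0 qm] lc have eq: "r = A * q + m" "m = 0 \<or> Polynomial.degree m < card S"
    by (simp_all add: deg)
  have "ev m a = 0" if "a \<in> S" for a
  proof -
    have "ev A a = 0" unfolding A poly_prod using S that by (intro prod_zero) auto
    then show ?thesis using bspec[OF r that] unfolding eq(1) ev_simps by simp
  qed
  then have sub: "S \<subseteq> {a. ev m a = 0}" by blast
  have "m = 0"
  proof (rule ccontr)
    assume m: "m \<noteq> 0"
    then have m': "map_poly padic_int_emb m \<noteq> 0" by simp
    have "card S \<le> card {a. ev m a = 0}" by (rule card_mono[OF poly_roots_finite[OF m'] sub])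
    also have "\<dots> \<le> Polynomial.degree (map_poly padic_int_emb m)" by (rule card_poly_roots_bound[OF m'])
    finally show False using eq(2) m by simp
  qed
  then have "r = q * A" using eq(1) by (simp add: mult.commute)
  then show "V.act r x = \<zero>\<^bsub>V\<^esub>" by (simp only: V.act_mult[OF x(1)] x(2) V.act_zero_right)
qed

text \<open>A polynomial over the \<open>p\<close>-adic integers that separates \<open>S - S'\<close> from \<open>S'\<close> cuts a polynomial vanishing
  on \<open>S \<inter> S'\<close> into a part vanishing on \<open>S\<close> and a part vanishing on \<open>S'\<close>.\<close>

lemma supported_Int:
  assumes x: "supported S x" "supported S' x" and st: "C.stable S" "C.stable S'"
    and units: "\<And>a b. a \<in> S - S' \<Longrightarrow> b \<in> S' \<Longrightarrow> C.Bunit (b - a)"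
  shows "supported (S \<inter> S') x"
  unfolding supported_def
proof (intro conjI allI impI supportedD(1)[OF x(1)])
  fix r assume r: "\<forall>a\<in>S \<inter> S'. ev r a = 0"
  note xV = supportedD(1)[OF x(1)]
  obtain e where e: "\<And>a. a \<in> S - S' \<Longrightarrow> ev e a = 0" "\<And>b. b \<in> S' \<Longrightarrow> ev e b = 1"
    using C.separating_polynomial[OF C.stable_ops(2)[OF st] st(2) units] by blast
  have 1: "V.act (r * e) x = \<zero>\<^bsub>V\<^esub>"
  proof (rule supportedD(2)[OF x(1)])
    fix a assume "a \<in> S"
    then show "ev (r * e) a = 0" using e(1)[of a] r unfolding ev_simps by (cases "a \<in> S'") simp_all
  qed
  have 2: "V.act (r * (1 - e)) x = \<zero>\<^bsub>V\<^esub>"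
    by (rule supportedD(2)[OF x(2)]) (simp add: ev_simps e(2))
  have "r = r * e + r * (1 - e)" by (simp add: algebra_simps)
  then have "V.act r x = V.act (r * e) x \<oplus>\<^bsub>V\<^esub> V.act (r * (1 - e)) x"
    using V.act_add[OF xV, of "r * e" "r * (1 - e)"] by simp
  then show "V.act r x = \<zero>\<^bsub>V\<^esub>" unfolding 1 2 by simp
qed

text \<open>The zeros of the norm polynomial for \<open>q\<close>.\<close>

abbreviation U :: "nat \<Rightarrow> 'p padic_closure set" where
  "U q \<equiv> {w. w ^ g = 1 \<and> w ^ (g div q) \<noteq> 1}"

lemma stable_roots: "C.stable {w. w ^ g = 1}"
  using C.Gal_root(4) by (auto simp: C.stable_def)

lemma stable_U: "C.stable (U q)"
  unfolding C.stable_def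
proof (intro conjI ballI)
  fix \<tau> assume t: "\<tau> \<in> C.Gal"
  note D = gal_groupD[OF C.A(1) t] and R = field_setD(1)[OF C.A(1)]
  show "\<tau> ` U q \<subseteq> U q"
  proof
    fix y assume "y \<in> \<tau> ` U q"
    then obtain w where w: "w ^ g = 1" "w ^ (g div q) \<noteq> 1" "y = \<tau> w" by blast
    have wA: "w \<in> adj Qp z" using C.B_subset C.root_B[OF w(1)] by blast
    have pow: "y ^ i = 1 \<longleftrightarrow> w ^ i = 1" for i
    proof -
      have "y ^ i = 1 \<longleftrightarrow> \<tau> (w ^ i) = \<tau> 1"
        unfolding w(3) by (simp only: ring_embD(7)[OF D(3) R wA] ring_embD(1)[OF D(3) R])
      also have "\<dots> \<longleftrightarrow> w ^ i = 1"
        by (rule inj_on_eq_iff[OF ring_emb_inj[OF D(3) C.A(1)] ring_setD(7)[OF R wA] ring_setD(1)[OF R]])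
      finally show ?thesis .
    qed
    show "y \<in> U q" using w(1,2) by (simp add: pow)
  qed
qed blast

lemma supported_roots: "x \<in> carrier V \<Longrightarrow> supported {w. w ^ g = 1} x"
  by (rule supported_if_product_kills[OF roots_of_unity_eq(2)[OF prim_root_z] _ _ act_order])
     (simp_all add: prod_roots_of_unity[OF prim_root_z] C.pm.hom_minus)

lemma supported_U:
  assumes x: "x \<in> ar" and q: "Factorial_Ring.prime q" "q dvd g"
  shows "supported (U q) x"
proof (rule supported_if_product_kills[OF C.stableD(1)[OF stable_U] _ _ norm_polynomial_kills[OF x q]])
  show "map_poly padic_int_emb (\<Sum>i<q. Polynomial.monom 1 (i * (g div q))) = (\<Prod>a\<in>U q. [:- a, 1:])"
    unfolding prod_roots_of_unity_quotient[OF prim_root_z q(2)] by (simp add: C.pm.hom_sum)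
  show "x \<in> carrier V" using x by (simp add: ar_def)
qed

definition n :: nat where "n = multiplicity CARD('p) g"

definition g0 :: nat where "g0 = g div CARD('p) ^ n"

lemma g0: "g = g0 * CARD('p) ^ n" "\<not> CARD('p) dvd g0"
proof -
  have d: "CARD('p) ^ n dvd g" unfolding n_def by (rule multiplicity_dvd)
  then show "g = g0 * CARD('p) ^ n" by (simp add: g0_def)
  show "\<not> CARD('p) dvd g0"
    unfolding g0_def n_def using g_pos prime_gt_1_nat[OF prime_CARD[where 'p = 'p]]
    by (intro multiplicity_decompose) auto
qed

lemma padic_roots: "prim_root g w \<Longrightarrow> padic_roots w g g0 n" for w :: "'p padic_closure"
  using g0 by (simp add: padic_roots_def)

lemma unit_difference:
  assumes "a ^ g = 1" "b ^ g = 1" "a ^ (CARD('p) ^ n) \<noteq> b ^ (CARD('p) ^ n)"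
  shows "C.Bunit (b - a)"
  by (rule padic_roots.different_p_free_parts_unit[OF padic_roots[OF prim_root_z] assms])

lemma root_of_unity_gcd:
  assumes "w ^ a = 1" "w ^ b = (1::'p padic_closure)" "a > 0"
  shows "w ^ gcd a b = 1"
proof -
  obtain u v where uv: "a * u = b * v + gcd a b" using bezout_nat[of a b] assms(3) by auto
  have "w ^ (a * u) = w ^ (b * v) * w ^ gcd a b" unfolding uv by (rule power_add)
  then show ?thesis using assms by (simp add: power_mult)
qed

text \<open>A root \<open>a\<close> outside \<open>U q\<close> has an order dividing \<open>g div q\<close>, and the \<open>b\<close> in \<open>U q\<close> do not. Passing to \<open>p\<close>-th
  powers preserves this distinction when \<open>q\<close> is different from \<open>p\<close>, so \<open>a\<close> and \<open>b\<close> have different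
  \<open>p\<close>-free parts and \<open>b - a\<close> is a unit.\<close>

lemma supported_Int_U:
  assumes x: "x \<in> ar" "supported S x" "C.stable S" and q: "Factorial_Ring.prime q" "q dvd g" "q \<noteq> CARD('p)"
  shows "supported (S \<inter> U q) x"
proof (rule supported_Int[OF x(2) supported_U[OF x(1) q(1,2)] x(3) stable_U])
  fix a b assume a: "a \<in> S - U q" and b: "b \<in> U q"
  have ag: "a ^ g = 1" using C.stableD(2)[OF x(3)] a by blast
  then have a1: "a ^ (g div q) = 1" using a by blast
  show "C.Bunit (b - a)"
  proof (rule unit_difference[OF ag], use b in blast, rule notI)
    assume eq: "a ^ (CARD('p) ^ n) = b ^ (CARD('p) ^ n)"
    have "b ^ (g div q * CARD('p) ^ n) = (b ^ (CARD('p) ^ n)) ^ (g div q)"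
      by (simp add: power_mult[symmetric] mult.commute)
    also have "\<dots> = (a ^ (g div q)) ^ (CARD('p) ^ n)"
      unfolding eq[symmetric] by (simp add: power_mult[symmetric] mult.commute)
    finally have 1: "b ^ (g div q * CARD('p) ^ n) = 1" by (simp add: a1)
    have "coprime q (CARD('p) ^ n)" using primes_coprime[OF q(1) prime_CARD q(3)] by simp
    then have "gcd (g div q * q) (g div q * CARD('p) ^ n) = g div q" by (simp add: gcd_mult_distrib_nat[symmetric])
    then have gcd: "gcd g (g div q * CARD('p) ^ n) = g div q" using q(2) by simp
    have "b ^ g = 1" using b by blast
    then have "b ^ (g div q) = 1" using root_of_unity_gcd[OF _ 1 g_pos] unfolding gcd by blast
    then show False using b by blast
  qed
qed

lemma primitive_if_no_proper_order:
  fixes w :: "'p padic_closure"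
  assumes w: "w ^ g = 1" "\<And>q. Factorial_Ring.prime q \<Longrightarrow> q dvd g \<Longrightarrow> w ^ (g div q) \<noteq> 1"
  shows "prim_root g w"
proof -
  obtain i where i: "w = z ^ i" using root_of_unity_power[OF prim_root_z w(1)] by blast
  have "coprime i g"
  proof (rule ccontr)
    assume "\<not> coprime i g"
    then obtain q where q: "Factorial_Ring.prime q" "q dvd gcd i g"
      using prime_factor_nat[of "gcd i g"] by (auto simp: coprime_iff_gcd_eq_1)
    then obtain j k where jk: "i = q * j" "g = q * k" by (auto elim!: dvdE)
    have "w ^ (g div q) = (z ^ g) ^ j" unfolding i
      using jk prime_gt_0_nat[OF q(1)] by (simp add: power_mult[symmetric] mult_ac)
    then show False using w(2)[OF q(1)] jk prim_rootD(3)[OF prim_root_z] by simp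
  qed
  then show ?thesis using prim_root_power_coprime[OF prim_root_z] i by simp
qed

text \<open>The primitive roots are the intersection of the sets \<open>U q\<close> for the primes \<open>q\<close> dividing \<open>g\<close>. The set for
  \<open>q = p\<close> has to be the first one: for it, the differences in question need not be units, whereas
  intersecting with the other sets is harmless whatever the set to begin with.\<close>

lemma ar_supported:
  assumes x: "x \<in> ar"
  shows "supported {w. prim_root g w} x"
proof -
  \<comment> \<open>without a factor \<open>p\<close> in \<open>g\<close>, the intersection starts from all \<open>g\<close>-th roots of unity\<close>
  define S where "S = (if CARD('p) dvd g then U CARD('p) else {w. w ^ g = 1})"
  have S: "C.stable S" unfolding S_def using stable_U stable_roots by simp
  have xV: "x \<in> carrier V" using x by (simp add: ar_def)
  have xS: "supported S x" unfolding S_def using supported_U[OF x prime_CARD[where 'p = 'p]] supported_roots[OF xV] by simp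
  define Q where "Q = {q. Factorial_Ring.prime q \<and> q dvd g \<and> q \<noteq> CARD('p)}"
  have finQ: "finite Q" unfolding Q_def by (rule finite_subset[OF _ finite_divisors_nat[OF g_pos]]) blast
  have "supported (S \<inter> (\<Inter>q\<in>Q'. U q)) x \<and> C.stable (S \<inter> (\<Inter>q\<in>Q'. U q))" if "Q' \<subseteq> Q" for Q'
    using finite_subset[OF that finQ] that
  proof (induction Q' rule: finite_induct)
    case empty
    then show ?case using xS S by simp
  next
    case (insert q Q')
    then have IH: "supported (S \<inter> (\<Inter>q\<in>Q'. U q)) x" "C.stable (S \<inter> (\<Inter>q\<in>Q'. U q))" by blast+
    have q: "Factorial_Ring.prime q" "q dvd g" "q \<noteq> CARD('p)" using insert.prems by (simp_all add: Q_def)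
    have eq: "S \<inter> (\<Inter>q\<in>insert q Q'. U q) = (S \<inter> (\<Inter>q\<in>Q'. U q)) \<inter> U q" by blast
    show ?case unfolding eq by (intro conjI supported_Int_U[OF x IH q] C.stable_ops(1)[OF IH(2) stable_U])
  qed
  then have sup: "supported (S \<inter> (\<Inter>q\<in>Q. U q)) x" by blast
  have sub: "S \<inter> (\<Inter>q\<in>Q. U q) \<subseteq> {w. prim_root g w}"
  proof
    fix w assume w: "w \<in> S \<inter> (\<Inter>q\<in>Q. U q)"
    have "prim_root g w"
    proof (rule primitive_if_no_proper_order)
      show "w ^ g = 1" using C.stableD(2)[OF S] w by blast
      fix q assume q: "Factorial_Ring.prime q" "q dvd g"
      show "w ^ (g div q) \<noteq> 1"
      proof (cases "q = CARD('p)")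
        case True
        then have "w \<in> U CARD('p)" using w q(2) unfolding S_def by simp
        then show ?thesis using True by blast
      next
        case False
        then have "q \<in> Q" using q by (simp add: Q_def)
        then show ?thesis using w by blast
      qed
    qed
    then show "w \<in> {w. prim_root g w}" by simp
  qed
  show ?thesis unfolding supported_def
    using supportedD(1)[OF sup] supportedD(2)[OF sup] sub by blast
qed

end

section \<open>The decomposition\<close>

context cyclic_character_module
begin

abbreviation Prim :: "'p padic_closure set" where "Prim \<equiv> {w. prim_root g w}"

abbreviation \<chi> :: "qab_aut \<Rightarrow> 'p padic_closure" where "\<chi> \<equiv> conjugate_sum \<rat> \<psi>"

abbreviation I :: "(qab_aut \<Rightarrow> 'p padic_closure) set" where "I \<equiv> padic_components \<chi>"

text \<open>The roots of unity that correspond to the terms of \<open>\<phi>\<close>. Defined in this way, the parts of distinct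
  \<open>\<phi>\<close> are disjoint; that they are orbits follows from the independence of characters.\<close>

definition part :: "(qab_aut \<Rightarrow> 'p padic_closure) \<Rightarrow> 'p padic_closure set" where
  "part \<phi> = {w. prim_root g w \<and> conjugate_sum Qp (char_of w) = \<phi>}"

lemma part_eq_orbit:
  assumes w: "prim_root g w"
  shows "part (conjugate_sum Qp (char_of w)) = orbit Qp w"
proof (intro equalityI subsetI)
  fix y assume y: "y \<in> orbit Qp w"
  show "y \<in> part (conjugate_sum Qp (char_of w))"
    unfolding part_def using orbit_prim_root[OF field_set_Qp w y] conjugate_sum_eq[OF w y] by simp
next
  fix y assume "y \<in> part (conjugate_sum Qp (char_of w))"
  then have y: "prim_root g y" "conjugate_sum Qp (char_of y) = conjugate_sum Qp (char_of w)"
    by (simp_all add: part_def)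
  have "char_of ` orbit Qp y = char_of ` orbit Qp w"
    unfolding terms_of_padic[OF y(1), symmetric] terms_of_padic[OF w, symmetric] y(2) ..
  then have "char_of y \<in> char_of ` orbit Qp w" using imageI[OF orbit_refl[OF y(1)], of char_of] by simp
  then obtain y' where y': "y' \<in> orbit Qp w" "char_of y = char_of y'" by blast
  have "y = char_of y s" by (rule char_of_s[OF prim_rootD(3)[OF y(1)], symmetric])
  also have "\<dots> = y'"
    unfolding y'(2) by (rule char_of_s[OF prim_rootD(3)[OF orbit_prim_root[OF field_set_Qp w y'(1)]]])
  finally show "y \<in> orbit Qp w" using y'(1) by simp
qed

lemma component_cases:
  assumes "\<phi> \<in> I"
  obtains w where "prim_root g w" "\<phi> = conjugate_sum Qp (char_of w)"
  using assms unfolding padic_components_eq by blast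

lemma finite_components: "finite I"
  unfolding padic_components_eq by (rule finite_imageI[OF finite_prim_roots])

lemma stable_prim: "C.stable Prim"
  unfolding C.stable_def
proof (intro conjI ballI subsetI)
  fix w assume "w \<in> Prim" then show "w \<in> {w. w ^ g = 1}" using prim_rootD(3) by blast
next
  fix \<tau> y assume t: "\<tau> \<in> C.Gal" and "y \<in> \<tau> ` Prim"
  then obtain w where w: "prim_root g w" "y = \<tau> w" by blast
  have "y \<in> orbit Qp w" unfolding orbit_def w(2) using t by (rule imageI)
  then show "y \<in> Prim" using orbit_prim_root[OF field_set_Qp w(1)] by simp
qed

text \<open>Otherwise \<open>a\<close> and \<open>b\<close> would have the same \<open>p\<close>-free part and hence be conjugate.\<close>

lemma part_separated:
  assumes w: "prim_root g w" and a: "prim_root g a" "a \<notin> orbit Qp w" and b: "b \<in> orbit Qp w"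
  shows "C.Bunit (b - a)"
proof (rule unit_difference)
  have pb: "prim_root g b" by (rule orbit_prim_root[OF field_set_Qp w b])
  show "a ^ g = 1" "b ^ g = 1" using prim_rootD(3) a(1) pb by blast+
  show "a ^ (CARD('p) ^ n) \<noteq> b ^ (CARD('p) ^ n)"
  proof
    assume eq: "a ^ (CARD('p) ^ n) = b ^ (CARD('p) ^ n)"
    obtain \<tau> where "\<tau> \<in> carrier (gal_group (adj Qp b) Qp)" "\<tau> b = a"
      using padic_roots.padic_conjugate[OF padic_roots[OF pb] a(1) eq] by blast
    then have "a \<in> orbit Qp b" unfolding orbit_def adj_prim_root[OF field_set_Qp pb] by blast
    then show False using a(2) orbit_eq[OF w b] by simp
  qed
qed

lemma component_idempotent:
  assumes "\<phi> \<in> I"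
  shows "\<exists>e. (\<forall>a\<in>Prim - part \<phi>. ev e a = 0) \<and> (\<forall>b\<in>part \<phi>. ev e b = 1)"
proof -
  obtain w where w: "prim_root g w" "\<phi> = conjugate_sum Qp (char_of w)" using component_cases[OF assms] .
  have eq: "part \<phi> = orbit Qp w" unfolding w(2) by (rule part_eq_orbit[OF w(1)])
  note st = orbit_stable[OF w(1)]
  have units: "C.Bunit (b - a)" if "a \<in> Prim - orbit Qp w" "b \<in> orbit Qp w" for a b
    using that by (intro part_separated[OF w(1)]) simp_all
  show ?thesis
    unfolding eq by (rule C.separating_polynomial[OF C.stable_ops(2)[OF stable_prim st] st units]) blast+
qed

text \<open>Modulo the polynomials that vanish on \<open>Prim\<close>, these are the orthogonal idempotents with sum \<open>1\<close> that
  belong to the decomposition of \<open>Prim\<close> into parts.\<close>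

definition idem :: "(qab_aut \<Rightarrow> 'p padic_closure) \<Rightarrow> 'p padic_int poly" where
  "idem \<phi> = (SOME e. (\<forall>a\<in>Prim - part \<phi>. ev e a = 0) \<and> (\<forall>b\<in>part \<phi>. ev e b = 1))"

lemma idem:
  assumes "\<phi> \<in> I"
  shows "prim_root g a \<Longrightarrow> ev (idem \<phi>) a = (if a \<in> part \<phi> then 1 else 0)"
  using someI_ex[OF component_idempotent[OF assms], folded idem_def] by simp

definition arphi :: "(qab_aut \<Rightarrow> 'p padic_closure) \<Rightarrow> 'a set" where
  "arphi \<phi> = {x \<in> ar. V.act (P_phi K \<sigma> \<phi>) x = \<zero>\<^bsub>V\<^esub>}"

lemma ev_P_phi:
  assumes "\<phi> \<in> I"
  shows "map_poly padic_int_emb (P_phi K \<sigma> \<phi>) = (\<Prod>a\<in>part \<phi>. [:- a, 1:])" "finite (part \<phi>)"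
proof -
  obtain w where w: "prim_root g w" "\<phi> = conjugate_sum Qp (char_of w)" using component_cases[OF assms] .
  show "map_poly padic_int_emb (P_phi K \<sigma> \<phi>) = (\<Prod>a\<in>part \<phi>. [:- a, 1:])"
    unfolding w(2) part_eq_orbit[OF w(1)] by (rule P_phi_eq[OF w(1)])
  show "finite (part \<phi>)" by (rule finite_subset[OF _ finite_prim_roots]) (auto simp: part_def)
qed

lemma arphi_supported:
  assumes phi: "\<phi> \<in> I" and x: "x \<in> arphi \<phi>"
  shows "supported (part \<phi>) x"
  by (rule supported_if_product_kills[OF ev_P_phi(2,1)[OF phi]]) (use x in \<open>simp_all add: arphi_def ar_def\<close>)

lemma submodule_ar: "submodule ar V.RG V"
proof -
  have mods: "module V.RG (M k)" and hom: "N K k \<in> module_hom V.RG V (M k)"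
    if "field_set k" "k \<subset> K" for k
    using KK_subfield[OF K(4) that(1)] that(2) arithmetic_family.modules[OF family]
      arithmetic_family.N_hom[OF family _ K(4)] by blast+
  show ?thesis
  proof (rule V.submoduleI)
    show "ar \<subseteq> carrier V" by (auto simp: ar_def)
    show "\<zero>\<^bsub>V\<^esub> \<in> ar"
      unfolding ar_def using module_hom_zero(1)[OF V.module_axioms mods hom] by simp
  next
    fix a assume a: "a \<in> ar"
    have aV: "a \<in> carrier V" using a by (simp add: ar_def)
    have "N K k (\<ominus>\<^bsub>V\<^esub> a) = \<zero>\<^bsub>M k\<^esub>" if k: "field_set k" "k \<subset> K" for k
    proof -
      interpret k: module V.RG "M k" by (rule mods[OF k])
      have "N K k a = \<zero>\<^bsub>M k\<^esub>" using a k by (simp add: ar_def)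
      then show ?thesis using module_hom_zero(2)[OF V.module_axioms mods[OF k] hom[OF k] aV] by simp
    qed
    then show "\<ominus>\<^bsub>V\<^esub> a \<in> ar" using aV by (simp add: ar_def)
  next
    fix a b assume ab: "a \<in> ar" "b \<in> ar"
    have V: "a \<in> carrier V" "b \<in> carrier V" using ab by (simp_all add: ar_def)
    have "N K k (a \<oplus>\<^bsub>V\<^esub> b) = \<zero>\<^bsub>M k\<^esub>" if k: "field_set k" "k \<subset> K" for k
    proof -
      interpret k: module V.RG "M k" by (rule mods[OF k])
      have 0: "N K k a = \<zero>\<^bsub>M k\<^esub>" "N K k b = \<zero>\<^bsub>M k\<^esub>" using ab k by (simp_all add: ar_def)
      have "N K k (a \<oplus>\<^bsub>V\<^esub> b) = N K k a \<oplus>\<^bsub>M k\<^esub> N K k b"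
        using hom[OF k] V unfolding module_hom_def by blast
      then show ?thesis by (simp add: 0)
    qed
    then show "a \<oplus>\<^bsub>V\<^esub> b \<in> ar" using V by (simp add: ar_def)
  next
    fix r x assume r: "r \<in> carrier V.RG" and x: "x \<in> ar"
    have V: "x \<in> carrier V" using x by (simp add: ar_def)
    have "N K k (r \<odot>\<^bsub>V\<^esub> x) = \<zero>\<^bsub>M k\<^esub>" if k: "field_set k" "k \<subset> K" for k
    proof -
      interpret k: module V.RG "M k" by (rule mods[OF k])
      have 0: "N K k x = \<zero>\<^bsub>M k\<^esub>" using x k by (simp add: ar_def)
      have "N K k (r \<odot>\<^bsub>V\<^esub> x) = r \<odot>\<^bsub>M k\<^esub> N K k x"
        using hom[OF k] V r unfolding module_hom_def by blast
      then show ?thesis unfolding 0 by (simp only: k.smult_r_null[OF r])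
    qed
    then show "r \<odot>\<^bsub>V\<^esub> x \<in> ar" using V.smult_closed[OF r V] by (simp add: ar_def)
  qed
qed

lemmas ar_closed = V.submoduleE[OF submodule_ar]

lemma ar_zero: "\<zero>\<^bsub>V\<^esub> \<in> ar"
  using subgroup.one_closed[OF submodule.axioms(1)[OF submodule_ar]] by simp

lemma ar_carrier: "x \<in> ar \<Longrightarrow> x \<in> carrier V" by (simp add: ar_def)

lemma submodule_arphi: "submodule (arphi \<phi>) V.RG V"
proof (rule V.submoduleI)
  show "arphi \<phi> \<subseteq> carrier V" using ar_carrier by (auto simp: arphi_def)
  show "\<zero>\<^bsub>V\<^esub> \<in> arphi \<phi>" by (simp add: arphi_def ar_zero V.act_zero_right)
next
  fix a assume a: "a \<in> arphi \<phi>"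
  then have V: "a \<in> ar" "a \<in> carrier V" using ar_carrier by (simp_all add: arphi_def)
  have "V.act (P_phi K \<sigma> \<phi>) a \<oplus>\<^bsub>V\<^esub> V.act (P_phi K \<sigma> \<phi>) (\<ominus>\<^bsub>V\<^esub> a) = \<zero>\<^bsub>V\<^esub>"
    using V.act_add_right[OF V(2) V.M.a_inv_closed[OF V(2)], symmetric]
    by (simp only: V.M.r_neg[OF V(2)] V.act_zero_right)
  then have "V.act (P_phi K \<sigma> \<phi>) (\<ominus>\<^bsub>V\<^esub> a) = \<zero>\<^bsub>V\<^esub>"
    using a V.act_closed[OF V.M.a_inv_closed[OF V(2)]] by (simp add: arphi_def)
  then show "\<ominus>\<^bsub>V\<^esub> a \<in> arphi \<phi>" using ar_closed(3)[OF V(1)] by (simp add: arphi_def)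
next
  fix a b assume ab: "a \<in> arphi \<phi>" "b \<in> arphi \<phi>"
  then have V: "a \<in> ar" "b \<in> ar" by (simp_all add: arphi_def)
  show "a \<oplus>\<^bsub>V\<^esub> b \<in> arphi \<phi>"
    using ab ar_closed(5)[OF V] V.act_add_right[OF ar_carrier[OF V(1)] ar_carrier[OF V(2)]] by (simp add: arphi_def)
next
  fix r x assume r: "r \<in> carrier V.RG" and x: "x \<in> arphi \<phi>"
  then have V: "x \<in> ar" by (simp add: arphi_def)
  have "V.act (P_phi K \<sigma> \<phi>) (r \<odot>\<^bsub>V\<^esub> x) = \<zero>\<^bsub>V\<^esub>"
    using x V.smult_r_null[OF r] unfolding V.act_smult[OF r ar_carrier[OF V]] by (simp add: arphi_def)
  then show "r \<odot>\<^bsub>V\<^esub> x \<in> arphi \<phi>" using ar_closed(4)[OF r V] by (simp add: arphi_def)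
qed

lemma ar_finsum:
  assumes "finite A" "\<And>i. i \<in> A \<Longrightarrow> f i \<in> ar"
  shows "finsum V f A \<in> ar"
  using assms
proof (induction A rule: finite_induct)
  case (insert i A)
  have "f \<in> A \<rightarrow> carrier V" "f i \<in> carrier V" using insert.prems ar_carrier by blast+
  then show ?case using insert ar_closed(5)[of "f i" "finsum V f A"] by simp
qed (simp add: ar_zero)

lemma ar_act: "x \<in> ar \<Longrightarrow> V.act r x \<in> ar"
  unfolding V.act_def by (rule ar_closed(4)[OF V.gr_poly_closed])

lemma act_idem_arphi:
  assumes phi: "\<phi> \<in> I" "\<theta> \<in> I" and x: "x \<in> arphi \<theta>"
  shows "V.act (idem \<phi>) x = (if \<theta> = \<phi> then x else \<zero>\<^bsub>V\<^esub>)"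
proof -
  note sup = arphi_supported[OF phi(2) x]
  note xV = supportedD(1)[OF sup]
  have prim: "prim_root g a" if "a \<in> part \<theta>" for a using that by (simp add: part_def)
  show ?thesis
  proof (cases "\<theta> = \<phi>")
    case True
    have "V.act (idem \<phi> - 1) x = \<zero>\<^bsub>V\<^esub>"
    proof (rule supportedD(2)[OF sup])
      fix a assume a: "a \<in> part \<theta>"
      then show "ev (idem \<phi> - 1) a = 0" using idem[OF phi(1) prim[OF a]] True by (simp add: ev_simps)
    qed
    then have "V.act (idem \<phi>) x = V.act 1 x" by (rule V.act_diff_eq[OF xV])
    then show ?thesis using True by (simp add: V.act_1[OF xV])
  next
    case False
    have "V.act (idem \<phi>) x = \<zero>\<^bsub>V\<^esub>"
    proof (rule supportedD(2)[OF sup])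
      fix a assume a: "a \<in> part \<theta>"
      have "a \<notin> part \<phi>" using a False by (simp add: part_def)
      then show "ev (idem \<phi>) a = 0" using idem[OF phi(1) prim[OF a]] by simp
    qed
    then show ?thesis using False by simp
  qed
qed

lemma act_idem_in_arphi:
  assumes phi: "\<phi> \<in> I" and x: "x \<in> ar"
  shows "V.act (idem \<phi>) x \<in> arphi \<phi>"
proof -
  have "V.act (P_phi K \<sigma> \<phi> * idem \<phi>) x = \<zero>\<^bsub>V\<^esub>"
  proof (rule supportedD(2)[OF ar_supported[OF x]])
    fix a assume "a \<in> Prim"
    then have a: "prim_root g a" by simp
    show "ev (P_phi K \<sigma> \<phi> * idem \<phi>) a = 0"
    proof (cases "a \<in> part \<phi>")
      case True
      have "ev (P_phi K \<sigma> \<phi>) a = 0"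
        unfolding ev_P_phi(1)[OF phi] poly_prod using ev_P_phi(2)[OF phi] True by (intro prod_zero) auto
      then show ?thesis by (simp add: ev_simps)
    next
      case False
      then show ?thesis using idem[OF phi a] by (simp add: ev_simps)
    qed
  qed
  then show ?thesis using ar_act[OF x] by (simp add: arphi_def V.act_mult[OF ar_carrier[OF x]])
qed

lemma sum_idem:
  assumes x: "x \<in> ar"
  shows "finsum V (\<lambda>\<phi>. V.act (idem \<phi>) x) I = x"
proof -
  note xV = ar_carrier[OF x]
  have "V.act ((\<Sum>\<phi>\<in>I. idem \<phi>) - 1) x = \<zero>\<^bsub>V\<^esub>"
  proof (rule supportedD(2)[OF ar_supported[OF x]])
    fix a assume "a \<in> Prim"
    then have a: "prim_root g a" by simp
    define \<theta> where "\<theta> = conjugate_sum Qp (char_of a)"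
    have th: "\<theta> \<in> I" unfolding padic_components_eq \<theta>_def using a by blast
    have "ev (\<Sum>\<phi>\<in>I. idem \<phi>) a = (\<Sum>\<phi>\<in>I. if \<theta> = \<phi> then 1 else 0)"
      unfolding ev_sum[OF finite_components]
      by (rule sum.cong[OF refl]) (simp add: idem[OF _ a] part_def a \<theta>_def)
    also have "\<dots> = 1" using th finite_components by simp
    finally show "ev ((\<Sum>\<phi>\<in>I. idem \<phi>) - 1) a = 0" by (simp add: ev_simps)
  qed
  then have "V.act (\<Sum>\<phi>\<in>I. idem \<phi>) x = V.act 1 x" by (rule V.act_diff_eq[OF xV])
  then show ?thesis by (simp only: V.act_sum[OF xV finite_components] V.act_1[OF xV])
qed

text \<open>The projection to the summand of \<open>\<phi>\<close> is the action of \<open>idem \<phi>\<close>.\<close>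

theorem ar_direct_sum: "internal_direct_sum V.RG V ar I arphi"
  unfolding internal_direct_sum_def
proof (intro conjI ballI finite_components submodule_ar submodule_arphi)
  have sub: "f \<phi> \<in> ar" if "f \<in> (\<Pi>\<^sub>E \<phi>\<in>I. arphi \<phi>)" "\<phi> \<in> I" for f \<phi>
    using PiE_mem[OF that] by (simp add: arphi_def)
  show "bij_betw (\<lambda>f. finsum V f I) (\<Pi>\<^sub>E \<phi>\<in>I. arphi \<phi>) ar"
  proof (rule bij_betwI[where g = "\<lambda>x. \<lambda>\<phi>\<in>I. V.act (idem \<phi>) x"])
    show "(\<lambda>f. finsum V f I) \<in> (\<Pi>\<^sub>E \<phi>\<in>I. arphi \<phi>) \<rightarrow> ar"
      using ar_finsum[OF finite_components] sub by blast
    show "(\<lambda>x. \<lambda>\<phi>\<in>I. V.act (idem \<phi>) x) \<in> ar \<rightarrow> (\<Pi>\<^sub>E \<phi>\<in>I. arphi \<phi>)"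
      using act_idem_in_arphi by (intro Pi_I restrict_PiE_iff[THEN iffD2] ballI)
  next
    fix x assume x: "x \<in> ar"
    have "finsum V (\<lambda>\<phi>\<in>I. V.act (idem \<phi>) x) I = finsum V (\<lambda>\<phi>. V.act (idem \<phi>) x) I"
      by (rule V.M.finsum_cong') (use V.act_closed[OF ar_carrier[OF x]] in auto)
    then show "finsum V (\<lambda>\<phi>\<in>I. V.act (idem \<phi>) x) I = x" by (simp only: sum_idem[OF x])
  next
    fix f assume f: "f \<in> (\<Pi>\<^sub>E \<phi>\<in>I. arphi \<phi>)"
    have fV: "f \<in> I \<rightarrow> carrier V" using sub[OF f] ar_carrier by blast
    show "(\<lambda>\<phi>\<in>I. V.act (idem \<phi>) (finsum V f I)) = f"
    proof (rule extensionalityI[of _ I])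
      fix \<phi> assume phi: "\<phi> \<in> I"
      have "V.act (idem \<phi>) (finsum V f I) = finsum V (\<lambda>\<theta>. V.act (idem \<phi>) (f \<theta>)) I"
        by (rule V.act_finsum[OF finite_components fV])
      also have "\<dots> = finsum V (\<lambda>\<theta>. if \<phi> = \<theta> then f \<theta> else \<zero>\<^bsub>V\<^esub>) I"
      proof (rule V.M.finsum_cong'[OF refl])
        show "(\<lambda>\<theta>. if \<phi> = \<theta> then f \<theta> else \<zero>\<^bsub>V\<^esub>) \<in> I \<rightarrow> carrier V" using fV by auto
        fix \<theta> assume th: "\<theta> \<in> I"
        show "V.act (idem \<phi>) (f \<theta>) = (if \<phi> = \<theta> then f \<theta> else \<zero>\<^bsub>V\<^esub>)"
          using act_idem_arphi[OF phi th PiE_mem[OF f th]] by auto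
      qed
      also have "\<dots> = f \<phi>" by (rule V.M.add.finprod_singleton[OF phi finite_components fV])
      finally show "(\<lambda>\<phi>\<in>I. V.act (idem \<phi>) (finsum V f I)) \<phi> = f \<phi>" using phi by simp
    qed (use f in \<open>auto simp: PiE_def\<close>)
  qed
qed

end

theorem theorem4p5:
  fixes M :: "complex set \<Rightarrow> ('p::prime_card, 'a) gal_module"
    and N J :: "complex set \<Rightarrow> complex set \<Rightarrow> 'a \<Rightarrow> 'a"
    and \<chi> :: "qab_aut \<Rightarrow> 'p padic_closure"
    and \<sigma> :: "complex \<Rightarrow> complex"
  assumes "arithmetic_family M N J"
    and "irreducible_character \<rat> \<chi>"
    and "\<sigma> \<in> carrier (gal_group (char_field \<chi>) \<rat>)"
    and "generate (gal_group (char_field \<chi>) \<rat>) {\<sigma>} = carrier (gal_group (char_field \<chi>) \<rat>)"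
  shows "internal_direct_sum (group_ring \<G>) (M (char_field \<chi>))
           (ar_chi M N \<chi>) (padic_components \<chi>) (ar_phi M N \<chi> \<sigma>)"
proof -
  obtain \<psi> where chi: "\<psi> \<in> characters" "\<chi> = conjugate_sum \<rat> \<psi>"
    using assms(2) unfolding irreducible_character_def by blast
  define \<psi>1 where "\<psi>1 = (SOME \<psi>. \<psi> \<in> terms_of \<rat> \<chi>)"
  have t: "terms_of \<rat> \<chi> = conjugates \<rat> \<psi>"
    unfolding chi(2) by (rule terms_of_conjugate_sum[OF field_set_Rats chi(1)])
  have "\<psi>1 \<in> terms_of \<rat> \<chi>"
    unfolding \<psi>1_def t by (rule someI[of "\<lambda>\<psi>'. \<psi>' \<in> conjugates \<rat> \<psi>", OF conjugates_refl[OF field_set_Rats chi(1)]])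
  then have c: "\<psi>1 \<in> conjugates \<rat> \<psi>" by (simp only: t)
  \<comment> \<open>the field of \<open>\<chi>\<close> is defined by a chosen term, but conjugate characters have the same kernel\<close>
  have "kernel_field \<psi>1 = kernel_field \<psi>"
    unfolding kernel_field_def using conjugatesD(3)[OF field_set_Rats chi(1) c] by auto
  then have field: "char_field \<chi> = kernel_field \<psi>" unfolding char_field_def \<psi>1_def .
  interpret cyclic_character_module \<psi> \<sigma> M N J
    by (intro cyclic_character_module.intro cyclic_character.intro cyclic_character_module_axioms.intro
        chi(1) assms(1) assms(3,4)[unfolded field])
  have "ar_chi M N \<chi> = ar"
    unfolding ar_chi_def ar_def field K_def subfield_iff_field_set ..
  moreover have "ar_phi M N \<chi> \<sigma> = arphi"
    unfolding ar_phi_def arphi_def ar_def field K_def[symmetric] subfield_iff_field_set V.act_def s_def[symmetric] by (auto simp: fun_eq_iff)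
  ultimately show ?thesis
    using ar_direct_sum unfolding field K_def[symmetric] unfolding chi(2) by simp
qed

end
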